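(* Let $\Bbbk$ be an algebraically closed field and $\mathcal{A}$ a basic $\Bbbk$-linear category with at most countably many objects and with finite-dimensional indecomposable projective and injective modules. Let $N\in\mathbb{N}$ and let $\mathcal{A}=\mathcal{I}_0\supsetneq\mathcal{I}_1\supsetneq\dots\supsetneq\mathcal{I}_N=0$ be a filtration of $\mathcal{A}$ by two-sided ideals such that $\mathcal{I}_i\mathcal{I}_j\subset\mathcal{I}_{i+j}$ for all $i,j$ (with $\mathcal{I}_m=0$ for $m\ge N$) and such that every $\mathcal{I}_i/\mathcal{I}_{i+1}$ is a semisimple $\mathcal{A}$-bimodule. Let $\mathfrak{C}=\mathfrak{C}(\mathcal{A})$ be the associated category (defined in the context). Then: (i) The left standard $\mathfrak{C}$-modules for the first order are given by the direct summands of the modules $\Delta^{1,l}_i$ ($i\in\mathbb{Z}$), the columns whose entry in row $j$ is $\mathcal{A}/\mathcal{I}_1$ if $i-N<j\le i$, and $0$ otherwise; that is, $\Delta^{1,l}_{\mathfrak C}(x,i)(y[j])=(\mathcal{A}/\mathcal{I}_1)(x,y)$ if $i-N<j\leq i$, and $0$ otherwise. (ii) The left standard $\mathfrak{C}$-modules for the second order are given by the direct summands of the columns whose entry in row $j$ is $\mathcal{I}_{j-i}/\mathcal{I}_{j-i+1}$ if $j\ge i$, and $0$ if $j<i$; that is, $\Delta^{2,l}_{\mathfrak C}(x,i)(y[j])=(\mathcal{I}_{j-i}/\mathcal{I}_{j-i+1})(x,y)$ if $j\geq i$, and $0$ otherwise. (iii) The right standard $\mathfrak{C}$-modules for the first order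 are given by the direct summands of the rows whose entry in column $j$ is $\mathcal{I}_{i-j}/\mathcal{I}_{i-j+1}$ if $j\le i$, and $0$ if $j>i$; that is, $\Delta^{1,r}_{\mathfrak C}(x,i)(y[j])=(\mathcal{I}_{i-j}/\mathcal{I}_{i-j+1})(y,x)$ if $j\leq i$, and $0$ otherwise. (iv) The right standard $\mathfrak{C}$-modules for the second order are given by the direct summands of the rows whose entry in column $j$ is $\mathcal{A}/\mathcal{I}_1$ if $i\le j<i+N$, and $0$ otherwise; that is, $\Delta^{2,r}_{\mathfrak C}(x,i)(y[j])=(\mathcal{A}/\mathcal{I}_1)(y,x)$ if $i\leq j<i+N$, and $0$ otherwise. (v) The category $\mathfrak{C}$ is quasi-hereditary with respect to both the first and the second order. In (i)--(iv) the action of $\mathfrak{C}$ is the one induced by the multiplication in $\mathcal{A}$.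
   Context: Basic: distinct objects are non-isomorphic and all endomorphism algebras are local. Finite-dimensional projectives and injectives: for every object $x$, both $\bigoplus_y\mathcal{A}(x,y)$ and $\bigoplus_y\mathcal{A}(y,x)$ are finite-dimensional. The category $\mathfrak{C}=\mathfrak{C}(\mathcal{A})$ has objects $x[i]$, $x\in\mathcal{A}$, $i\in\mathbb{Z}$, and morphism spaces $$\mathfrak{C}(x[i],y[j])=\begin{cases}\mathcal{I}_{j-i}(x,y), & j>i,\\ \mathcal{A}(x,y)/\mathcal{I}_{N-(i-j)}(x,y), & 0\le i-j<N,\\ 0,& i-j\ge N,\end{cases}$$ (where $\mathcal{I}_m=0$ for $m\geq N$) with composition induced by composition in $\mathcal{A}$; this is well defined. The space $\mathfrak{C}(x[i],y[j])$ is thought of as placed in row $j$, column $i$ of an infinite matrix. Left modules are covariant functors $\mathfrak{C}\to\Bbbk\text{-mod}$ (columns; the left projective $P(x,i)$ is $\mathfrak{C}(x[i],-)$), right modules are contravariant functors (rows; the right projective at $(x,i)$ is $\mathfrak{C}(-,x[i])$). Simple modules are indexed by pairs $(x,i)$. First order: $(x,i)<(y,j)$ iff $i<j$. Second order: $(x,i)<(y,j)$ iff $i>j$. For a given partial order on the index set, the standard module $\Delta(\lambda)$ (left or right) is the quotient of the (left or right) indecomposable projective $P(\lambda)$ by the sum of images of all homomorphisms $P(\mu)\to P(\lambda)$, $\mu>\lambda$. Superscripts $1,2$ refer to the first/second order and $l,r$ to left/right modules. Quasi-hereditary with respect to an order: for every $\lambda$, $\mathrm{End}(\Delta(\lambda))=\Bbbk$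 and $P(\lambda)$ has a finite filtration whose top subquotient is $\Delta(\lambda)$ and whose other subquotients are of the form $\Delta(\mu)$ with $\mu>\lambda$. *)

theory Defs
  imports "HOL-Algebra.Algebra" "HOL-Library.Countable_Set"
begin

section \<open>Vector spaces\<close>

text \<open>
  Vector spaces are modules over a field in the sense of HOL-Algebra; the fields \<open>mult\<close> and \<open>one\<close>
  of the record are irrelevant.  The subspace of \<open>V\<close> on \<open>W\<close> is \<open>V\<lparr>carrier := W\<rparr>\<close>.
\<close>

definition linear_hom ::
    "('k, 'c) ring_scheme \<Rightarrow> ('k, 'v) module \<Rightarrow> ('k, 'w) module \<Rightarrow> ('v \<Rightarrow> 'w) \<Rightarrow> bool" where
  "linear_hom K V W f \<longleftrightarrow>
     f \<in> carrier V \<rightarrow> carrier W \<and>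
     (\<forall>u\<in>carrier V. \<forall>v\<in>carrier V. f (u \<oplus>\<^bsub>V\<^esub> v) = f u \<oplus>\<^bsub>W\<^esub> f v) \<and>
     (\<forall>c\<in>carrier K. \<forall>v\<in>carrier V. f (c \<odot>\<^bsub>V\<^esub> v) = c \<odot>\<^bsub>W\<^esub> f v)"

definition lin_span :: "('k, 'c) ring_scheme \<Rightarrow> ('k, 'v) module \<Rightarrow> 'v set \<Rightarrow> 'v set" where
  "lin_span K V S = (\<lambda>W. submodule W K V) hull S"

definition fin_dim :: "('k, 'c) ring_scheme \<Rightarrow> ('k, 'v) module \<Rightarrow> bool" where
  "fin_dim K V \<longleftrightarrow> (\<exists>S. finite S \<and> S \<subseteq> carrier V \<and> lin_span K V S = carrier V)"

definition quot_space :: "('k, 'v) module \<Rightarrow> 'v set \<Rightarrow> ('k, 'v set) module" where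
  "quot_space V W =
     \<lparr>carrier = a_rcosets\<^bsub>V\<^esub> W, monoid.mult = undefined, one = undefined,
      ring.zero = W, ring.add = (<+>\<^bsub>V\<^esub>),
      smult = (\<lambda>c Y. \<Union>v\<in>Y. W +>\<^bsub>V\<^esub> (c \<odot>\<^bsub>V\<^esub> v))\<rparr>"

text \<open>External direct sum: families in \<open>\<Pi>\<^sub>E\<close> with finite support.\<close>

definition dsum :: "'j set \<Rightarrow> ('j \<Rightarrow> ('k, 'v) module) \<Rightarrow> ('k, 'j \<Rightarrow> 'v) module" where
  "dsum J V =
     \<lparr>carrier = {f \<in> \<Pi>\<^sub>E j\<in>J. carrier (V j). finite {j\<in>J. f j \<noteq> \<zero>\<^bsub>V j\<^esub>}},
      monoid.mult = undefined, one = undefined,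
      ring.zero = (\<lambda>j\<in>J. \<zero>\<^bsub>V j\<^esub>), ring.add = (\<lambda>f g. \<lambda>j\<in>J. f j \<oplus>\<^bsub>V j\<^esub> g j),
      smult = (\<lambda>c f. \<lambda>j\<in>J. c \<odot>\<^bsub>V j\<^esub> f j)\<rparr>"


section \<open>Linear categories\<close>

text \<open>
  \<open>comp C x y z g f\<close> is the composite \<open>g \<circ> f\<close> of \<open>f : x \<rightarrow> y\<close> and \<open>g : y \<rightarrow> z\<close>.  Morphism spaces need
  not be disjoint, which is why composition takes the objects as arguments.
\<close>

record ('k, 'o, 'm) lincat =
  obj :: "'o set"
  mor :: "'o \<Rightarrow> 'o \<Rightarrow> ('k, 'm) module"
  comp :: "'o \<Rightarrow> 'o \<Rightarrow> 'o \<Rightarrow> 'm \<Rightarrow> 'm \<Rightarrow> 'm"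
  idm :: "'o \<Rightarrow> 'm"

locale linear_category = K: field K
  for K :: "('k, 'c) ring_scheme" and C :: "('k, 'o, 'm) lincat" +
  assumes mor_module: "\<lbrakk>x \<in> obj C; y \<in> obj C\<rbrakk> \<Longrightarrow> module K (mor C x y)"
    and comp_linear_right: "\<lbrakk>x \<in> obj C; y \<in> obj C; z \<in> obj C; g \<in> carrier (mor C y z)\<rbrakk>
      \<Longrightarrow> linear_hom K (mor C x y) (mor C x z) (\<lambda>f. comp C x y z g f)"
    and comp_linear_left: "\<lbrakk>x \<in> obj C; y \<in> obj C; z \<in> obj C; f \<in> carrier (mor C x y)\<rbrakk>
      \<Longrightarrow> linear_hom K (mor C y z) (mor C x z) (\<lambda>g. comp C x y z g f)"
    and comp_assoc: "\<lbrakk>w \<in> obj C; x \<in> obj C; y \<in> obj C; z \<in> obj C;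
        f \<in> carrier (mor C w x); g \<in> carrier (mor C x y); h \<in> carrier (mor C y z)\<rbrakk>
      \<Longrightarrow> comp C w y z h (comp C w x y g f) = comp C w x z (comp C x y z h g) f"
    and idm_closed: "x \<in> obj C \<Longrightarrow> idm C x \<in> carrier (mor C x x)"
    and comp_idm_right: "\<lbrakk>x \<in> obj C; y \<in> obj C; f \<in> carrier (mor C x y)\<rbrakk>
      \<Longrightarrow> comp C x x y f (idm C x) = f"
    and comp_idm_left: "\<lbrakk>x \<in> obj C; y \<in> obj C; f \<in> carrier (mor C x y)\<rbrakk>
      \<Longrightarrow> comp C x y y (idm C y) f = f"

definition opcat :: "('k, 'o, 'm) lincat \<Rightarrow> ('k, 'o, 'm) lincat" where
  "opcat C = \<lparr>obj = obj C, mor = (\<lambda>x y. mor C y x),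
              comp = (\<lambda>x y z g f. comp C z y x f g), idm = idm C\<rparr>"

definition isomorphic_objs :: "('k, 'o, 'm) lincat \<Rightarrow> 'o \<Rightarrow> 'o \<Rightarrow> bool" where
  "isomorphic_objs C x y \<longleftrightarrow>
     (\<exists>f\<in>carrier (mor C x y). \<exists>g\<in>carrier (mor C y x).
        comp C x y x g f = idm C x \<and> comp C y x y f g = idm C y)"

definition end_ring :: "('k, 'o, 'm) lincat \<Rightarrow> 'o \<Rightarrow> 'm ring" where
  "end_ring C x =
     \<lparr>carrier = carrier (mor C x x), monoid.mult = comp C x x x, one = idm C x,
      ring.zero = \<zero>\<^bsub>mor C x x\<^esub>, ring.add = (\<oplus>\<^bsub>mor C x x\<^esub>)\<rparr>"

text \<open>A (noncommutative) ring is local if its non-units form an ideal.  The zero ring is excluded, its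
  set of non-units being empty.\<close>

definition local_ring :: "('a, 'b) ring_scheme \<Rightarrow> bool" where
  "local_ring R \<longleftrightarrow> ideal (carrier R - Units R) R"

definition basic_category :: "('k, 'o, 'm) lincat \<Rightarrow> bool" where
  "basic_category C \<longleftrightarrow>
     (\<forall>x\<in>obj C. \<forall>y\<in>obj C. isomorphic_objs C x y \<longrightarrow> x = y) \<and>
     (\<forall>x\<in>obj C. local_ring (end_ring C x))"

definition fin_dim_projectives_injectives ::
    "('k, 'c) ring_scheme \<Rightarrow> ('k, 'o, 'm) lincat \<Rightarrow> bool" where
  "fin_dim_projectives_injectives K C \<longleftrightarrow>
     (\<forall>x\<in>obj C. fin_dim K (dsum (obj C) (\<lambda>y. mor C x y)) \<and>
                fin_dim K (dsum (obj C) (\<lambda>y. mor C y x)))"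


section \<open>Modules over linear categories\<close>

text \<open>
  Left modules are covariant functors to vector spaces: \<open>act M x y g : M x \<rightarrow> M y\<close> for \<open>g : x \<rightarrow> y\<close>.
  Right modules over \<open>C\<close> (contravariant functors) are left modules over \<open>opcat C\<close>.
\<close>

record ('k, 'o, 'm, 'v) catmod =
  val :: "'o \<Rightarrow> ('k, 'v) module"
  act :: "'o \<Rightarrow> 'o \<Rightarrow> 'm \<Rightarrow> 'v \<Rightarrow> 'v"

definition left_module ::
    "('k, 'c) ring_scheme \<Rightarrow> ('k, 'o, 'm) lincat \<Rightarrow> ('k, 'o, 'm, 'v) catmod \<Rightarrow> bool" where
  "left_module K C M \<longleftrightarrow>
     (\<forall>x\<in>obj C. module K (val M x)) \<and>
     (\<forall>x\<in>obj C. \<forall>y\<in>obj C. \<forall>g\<in>carrier (mor C x y).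
        linear_hom K (val M x) (val M y) (act M x y g)) \<and>
     (\<forall>x\<in>obj C. \<forall>y\<in>obj C. \<forall>v\<in>carrier (val M x).
        linear_hom K (mor C x y) (val M y) (\<lambda>g. act M x y g v)) \<and>
     (\<forall>x\<in>obj C. \<forall>v\<in>carrier (val M x). act M x x (idm C x) v = v) \<and>
     (\<forall>x\<in>obj C. \<forall>y\<in>obj C. \<forall>z\<in>obj C.
        \<forall>f\<in>carrier (mor C x y). \<forall>g\<in>carrier (mor C y z). \<forall>v\<in>carrier (val M x).
        act M x z (comp C x y z g f) v = act M y z g (act M x y f v))"

definition catmod_hom ::
    "('k, 'c) ring_scheme \<Rightarrow> ('k, 'o, 'm) lincat \<Rightarrow> ('k, 'o, 'm, 'v) catmod \<Rightarrow>
     ('k, 'o, 'm, 'w) catmod \<Rightarrow> ('o \<Rightarrow> 'v \<Rightarrow> 'w) \<Rightarrow> bool" where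
  "catmod_hom K C M L \<phi> \<longleftrightarrow>
     (\<forall>x\<in>obj C. linear_hom K (val M x) (val L x) (\<phi> x)) \<and>
     (\<forall>x\<in>obj C. \<forall>y\<in>obj C. \<forall>g\<in>carrier (mor C x y). \<forall>v\<in>carrier (val M x).
        \<phi> y (act M x y g v) = act L x y g (\<phi> x v))"

definition catmod_iso ::
    "('k, 'c) ring_scheme \<Rightarrow> ('k, 'o, 'm) lincat \<Rightarrow> ('k, 'o, 'm, 'v) catmod \<Rightarrow>
     ('k, 'o, 'm, 'w) catmod \<Rightarrow> bool" where
  "catmod_iso K C M L \<longleftrightarrow>
     left_module K C M \<and> left_module K C L \<and>
     (\<exists>\<phi>. catmod_hom K C M L \<phi> \<and>
          (\<forall>x\<in>obj C. bij_betw (\<phi> x) (carrier (val M x)) (carrier (val L x))))"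

definition catmod_sub ::
    "('k, 'c) ring_scheme \<Rightarrow> ('k, 'o, 'm) lincat \<Rightarrow> ('k, 'o, 'm, 'v) catmod \<Rightarrow>
     ('o \<Rightarrow> 'v set) \<Rightarrow> bool" where
  "catmod_sub K C M U \<longleftrightarrow>
     (\<forall>x\<in>obj C. submodule (U x) K (val M x)) \<and>
     (\<forall>x\<in>obj C. \<forall>y\<in>obj C. \<forall>g\<in>carrier (mor C x y). \<forall>v\<in>U x. act M x y g v \<in> U y)"

definition catmod_restrict ::
    "('k, 'o, 'm, 'v) catmod \<Rightarrow> ('o \<Rightarrow> 'v set) \<Rightarrow> ('k, 'o, 'm, 'v) catmod" where
  "catmod_restrict M U = M\<lparr>val := \<lambda>x. (val M x)\<lparr>carrier := U x\<rparr>\<rparr>"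

definition catmod_quot ::
    "('k, 'o, 'm, 'v) catmod \<Rightarrow> ('o \<Rightarrow> 'v set) \<Rightarrow> ('k, 'o, 'm, 'v set) catmod" where
  "catmod_quot M U =
     \<lparr>val = (\<lambda>x. quot_space (val M x) (U x)),
      act = (\<lambda>x y g Y. \<Union>v\<in>Y. U y +>\<^bsub>val M y\<^esub> act M x y g v)\<rparr>"

definition catmod_dsum ::
    "'j set \<Rightarrow> ('j \<Rightarrow> ('k, 'o, 'm, 'v) catmod) \<Rightarrow> ('k, 'o, 'm, 'j \<Rightarrow> 'v) catmod" where
  "catmod_dsum J M =
     \<lparr>val = (\<lambda>x. dsum J (\<lambda>j. val (M j) x)),
      act = (\<lambda>x y g f. \<lambda>j\<in>J. act (M j) x y g (f j))\<rparr>"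

definition projective :: "('k, 'o, 'm) lincat \<Rightarrow> 'o \<Rightarrow> ('k, 'o, 'm, 'm) catmod" where
  "projective C l = \<lparr>val = mor C l, act = comp C l\<rparr>"

text \<open>The algebra \<open>End(M)\<close> is the ground field: every endomorphism is multiplication by a unique
  scalar (uniqueness excludes \<open>M = 0\<close>).\<close>

definition end_is_ground_field ::
    "('k, 'c) ring_scheme \<Rightarrow> ('k, 'o, 'm) lincat \<Rightarrow> ('k, 'o, 'm, 'v) catmod \<Rightarrow> bool" where
  "end_is_ground_field K C M \<longleftrightarrow>
     (\<forall>\<phi>. catmod_hom K C M M \<phi> \<longrightarrow>
        (\<exists>!c. c \<in> carrier K \<and>
              (\<forall>x\<in>obj C. \<forall>v\<in>carrier (val M x). \<phi> x v = c \<odot>\<^bsub>val M x\<^esub> v)))"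


section \<open>Standard modules and quasi-hereditary categories\<close>

text \<open>In this section \<open>lt\<close> is a strict order on the objects (which index the simple modules).\<close>

definition standard_trace ::
    "('k, 'c) ring_scheme \<Rightarrow> ('k, 'o, 'm) lincat \<Rightarrow> ('o \<Rightarrow> 'o \<Rightarrow> bool) \<Rightarrow> 'o \<Rightarrow> 'o \<Rightarrow> 'm set" where
  "standard_trace K C lt l x =
     lin_span K (val (projective C l) x)
       (\<Union>{\<phi> x ` carrier (val (projective C m) x) | m \<phi>.
           m \<in> obj C \<and> lt l m \<and> catmod_hom K C (projective C m) (projective C l) \<phi>})"

definition standard ::
    "('k, 'c) ring_scheme \<Rightarrow> ('k, 'o, 'm) lincat \<Rightarrow> ('o \<Rightarrow> 'o \<Rightarrow> bool) \<Rightarrow> 'o \<Rightarrow>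
     ('k, 'o, 'm, 'm set) catmod" where
  "standard K C lt l = catmod_quot (projective C l) (standard_trace K C lt l)"

definition has_standard_filtration ::
    "('k, 'c) ring_scheme \<Rightarrow> ('k, 'o, 'm) lincat \<Rightarrow> ('o \<Rightarrow> 'o \<Rightarrow> bool) \<Rightarrow> 'o \<Rightarrow> bool" where
  "has_standard_filtration K C lt l \<longleftrightarrow>
     (\<exists>(n::nat) F m.
        (\<forall>x\<in>obj C. F 0 x = carrier (val (projective C l) x)) \<and>
        (\<forall>x\<in>obj C. F (Suc n) x = {\<zero>\<^bsub>val (projective C l) x\<^esub>}) \<and>
        (\<forall>k\<le>Suc n. catmod_sub K C (projective C l) (F k)) \<and>
        (\<forall>k\<le>n. \<forall>x\<in>obj C. F (Suc k) x \<subseteq> F k x) \<and>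
        m 0 = l \<and> (\<forall>k\<in>{1..n}. m k \<in> obj C \<and> lt l (m k)) \<and>
        (\<forall>k\<le>n. catmod_iso K C
            (catmod_quot (catmod_restrict (projective C l) (F k)) (F (Suc k)))
            (standard K C lt (m k))))"

definition left_quasi_hereditary ::
    "('k, 'c) ring_scheme \<Rightarrow> ('k, 'o, 'm) lincat \<Rightarrow> ('o \<Rightarrow> 'o \<Rightarrow> bool) \<Rightarrow> bool" where
  "left_quasi_hereditary K C lt \<longleftrightarrow>
     linear_category K C \<and>
     (\<forall>l\<in>obj C. end_is_ground_field K C (standard K C lt l) \<and>
                has_standard_filtration K C lt l)"

text \<open>The requirement is imposed on left as well as on right modules.\<close>

definition quasi_hereditary ::
    "('k, 'c) ring_scheme \<Rightarrow> ('k, 'o, 'm) lincat \<Rightarrow> ('o \<Rightarrow> 'o \<Rightarrow> bool) \<Rightarrow> bool" where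
  "quasi_hereditary K C lt \<longleftrightarrow>
     left_quasi_hereditary K C lt \<and> left_quasi_hereditary K (opcat C) lt"


section \<open>Ideals and bimodules\<close>

definition cat_ideal ::
    "('k, 'c) ring_scheme \<Rightarrow> ('k, 'o, 'm) lincat \<Rightarrow> ('o \<Rightarrow> 'o \<Rightarrow> 'm set) \<Rightarrow> bool" where
  "cat_ideal K A J \<longleftrightarrow>
     (\<forall>x\<in>obj A. \<forall>y\<in>obj A. submodule (J x y) K (mor A x y)) \<and>
     (\<forall>x\<in>obj A. \<forall>y\<in>obj A. \<forall>z\<in>obj A. \<forall>f\<in>J x y. \<forall>g\<in>carrier (mor A y z).
        comp A x y z g f \<in> J x z) \<and>
     (\<forall>x\<in>obj A. \<forall>y\<in>obj A. \<forall>z\<in>obj A. \<forall>f\<in>carrier (mor A x y). \<forall>g\<in>J y z.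
        comp A x y z g f \<in> J x z)"

definition ideal_filtration ::
    "('k, 'c) ring_scheme \<Rightarrow> ('k, 'o, 'm) lincat \<Rightarrow> nat \<Rightarrow> (nat \<Rightarrow> 'o \<Rightarrow> 'o \<Rightarrow> 'm set) \<Rightarrow> bool" where
  "ideal_filtration K A N I \<longleftrightarrow>
     (\<forall>i. cat_ideal K A (I i)) \<and>
     (\<forall>x\<in>obj A. \<forall>y\<in>obj A. I 0 x y = carrier (mor A x y)) \<and>
     (\<forall>i\<ge>N. \<forall>x\<in>obj A. \<forall>y\<in>obj A. I i x y = {\<zero>\<^bsub>mor A x y\<^esub>}) \<and>
     (\<forall>i<N. (\<forall>x\<in>obj A. \<forall>y\<in>obj A. I (Suc i) x y \<subseteq> I i x y) \<and>
            (\<exists>x\<in>obj A. \<exists>y\<in>obj A. I (Suc i) x y \<noteq> I i x y)) \<and>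
     (\<forall>i j. \<forall>x\<in>obj A. \<forall>y\<in>obj A. \<forall>z\<in>obj A. \<forall>f\<in>I j x y. \<forall>g\<in>I i y z.
        comp A x y z g f \<in> I (i + j) x z)"

text \<open>
  A bimodule \<open>B\<close> has components \<open>B x y\<close>, covariant in \<open>y\<close> and contravariant in \<open>x\<close>:
  \<open>lact B x y z g : B x y \<rightarrow> B x z\<close> for \<open>g : y \<rightarrow> z\<close> and \<open>ract B w x y f : B x y \<rightarrow> B w y\<close> for
  \<open>f : w \<rightarrow> x\<close>.
\<close>

record ('k, 'o, 'm, 'v) bimod =
  bval :: "'o \<Rightarrow> 'o \<Rightarrow> ('k, 'v) module"
  lact :: "'o \<Rightarrow> 'o \<Rightarrow> 'o \<Rightarrow> 'm \<Rightarrow> 'v \<Rightarrow> 'v"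
  ract :: "'o \<Rightarrow> 'o \<Rightarrow> 'o \<Rightarrow> 'm \<Rightarrow> 'v \<Rightarrow> 'v"

definition ideal_quot_bimod ::
    "('k, 'o, 'm) lincat \<Rightarrow> ('o \<Rightarrow> 'o \<Rightarrow> 'm set) \<Rightarrow> ('o \<Rightarrow> 'o \<Rightarrow> 'm set) \<Rightarrow>
     ('k, 'o, 'm, 'm set) bimod" where
  "ideal_quot_bimod A J L =
     \<lparr>bval = (\<lambda>x y. quot_space ((mor A x y)\<lparr>carrier := J x y\<rparr>) (L x y)),
      lact = (\<lambda>x y z g Y. \<Union>f\<in>Y. L x z +>\<^bsub>mor A x z\<^esub> comp A x y z g f),
      ract = (\<lambda>w x y f Y. \<Union>g\<in>Y. L w y +>\<^bsub>mor A w y\<^esub> comp A w x y g f)\<rparr>"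

definition sub_bimod ::
    "('k, 'c) ring_scheme \<Rightarrow> ('k, 'o, 'm) lincat \<Rightarrow> ('k, 'o, 'm, 'v) bimod \<Rightarrow>
     ('o \<Rightarrow> 'o \<Rightarrow> 'v set) \<Rightarrow> bool" where
  "sub_bimod K A B U \<longleftrightarrow>
     (\<forall>x\<in>obj A. \<forall>y\<in>obj A. submodule (U x y) K (bval B x y)) \<and>
     (\<forall>x\<in>obj A. \<forall>y\<in>obj A. \<forall>z\<in>obj A. \<forall>g\<in>carrier (mor A y z). \<forall>v\<in>U x y.
        lact B x y z g v \<in> U x z) \<and>
     (\<forall>w\<in>obj A. \<forall>x\<in>obj A. \<forall>y\<in>obj A. \<forall>f\<in>carrier (mor A w x). \<forall>v\<in>U x y.
        ract B w x y f v \<in> U w y)"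

definition simple_sub_bimod ::
    "('k, 'c) ring_scheme \<Rightarrow> ('k, 'o, 'm) lincat \<Rightarrow> ('k, 'o, 'm, 'v) bimod \<Rightarrow>
     ('o \<Rightarrow> 'o \<Rightarrow> 'v set) \<Rightarrow> bool" where
  "simple_sub_bimod K A B U \<longleftrightarrow>
     sub_bimod K A B U \<and>
     (\<exists>x\<in>obj A. \<exists>y\<in>obj A. U x y \<noteq> {\<zero>\<^bsub>bval B x y\<^esub>}) \<and>
     (\<forall>V. sub_bimod K A B V \<and> (\<forall>x\<in>obj A. \<forall>y\<in>obj A. V x y \<subseteq> U x y) \<longrightarrow>
        (\<forall>x\<in>obj A. \<forall>y\<in>obj A. V x y = {\<zero>\<^bsub>bval B x y\<^esub>}) \<or>
        (\<forall>x\<in>obj A. \<forall>y\<in>obj A. V x y = U x y))"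

definition semisimple_bimod ::
    "('k, 'c) ring_scheme \<Rightarrow> ('k, 'o, 'm) lincat \<Rightarrow> ('k, 'o, 'm, 'v) bimod \<Rightarrow> bool" where
  "semisimple_bimod K A B \<longleftrightarrow>
     (\<forall>x\<in>obj A. \<forall>y\<in>obj A.
        lin_span K (bval B x y) (\<Union>{U x y | U. simple_sub_bimod K A B U}) = carrier (bval B x y))"


section \<open>The category associated with a filtration\<close>

text \<open>
  The object \<open>x[i]\<close> is the pair \<open>(x, i)\<close>.  All morphism spaces are realised as spaces of cosets, so that
  they live in one type: for \<open>j > i\<close> the space \<open>I\<^bsub>j-i\<^esub>\<close> appears as \<open>I\<^bsub>j-i\<^esub>/0\<close> (singletons), and for
  \<open>i - j \<ge> N\<close> the zero space appears as \<open>A(x,y)/A(x,y)\<close>.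
\<close>

definition conv_num ::
    "('k, 'o, 'm) lincat \<Rightarrow> (nat \<Rightarrow> 'o \<Rightarrow> 'o \<Rightarrow> 'm set) \<Rightarrow> 'o \<times> int \<Rightarrow> 'o \<times> int \<Rightarrow> 'm set" where
  "conv_num A I = (\<lambda>(x, i) (y, j).
     if j > i then I (nat (j - i)) x y else carrier (mor A x y))"

definition conv_den ::
    "('k, 'o, 'm) lincat \<Rightarrow> nat \<Rightarrow> (nat \<Rightarrow> 'o \<Rightarrow> 'o \<Rightarrow> 'm set) \<Rightarrow>
     'o \<times> int \<Rightarrow> 'o \<times> int \<Rightarrow> 'm set" where
  "conv_den A N I = (\<lambda>(x, i) (y, j).
     if j > i then {\<zero>\<^bsub>mor A x y\<^esub>}
     else if i - j < int N then I (nat (int N - (i - j))) x y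
     else carrier (mor A x y))"

definition conv_cat ::
    "('k, 'o, 'm) lincat \<Rightarrow> nat \<Rightarrow> (nat \<Rightarrow> 'o \<Rightarrow> 'o \<Rightarrow> 'm set) \<Rightarrow>
     ('k, 'o \<times> int, 'm set) lincat" where
  "conv_cat A N I =
     \<lparr>obj = obj A \<times> UNIV,
      mor = (\<lambda>p q. quot_space ((mor A (fst p) (fst q))\<lparr>carrier := conv_num A I p q\<rparr>)
                              (conv_den A N I p q)),
      comp = (\<lambda>p q r G F. \<Union>g\<in>G. \<Union>f\<in>F.
                conv_den A N I p r +>\<^bsub>mor A (fst p) (fst r)\<^esub> comp A (fst p) (fst q) (fst r) g f),
      idm = (\<lambda>p. conv_den A N I p p +>\<^bsub>mor A (fst p) (fst p)\<^esub> idm A (fst p))\<rparr>"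

definition first_order :: "'o \<times> int \<Rightarrow> 'o \<times> int \<Rightarrow> bool" where
  "first_order p q \<longleftrightarrow> snd p < snd q"

definition second_order :: "'o \<times> int \<Rightarrow> 'o \<times> int \<Rightarrow> bool" where
  "second_order p q \<longleftrightarrow> snd p > snd q"

text \<open>
  The module with value \<open>U j x y / D j x y\<close> at \<open>y[j]\<close> if \<open>j \<in> S\<close> and \<open>0\<close> otherwise, on which (classes of)
  morphisms act by composition in \<open>A\<close> between nonzero entries.  Applied to \<open>opcat A\<close> it describes
  modules over the opposite of \<open>conv_cat A N I\<close>.
\<close>

definition entry_module ::
    "('k, 'o, 'm) lincat \<Rightarrow> int set \<Rightarrow> (int \<Rightarrow> 'o \<Rightarrow> 'o \<Rightarrow> 'm set) \<Rightarrow>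
     (int \<Rightarrow> 'o \<Rightarrow> 'o \<Rightarrow> 'm set) \<Rightarrow> 'o \<Rightarrow> ('k, 'o \<times> int, 'm set, 'm set) catmod" where
  "entry_module A S U D x =
     \<lparr>val = (\<lambda>(y, j).
        if j \<in> S then quot_space ((mor A x y)\<lparr>carrier := U j x y\<rparr>) (D j x y)
        else quot_space ((mor A x y)\<lparr>carrier := {\<zero>\<^bsub>mor A x y\<^esub>}\<rparr>) {\<zero>\<^bsub>mor A x y\<^esub>}),
      act = (\<lambda>(y, j) (z, k) G Y.
        if k \<notin> S then {\<zero>\<^bsub>mor A x z\<^esub>}
        else if j \<notin> S then D k x z
        else \<Union>g\<in>G. \<Union>f\<in>Y. D k x z +>\<^bsub>mor A x z\<^esub> comp A x y z g f)\<rparr>"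

definition entry_1l ::
    "('k, 'o, 'm) lincat \<Rightarrow> nat \<Rightarrow> (nat \<Rightarrow> 'o \<Rightarrow> 'o \<Rightarrow> 'm set) \<Rightarrow> int \<Rightarrow> 'o \<Rightarrow>
     ('k, 'o \<times> int, 'm set, 'm set) catmod" where
  "entry_1l A N I i = entry_module A {j. i - int N < j \<and> j \<le> i}
     (\<lambda>j x y. carrier (mor A x y)) (\<lambda>j x y. I 1 x y)"

definition entry_2l ::
    "('k, 'o, 'm) lincat \<Rightarrow> (nat \<Rightarrow> 'o \<Rightarrow> 'o \<Rightarrow> 'm set) \<Rightarrow> int \<Rightarrow> 'o \<Rightarrow>
     ('k, 'o \<times> int, 'm set, 'm set) catmod" where
  "entry_2l A I i = entry_module A {j. i \<le> j}
     (\<lambda>j x y. I (nat (j - i)) x y) (\<lambda>j x y. I (nat (j - i + 1)) x y)"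

definition entry_1r ::
    "('k, 'o, 'm) lincat \<Rightarrow> (nat \<Rightarrow> 'o \<Rightarrow> 'o \<Rightarrow> 'm set) \<Rightarrow> int \<Rightarrow> 'o \<Rightarrow>
     ('k, 'o \<times> int, 'm set, 'm set) catmod" where
  "entry_1r A I i = entry_module (opcat A) {j. j \<le> i}
     (\<lambda>j x y. I (nat (i - j)) y x) (\<lambda>j x y. I (nat (i - j + 1)) y x)"

definition entry_2r ::
    "('k, 'o, 'm) lincat \<Rightarrow> nat \<Rightarrow> (nat \<Rightarrow> 'o \<Rightarrow> 'o \<Rightarrow> 'm set) \<Rightarrow> int \<Rightarrow> 'o \<Rightarrow>
     ('k, 'o \<times> int, 'm set, 'm set) catmod" where
  "entry_2r A N I i = entry_module (opcat A) {j. i \<le> j \<and> j < i + int N}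
     (\<lambda>j x y. carrier (mor A y x)) (\<lambda>j x y. I 1 y x)"

text \<open>
  The standard modules \<open>\<Delta>(x,i)\<close> are the direct summands, indexed by the objects \<open>x\<close>, of the columns
  (or rows) \<open>\<Oplus>\<^sub>x E i x\<close>: each \<open>\<Delta>(x,i)\<close> is the summand \<open>E i x\<close>, and the whole column is the direct
  sum of the standard modules.
\<close>

definition standards_are_summands ::
    "('k, 'c) ring_scheme \<Rightarrow> ('k, 'o \<times> int, 'm) lincat \<Rightarrow> 'o set \<Rightarrow>
     ('o \<times> int \<Rightarrow> 'o \<times> int \<Rightarrow> bool) \<Rightarrow>
     (int \<Rightarrow> 'o \<Rightarrow> ('k, 'o \<times> int, 'm, 'v) catmod) \<Rightarrow> bool" where
  "standards_are_summands K C Ob lt E \<longleftrightarrow>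
     (\<forall>i. \<forall>x\<in>Ob. catmod_iso K C (standard K C lt (x, i)) (E i x)) \<and>
     (\<forall>i. catmod_iso K C (catmod_dsum Ob (\<lambda>x. standard K C lt (x, i)))
                         (catmod_dsum Ob (E i)))"

end

theory Submission
  imports Defs
begin

text \<open>
  Put \<open>I\<^sub>n = A\<close> for \<open>n \<le> 0\<close>.  Then \<open>I\<^sub>m I\<^sub>n \<subseteq> I\<^bsub>m+n\<^esub>\<close> for all integers, and the three cases in the
  definition of \<open>C = C(A)\<close> merge into one: the space of morphisms from \<open>x[i]\<close> to \<open>y[j]\<close> is the subquotient
  \<open>I\<^bsub>j-i\<^esub>(x,y) / I\<^bsub>j-i+N\<^esub>(x,y)\<close>.  Submodules of the projective at \<open>x[i]\<close> are therefore families of subspaces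
  of the spaces \<open>A(x,y)\<close> between these two levels, and everything is computed with representatives in \<open>A\<close>.

  \<^emph>\<open>Standard modules.\<close>  By the Yoneda lemma the submodule that is divided out of the projective at \<open>x[i]\<close>
  consists of the morphisms that factor through a larger object.  For the first order these are, in row
  \<open>i + d\<close>, the classes of \<open>I\<^sub>d \<inter> (I\<^sub>1 + I\<^bsub>d+N\<^esub>)\<close>: an element of \<open>I\<^sub>1(x,y)\<close> is a morphism to \<open>y[i+1]\<close>.  For the
  second order they are the classes of \<open>I\<^bsub>d+1\<^esub>\<close>: the identity of \<open>x\<close> is a morphism to \<open>x[i-1]\<close>, and from there
  \<open>I\<^bsub>d+1\<^esub>\<close> is available (\<open>first_trace\<close>, \<open>second_trace\<close>).  The quotients are the entries in the statement.

  \<^emph>\<open>The role of semisimplicity.\<close>  Quasi-heredity rests on one fact: \<open>(A/I\<^sub>1)(x,y)\<close> is \<open>0\<close> for \<open>x \<noteq> y\<close> and the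
  ground field for \<open>x = y\<close> (\<open>schurian_filtrationI\<close>).  To see it, let \<open>s\<close> be an endomorphism of \<open>x\<close> in a
  simple subbimodule of \<open>A/I\<^sub>1\<close>, and let \<open>r : x \<rightarrow> y\<close> be radical in the sense that \<open>a r\<close> is a nonunit for every
  \<open>a : y \<rightarrow> x\<close>.  If \<open>r s \<noteq> 0\<close>, then \<open>r s\<close> generates the simple subbimodule, so \<open>s\<close> lies in \<open>m s End(x)\<close>, where
  \<open>m\<close> is the maximal ideal of \<open>End(x)\<close>; as \<open>End(x)\<close> is finite-dimensional, Nakayama's lemma gives \<open>s = 0\<close>.
  So \<open>r\<close> kills all simple subbimodules, and by semisimplicity it kills the identity of \<open>x\<close> in \<open>A/I\<^sub>1\<close>.
  Morphisms between distinct objects and nonunits are radical, and over an algebraically closed field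
  every endomorphism is a scalar plus a nonunit.

  \<^emph>\<open>Filtrations.\<close>  For the second order the levels \<open>I\<^bsub>d+t\<^esub>\<close>, \<open>0 \<le> t \<le> N\<close>, filter the projective at \<open>x[i]\<close>;
  the layer between \<open>t\<close> and \<open>t+1\<close> is generated by the identity of \<open>x\<close> in row \<open>i - t\<close> and is the standard module
  of \<open>x[i-t]\<close>.  For the first order every \<open>A\<close>-submodule \<open>W\<close> of \<open>A(x,-)\<close> gives the submodule with entries
  \<open>I\<^sub>d \<inter> (W + I\<^bsub>d+N\<^esub>)\<close>.  Starting from \<open>W = I\<^sub>t\<close> one descends to \<open>I\<^bsub>t+1\<^esub>\<close> by one dimension at a time, and a
  step that removes a vector \<open>b \<in> I\<^sub>t(x,y)\<close> has the standard module of \<open>y[i+t]\<close> as its layer; since \<open>A(x,-)\<close> is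
  finite-dimensional, finitely many steps suffice (\<open>first_step\<close>, \<open>first_refine\<close>).

  \<^emph>\<open>Right modules.\<close>  The opposite of \<open>C(A)\<close> is the category \<open>C\<close> of the opposite of \<open>A\<close> with \<open>x[i]\<close> renamed to
  \<open>x[-i]\<close> (\<open>opcat_conv_cat\<close>), and this renaming exchanges the two orders.  The hypotheses are symmetric, so
  the right-hand statements are left-hand statements for the opposite of \<open>A\<close>.
\<close>


section \<open>Subspaces, quotients and spans\<close>

lemma (in abelian_group) minus_add_cancel:
  "x \<in> carrier G \<Longrightarrow> y \<in> carrier G \<Longrightarrow> (x \<ominus> y) \<oplus> y = x"
  "x \<in> carrier G \<Longrightarrow> y \<in> carrier G \<Longrightarrow> y \<oplus> (x \<ominus> y) = x"
  "x \<in> carrier G \<Longrightarrow> y \<in> carrier G \<Longrightarrow> (x \<oplus> y) \<ominus> y = x"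
  "x \<in> carrier G \<Longrightarrow> y \<in> carrier G \<Longrightarrow> (y \<oplus> x) \<ominus> y = x"
  by (simp_all add: a_minus_def a_assoc l_neg r_neg a_comm[of y] del: add.inv_mult_group)

lemma (in abelian_group) minus_zero_imp_eq:
  assumes "x \<in> carrier G" "y \<in> carrier G" "x \<ominus> y = \<zero>"
  shows "x = y"
  using minus_add_cancel(1)[OF assms(1,2)] assms by simp

lemma (in abelian_group) minus_add_minus:
  assumes "x \<in> carrier G" "y \<in> carrier G" "z \<in> carrier G"
  shows "(x \<ominus> y) \<oplus> (y \<ominus> z) = x \<ominus> z" "(z \<oplus> x) \<ominus> (z \<oplus> y) = x \<ominus> y"
proof -
  show "(x \<ominus> y) \<oplus> (y \<ominus> z) = x \<ominus> z"
    using assms by (simp add: a_minus_def a_assoc r_neg1)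
  have "(z \<oplus> x) \<ominus> (z \<oplus> y) = (x \<oplus> z) \<oplus> (\<ominus> z \<oplus> \<ominus> y)"
    using assms by (simp add: a_minus_def minus_add a_comm[of z x])
  also have "\<dots> = x \<ominus> y" using assms by (simp add: a_minus_def a_assoc r_neg2)
  finally show "(z \<oplus> x) \<ominus> (z \<oplus> y) = x \<ominus> y" .
qed

lemma cring_if_module: "module K V \<Longrightarrow> cring K"
  by (simp add: module_def)

lemma submodule_iff:
  assumes "module K V"
  shows "submodule W K V \<longleftrightarrow> W \<subseteq> carrier V \<and> \<zero>\<^bsub>V\<^esub> \<in> W \<and> (\<forall>u\<in>W. \<forall>v\<in>W. u \<oplus>\<^bsub>V\<^esub> v \<in> W) \<and>
    (\<forall>c\<in>carrier K. \<forall>v\<in>W. c \<odot>\<^bsub>V\<^esub> v \<in> W)" (is "?L \<longleftrightarrow> ?R")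
proof
  interpret V: module K V by fact
  show "?L \<Longrightarrow> ?R"
    using V.submoduleE[of W] subgroup.one_closed[OF submodule.axioms(1), of W K V] by auto
  assume R: ?R
  show ?L
  proof (rule V.submoduleI)
    fix a assume a: "a \<in> W"
    have "\<ominus>\<^bsub>V\<^esub> a = (\<ominus>\<^bsub>K\<^esub> \<one>\<^bsub>K\<^esub>) \<odot>\<^bsub>V\<^esub> a" using a R V.smult_l_minus[of "\<one>\<^bsub>K\<^esub>" a] by auto
    thus "\<ominus>\<^bsub>V\<^esub> a \<in> W" using a R by auto
  qed (use R in auto)
qed

lemma submoduleD:
  assumes "module K V" "submodule W K V"
  shows submodule_subset: "W \<subseteq> carrier V" and submodule_zero: "\<zero>\<^bsub>V\<^esub> \<in> W"
    and submodule_add: "\<And>u v. u \<in> W \<Longrightarrow> v \<in> W \<Longrightarrow> u \<oplus>\<^bsub>V\<^esub> v \<in> W"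
    and submodule_smult: "\<And>c v. c \<in> carrier K \<Longrightarrow> v \<in> W \<Longrightarrow> c \<odot>\<^bsub>V\<^esub> v \<in> W"
    and submodule_minus: "\<And>u v. u \<in> W \<Longrightarrow> v \<in> W \<Longrightarrow> u \<ominus>\<^bsub>V\<^esub> v \<in> W"
  using assms submodule_iff[OF assms(1), of W] module.submoduleE(3)[OF assms]
  by (auto simp: a_minus_def)

lemma submodule_restrict_iff:
  assumes V: "module K V" and U: "submodule U K V"
  shows "submodule W K (V\<lparr>carrier := U\<rparr>) \<longleftrightarrow> submodule W K V \<and> W \<subseteq> U"
  using submodule_iff[OF V, of W] submodule_iff[OF submodule.submodule_is_module[OF U V], of W]
    submodule_subset[OF V U] by auto

lemma submodule_carrier: "module K V \<Longrightarrow> submodule (carrier V) K V"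
  by (rule module.carrier_is_submodule)

lemma submodule_zero_space: "module K V \<Longrightarrow> submodule {\<zero>\<^bsub>V\<^esub>} K V"
proof -
  assume m: "module K V"
  interpret V: module K V by fact
  show ?thesis by (simp add: submodule_iff[OF m])
qed

lemma submodule_Int:
  "module K V \<Longrightarrow> submodule U K V \<Longrightarrow> submodule W K V \<Longrightarrow> submodule (U \<inter> W) K V"
  by (auto simp: submodule_iff)

lemma linear_homD:
  assumes "linear_hom K V W f"
  shows linear_hom_closed: "\<And>v. v \<in> carrier V \<Longrightarrow> f v \<in> carrier W"
    and linear_hom_add: "\<And>u v. u \<in> carrier V \<Longrightarrow> v \<in> carrier V \<Longrightarrow> f (u \<oplus>\<^bsub>V\<^esub> v) = f u \<oplus>\<^bsub>W\<^esub> f v"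
    and linear_hom_smult: "\<And>c v. c \<in> carrier K \<Longrightarrow> v \<in> carrier V \<Longrightarrow> f (c \<odot>\<^bsub>V\<^esub> v) = c \<odot>\<^bsub>W\<^esub> f v"
  using assms by (auto simp: linear_hom_def)

lemma linear_hom_zero:
  assumes "module K V" "module K W" "linear_hom K V W f"
  shows "f \<zero>\<^bsub>V\<^esub> = \<zero>\<^bsub>W\<^esub>"
proof -
  interpret V: module K V by fact
  interpret W: module K W by fact
  have "f (\<zero>\<^bsub>K\<^esub> \<odot>\<^bsub>V\<^esub> \<zero>\<^bsub>V\<^esub>) = \<zero>\<^bsub>K\<^esub> \<odot>\<^bsub>W\<^esub> f \<zero>\<^bsub>V\<^esub>"
    by (rule linear_hom_smult[OF assms(3)]) auto
  thus ?thesis using linear_hom_closed[OF assms(3) V.zero_closed] by simp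
qed

lemma linear_hom_neg:
  assumes "module K V" "module K W" "linear_hom K V W f" "v \<in> carrier V"
  shows "f (\<ominus>\<^bsub>V\<^esub> v) = \<ominus>\<^bsub>W\<^esub> f v"
proof -
  interpret V: module K V by fact
  interpret W: module K W by fact
  have "f (\<ominus>\<^bsub>V\<^esub> v) = f ((\<ominus>\<^bsub>K\<^esub> \<one>\<^bsub>K\<^esub>) \<odot>\<^bsub>V\<^esub> v)"
    using V.smult_l_minus[of "\<one>\<^bsub>K\<^esub>" v] assms(4) by simp
  also have "\<dots> = \<ominus>\<^bsub>W\<^esub> f v"
    using linear_homD[OF assms(3)] W.smult_l_minus[of "\<one>\<^bsub>K\<^esub>" "f v"] assms(4) by simp
  finally show ?thesis .
qed

lemma linear_hom_minus:
  assumes "module K V" "module K W" "linear_hom K V W f" "u \<in> carrier V" "v \<in> carrier V"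
  shows "f (u \<ominus>\<^bsub>V\<^esub> v) = f u \<ominus>\<^bsub>W\<^esub> f v"
proof -
  interpret V: module K V by fact
  show ?thesis using assms linear_hom_neg[OF assms(1-3)] linear_homD[OF assms(3)]
    by (simp add: a_minus_def)
qed

lemma linear_hom_vimage_submodule:
  assumes "module K V" "module K W" "linear_hom K V W f" "submodule U K W"
  shows "submodule {v \<in> carrier V. f v \<in> U} K V"
proof -
  interpret V: module K V by fact
  show ?thesis
    using submoduleD[OF assms(2,4)] linear_homD[OF assms(3)] linear_hom_zero[OF assms(1-3)]
    by (auto simp: submodule_iff[OF assms(1)])
qed

lemma linear_hom_image_submodule:
  assumes "module K V" "module K W" "linear_hom K V W f" "submodule U K V"
  shows "submodule (f ` U) K W"
proof -
  have sub: "U \<subseteq> carrier V" by (rule submodule_subset[OF assms(1,4)])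
  have "f u \<oplus>\<^bsub>W\<^esub> f v \<in> f ` U" if "u \<in> U" "v \<in> U" for u v
    using that sub linear_hom_add[OF assms(3), of u v] submodule_add[OF assms(1,4), of u v]
    by (metis image_eqI subsetD)
  moreover have "c \<odot>\<^bsub>W\<^esub> f v \<in> f ` U" if "c \<in> carrier K" "v \<in> U" for c v
    using that sub linear_hom_smult[OF assms(3), of c v] submodule_smult[OF assms(1,4), of c v]
    by (metis image_eqI subsetD)
  moreover have "\<zero>\<^bsub>W\<^esub> \<in> f ` U"
    using linear_hom_zero[OF assms(1-3)] submodule_zero[OF assms(1,4)] by (metis image_eqI)
  ultimately show ?thesis
    using linear_hom_closed[OF assms(3)] sub by (auto simp: submodule_iff[OF assms(2)])
qed

lemma linear_hom_subset:
  assumes "module K V" "submodule U K V" "linear_hom K V W f"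
  shows "linear_hom K (V\<lparr>carrier := U\<rparr>) W f"
  using assms(3) submodule_subset[OF assms(1,2)] unfolding linear_hom_def
  by (auto simp: Pi_def subset_iff)

text \<open>The axioms of a vector space are equations, so they pass to any surjective linear image.  The zero must be
  given separately: linearity alone does not determine the zero field of the record.\<close>

lemma module_surj:
  assumes V: "module K V" and f: "linear_hom K V W f"
    and surj: "f ` carrier V = carrier W" and zero: "\<zero>\<^bsub>W\<^esub> = f \<zero>\<^bsub>V\<^esub>"
  shows "module K W"
proof -
  interpret V: module K V by fact
  note hom = linear_hom_add[OF f, symmetric] linear_hom_smult[OF f, symmetric]
  have ab: "abelian_group W"
  proof (rule abelian_groupI, goal_cases)
    case (6 w)
    then obtain v where v: "v \<in> carrier V" "w = f v" using surj by auto
    hence "f (\<ominus>\<^bsub>V\<^esub> v) \<oplus>\<^bsub>W\<^esub> w = \<zero>\<^bsub>W\<^esub>" by (simp add: hom zero V.l_neg)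
    moreover have "f (\<ominus>\<^bsub>V\<^esub> v) \<in> carrier W" using v surj by auto
    ultimately show ?case by blast
  qed (auto simp: hom zero V.a_ac simp flip: surj)
  show ?thesis
    by (rule moduleI[OF cring_if_module[OF V] ab])
      (auto simp: hom V.smult_l_distr V.smult_r_distr V.smult_assoc1 simp flip: surj)
qed


lemma a_r_coset_restrict [simp]: "W +>\<^bsub>V\<lparr>carrier := U\<rparr>\<^esub> v = W +>\<^bsub>V\<^esub> v"
  by (simp add: a_r_coset_def')

lemma quot_space_carrier: "carrier (quot_space V W) = (\<lambda>v. W +>\<^bsub>V\<^esub> v) ` carrier V"
  by (auto simp: quot_space_def A_RCOSETS_def')

lemma coset_self:
  assumes "module K V" "submodule W K V" "v \<in> carrier V"
  shows "v \<in> W +>\<^bsub>V\<^esub> v"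
proof -
  interpret V: module K V by fact
  have "\<zero>\<^bsub>V\<^esub> \<oplus>\<^bsub>V\<^esub> v = v" using assms by simp
  thus ?thesis using submodule_zero[OF assms(1,2)] unfolding a_r_coset_def' by force
qed

lemma mem_coset_iff:
  assumes "module K V" "submodule W K V" "v \<in> carrier V"
  shows "u \<in> W +>\<^bsub>V\<^esub> v \<longleftrightarrow> u \<in> carrier V \<and> u \<ominus>\<^bsub>V\<^esub> v \<in> W"
proof -
  interpret V: module K V by fact
  have sub: "W \<subseteq> carrier V" by (rule submodule_subset[OF assms(1,2)])
  show ?thesis
  proof
    assume "u \<in> W +>\<^bsub>V\<^esub> v"
    then obtain h where h: "h \<in> W" "u = h \<oplus>\<^bsub>V\<^esub> v" by (auto simp: a_r_coset_def')
    have "u \<ominus>\<^bsub>V\<^esub> v = h" using h sub assms(3)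
      by (metis V.M.add.inv_solve_right' V.a_closed a_minus_def subsetD)
    thus "u \<in> carrier V \<and> u \<ominus>\<^bsub>V\<^esub> v \<in> W" using h sub assms(3) by auto
  next
    assume u: "u \<in> carrier V \<and> u \<ominus>\<^bsub>V\<^esub> v \<in> W"
    have "u = (u \<ominus>\<^bsub>V\<^esub> v) \<oplus>\<^bsub>V\<^esub> v" using u assms(3)
      by (simp add: a_minus_def V.a_assoc V.l_neg)
    thus "u \<in> W +>\<^bsub>V\<^esub> v" using u by (auto simp: a_r_coset_def')
  qed
qed

lemma coset_eq_iff:
  assumes "module K V" "submodule W K V" "u \<in> carrier V" "v \<in> carrier V"
  shows "W +>\<^bsub>V\<^esub> u = W +>\<^bsub>V\<^esub> v \<longleftrightarrow> u \<ominus>\<^bsub>V\<^esub> v \<in> W"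
proof
  interpret V: module K V by fact
  assume "W +>\<^bsub>V\<^esub> u = W +>\<^bsub>V\<^esub> v"
  thus "u \<ominus>\<^bsub>V\<^esub> v \<in> W" using coset_self[OF assms(1-3)] mem_coset_iff[OF assms(1,2,4)] by auto
next
  interpret V: module K V by fact
  assume uv: "u \<ominus>\<^bsub>V\<^esub> v \<in> W"
  have "w \<ominus>\<^bsub>V\<^esub> u \<in> W \<longleftrightarrow> w \<ominus>\<^bsub>V\<^esub> v \<in> W" if w: "w \<in> carrier V" for w
  proof -
    have e: "w \<ominus>\<^bsub>V\<^esub> v = (w \<ominus>\<^bsub>V\<^esub> u) \<oplus>\<^bsub>V\<^esub> (u \<ominus>\<^bsub>V\<^esub> v)"
      using w assms(3,4) by (simp add: V.minus_add_minus)
    have e': "w \<ominus>\<^bsub>V\<^esub> u = (w \<ominus>\<^bsub>V\<^esub> v) \<ominus>\<^bsub>V\<^esub> (u \<ominus>\<^bsub>V\<^esub> v)"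
      using w assms(3,4) by (simp add: e V.minus_add_cancel)
    show ?thesis using e e' uv submoduleD[OF assms(1,2)] by metis
  qed
  thus "W +>\<^bsub>V\<^esub> u = W +>\<^bsub>V\<^esub> v"
    using mem_coset_iff[OF assms(1,2,3)] mem_coset_iff[OF assms(1,2,4)] by blast
qed

lemma coset_zero_iff:
  assumes "module K V" "submodule W K V" "v \<in> carrier V"
  shows "W +>\<^bsub>V\<^esub> v = W \<longleftrightarrow> v \<in> W"
proof -
  interpret V: module K V by fact
  have "W +>\<^bsub>V\<^esub> \<zero>\<^bsub>V\<^esub> = W" using submodule_subset[OF assms(1,2)]
    by (auto simp: a_r_coset_def' subset_iff)
  hence "W +>\<^bsub>V\<^esub> v = W \<longleftrightarrow> W +>\<^bsub>V\<^esub> v = W +>\<^bsub>V\<^esub> \<zero>\<^bsub>V\<^esub>" by simp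
  also have "\<dots> \<longleftrightarrow> v \<in> W" using coset_eq_iff[OF assms V.zero_closed] assms(3)
    V.minus_add_cancel(3)[OF assms(3) V.zero_closed] by simp
  finally show ?thesis .
qed

lemma quot_space_add:
  assumes "module K V" "submodule W K V" "u \<in> carrier V" "v \<in> carrier V"
  shows "(W +>\<^bsub>V\<^esub> u) \<oplus>\<^bsub>quot_space V W\<^esub> (W +>\<^bsub>V\<^esub> v) = W +>\<^bsub>V\<^esub> (u \<oplus>\<^bsub>V\<^esub> v)"
proof -
  interpret V: module K V by fact
  interpret abelian_subgroup W V
    by (rule abelian_subgroupI3)
      (use assms submodule.axioms(1) V.M.abelian_group_axioms in \<open>auto intro: additive_subgroupI\<close>)
  show ?thesis using a_rcos_sum[OF assms(3,4)] by (simp add: quot_space_def)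
qed

text \<open>Operations on cosets are written as unions over representatives; such a union is a single coset once all
  its members agree modulo the subspace.\<close>

lemma UN_coset:
  assumes "module K V" "submodule W K V" "B \<noteq> {}"
    "\<And>w. w \<in> B \<Longrightarrow> f w \<in> carrier V" "v \<in> carrier V" "\<And>w. w \<in> B \<Longrightarrow> f w \<ominus>\<^bsub>V\<^esub> v \<in> W"
  shows "(\<Union>w\<in>B. W +>\<^bsub>V\<^esub> f w) = (W +>\<^bsub>V\<^esub> v)"
proof -
  have "W +>\<^bsub>V\<^esub> f w = W +>\<^bsub>V\<^esub> v" if "w \<in> B" for w
    using coset_eq_iff[OF assms(1,2,4,5)] assms(6) that by blast
  thus ?thesis using assms(3) by auto
qed

lemma UN_coset_linear:
  assumes "module K V" "submodule W K V" "module K V'" "submodule W' K V'"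
    "linear_hom K V V' f" "\<And>w. w \<in> W \<Longrightarrow> f w \<in> W'" "v \<in> carrier V"
  shows "(\<Union>w\<in>(W +>\<^bsub>V\<^esub> v). W' +>\<^bsub>V'\<^esub> f w) = (W' +>\<^bsub>V'\<^esub> f v)"
proof (rule UN_coset[OF assms(3,4)])
  show "W +>\<^bsub>V\<^esub> v \<noteq> {}" using coset_self[OF assms(1,2,7)] by auto
  fix w assume "w \<in> W +>\<^bsub>V\<^esub> v"
  hence w: "w \<in> carrier V" "w \<ominus>\<^bsub>V\<^esub> v \<in> W" using mem_coset_iff[OF assms(1,2,7)] by auto
  show "f w \<in> carrier V'" using w linear_hom_closed[OF assms(5)] by auto
  show "f w \<ominus>\<^bsub>V'\<^esub> f v \<in> W'" using assms(6)[OF w(2)]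
    linear_hom_minus[OF assms(1,3,5) w(1) assms(7)] by simp
qed (use linear_hom_closed[OF assms(5)] assms(7) in auto)

lemma quot_space_smult:
  assumes "module K V" "submodule W K V" "c \<in> carrier K" "v \<in> carrier V"
  shows "c \<odot>\<^bsub>quot_space V W\<^esub> (W +>\<^bsub>V\<^esub> v) = W +>\<^bsub>V\<^esub> (c \<odot>\<^bsub>V\<^esub> v)"
proof -
  interpret V: module K V by fact
  have "linear_hom K V V (\<lambda>v. c \<odot>\<^bsub>V\<^esub> v)"
    using assms(3) V.smult_assoc1[of c] V.smult_assoc1[of _ c] V.R.m_comm[of c]
    by (auto simp: linear_hom_def V.smult_r_distr)
  from UN_coset_linear[OF assms(1,2,1,2) this _ assms(4)] submodule_smult[OF assms(1,2,3)]
  show ?thesis by (simp add: quot_space_def)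
qed

lemma quot_space_zero: "\<zero>\<^bsub>quot_space V W\<^esub> = W"
  by (simp add: quot_space_def)

lemma quot_space_linear_hom:
  assumes "module K V" "submodule W K V"
  shows "linear_hom K V (quot_space V W) (\<lambda>v. W +>\<^bsub>V\<^esub> v)"
  using quot_space_add[OF assms] quot_space_smult[OF assms]
  by (auto simp: linear_hom_def quot_space_carrier)

lemma quot_space_module:
  assumes "module K V" "submodule W K V"
  shows "module K (quot_space V W)"
proof (rule module_surj[OF assms(1) quot_space_linear_hom[OF assms]])
  interpret V: module K V by fact
  show "\<zero>\<^bsub>quot_space V W\<^esub> = W +>\<^bsub>V\<^esub> \<zero>\<^bsub>V\<^esub>"
    using coset_zero_iff[OF assms V.zero_closed] submodule_zero[OF assms]
    by (simp add: quot_space_zero)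
qed (simp add: quot_space_carrier)


lemma lin_span_superset: "S \<subseteq> lin_span K V S"
  by (simp add: lin_span_def hull_subset)

lemma lin_span_minimal: "submodule W K V \<Longrightarrow> S \<subseteq> W \<Longrightarrow> lin_span K V S \<subseteq> W"
  by (simp add: lin_span_def hull_minimal)

lemma lin_span_mono: "S \<subseteq> T \<Longrightarrow> lin_span K V S \<subseteq> lin_span K V T"
  by (simp add: lin_span_def hull_mono)

lemma lin_span_submodule:
  assumes V: "module K V" and S: "S \<subseteq> carrier V"
  shows "submodule (lin_span K V S) K V"
proof -
  have "lin_span K V S \<subseteq> carrier V" by (rule lin_span_minimal[OF submodule_carrier[OF V] S])
  thus ?thesis using V unfolding lin_span_def hull_def
    by (auto simp: submodule_iff)
qed

lemma lin_span_subset_carrier: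
  assumes V: "module K V" and S: "S \<subseteq> carrier V"
  shows "lin_span K V S \<subseteq> carrier V"
  by (rule lin_span_minimal[OF submodule_carrier[OF V] S])

lemma submodule_sum_line:
  assumes V: "module K V" and W: "submodule W K V" and b: "b \<in> carrier V"
  shows "submodule {(c \<odot>\<^bsub>V\<^esub> b) \<oplus>\<^bsub>V\<^esub> w | c w. c \<in> carrier K \<and> w \<in> W} K V" (is "submodule ?H K V")
proof -
  interpret V: module K V by fact
  have sub: "W \<subseteq> carrier V" by (rule submodule_subset[OF V W])
  have "\<zero>\<^bsub>V\<^esub> = (\<zero>\<^bsub>K\<^esub> \<odot>\<^bsub>V\<^esub> b) \<oplus>\<^bsub>V\<^esub> \<zero>\<^bsub>V\<^esub>" using b by simp
  hence 0: "\<zero>\<^bsub>V\<^esub> \<in> ?H" using submodule_zero[OF V W] V.R.zero_closed by blast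
  have add: "((c \<odot>\<^bsub>V\<^esub> b) \<oplus>\<^bsub>V\<^esub> w) \<oplus>\<^bsub>V\<^esub> ((c' \<odot>\<^bsub>V\<^esub> b) \<oplus>\<^bsub>V\<^esub> w') \<in> ?H"
    if "c \<in> carrier K" "w \<in> W" "c' \<in> carrier K" "w' \<in> W" for c w c' w'
  proof -
    have "((c \<odot>\<^bsub>V\<^esub> b) \<oplus>\<^bsub>V\<^esub> w) \<oplus>\<^bsub>V\<^esub> ((c' \<odot>\<^bsub>V\<^esub> b) \<oplus>\<^bsub>V\<^esub> w') = ((c \<oplus>\<^bsub>K\<^esub> c') \<odot>\<^bsub>V\<^esub> b) \<oplus>\<^bsub>V\<^esub> (w \<oplus>\<^bsub>V\<^esub> w')"
      using that sub b by (simp add: V.smult_l_distr V.a_ac subset_iff)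
    thus ?thesis using that submodule_add[OF V W] by blast
  qed
  have smult: "d \<odot>\<^bsub>V\<^esub> ((c \<odot>\<^bsub>V\<^esub> b) \<oplus>\<^bsub>V\<^esub> w) \<in> ?H"
    if "c \<in> carrier K" "w \<in> W" "d \<in> carrier K" for c w d
  proof -
    have "d \<odot>\<^bsub>V\<^esub> ((c \<odot>\<^bsub>V\<^esub> b) \<oplus>\<^bsub>V\<^esub> w) = ((d \<otimes>\<^bsub>K\<^esub> c) \<odot>\<^bsub>V\<^esub> b) \<oplus>\<^bsub>V\<^esub> (d \<odot>\<^bsub>V\<^esub> w)"
      using that sub b by (simp add: V.smult_r_distr V.smult_assoc1 subset_iff)
    thus ?thesis using that submodule_smult[OF V W] by blast
  qed
  show ?thesis using 0 add smult sub b by (auto simp: submodule_iff[OF V])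
qed

lemma lin_span_insert:
  assumes V: "module K V" and S: "S \<subseteq> carrier V" and b: "b \<in> carrier V"
  shows "lin_span K V (insert b S) = {(c \<odot>\<^bsub>V\<^esub> b) \<oplus>\<^bsub>V\<^esub> w | c w. c \<in> carrier K \<and> w \<in> lin_span K V S}"
    (is "_ = ?H")
proof -
  interpret V: module K V by fact
  note W = lin_span_submodule[OF V S]
  note W' = lin_span_submodule[OF V, of "insert b S"]
  have "S \<subseteq> ?H"
  proof
    fix s assume "s \<in> S"
    hence s: "s \<in> lin_span K V S" using lin_span_superset by (rule subsetD[rotated])
    have "s = (\<zero>\<^bsub>K\<^esub> \<odot>\<^bsub>V\<^esub> b) \<oplus>\<^bsub>V\<^esub> s"
      using b subsetD[OF lin_span_subset_carrier[OF V S] s] by simp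
    thus "s \<in> ?H" using s V.R.zero_closed
      by (intro CollectI exI[of _ "\<zero>\<^bsub>K\<^esub>"] exI[of _ s] conjI)
  qed
  moreover have "b = (\<one>\<^bsub>K\<^esub> \<odot>\<^bsub>V\<^esub> b) \<oplus>\<^bsub>V\<^esub> \<zero>\<^bsub>V\<^esub>" using b by simp
  hence "b \<in> ?H" using submodule_zero[OF V W] V.R.one_closed
    by (intro CollectI exI[of _ "\<one>\<^bsub>K\<^esub>"] exI[of _ "\<zero>\<^bsub>V\<^esub>"] conjI)
  ultimately have "lin_span K V (insert b S) \<subseteq> ?H"
    by (intro lin_span_minimal[OF submodule_sum_line[OF V W b]] insert_subsetI)
  moreover have "?H \<subseteq> lin_span K V (insert b S)"
  proof -
    have "c \<odot>\<^bsub>V\<^esub> b \<oplus>\<^bsub>V\<^esub> w \<in> lin_span K V (insert b S)"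
      if "c \<in> carrier K" "w \<in> lin_span K V S" for c w
      using that subsetD[OF lin_span_superset[of "insert b S" K V], of b]
        subsetD[OF lin_span_mono[of S "insert b S" K V], of w] S b
      by (intro submodule_add[OF V W'] submodule_smult[OF V W']) auto
    thus ?thesis by blast
  qed
  ultimately show ?thesis by (rule subset_antisym)
qed

lemma lin_span_submodule_eq: "submodule W K V \<Longrightarrow> lin_span K V W = W"
  by (simp add: lin_span_def hull_same)

lemma lin_span_empty: "module K V \<Longrightarrow> lin_span K V {} = {\<zero>\<^bsub>V\<^esub>}"
  using lin_span_minimal[OF submodule_zero_space, of K V "{}"]
    submodule_zero[OF _ lin_span_submodule, of K V "{}"] by auto

text \<open>Induction on the spanning set: if a subspace is not already inside the span of the smaller set, any one of
  its vectors outside that span accounts, up to a scalar, for the removed spanning vector.\<close>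

lemma subspace_finitely_spanned:
  assumes K: "field K" and V: "module K V"
  shows "finite S \<Longrightarrow> S \<subseteq> carrier V \<Longrightarrow> submodule W K V \<Longrightarrow> W \<subseteq> lin_span K V S \<Longrightarrow>
    \<exists>T. finite T \<and> T \<subseteq> W \<and> lin_span K V T = W"
proof (induction S arbitrary: W rule: finite_induct)
  case empty
  have "W = {\<zero>\<^bsub>V\<^esub>}" using empty submodule_zero[OF V empty(2)] lin_span_empty[OF V] by auto
  thus ?case using lin_span_empty[OF V] by (intro exI[of _ "{}"]) auto
next
  case (insert b S)
  interpret K: field K by fact
  interpret V: module K V by fact
  have S: "S \<subseteq> carrier V" and b: "b \<in> carrier V" using insert by auto
  let ?L = "lin_span K V S"
  have L: "submodule ?L K V" by (rule lin_span_submodule[OF V S])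
  show ?case
  proof (cases "W \<subseteq> ?L")
    case True
    thus ?thesis using insert by auto
  next
    case False
    then obtain w0 where w0: "w0 \<in> W" "w0 \<notin> ?L" by blast
    then obtain c u where cu: "c \<in> carrier K" "u \<in> ?L" "w0 = (c \<odot>\<^bsub>V\<^esub> b) \<oplus>\<^bsub>V\<^esub> u"
      using insert.prems(3) lin_span_insert[OF V S b] by blast
    have uc: "u \<in> carrier V" using cu lin_span_subset_carrier[OF V S] by auto
    have "c \<noteq> \<zero>\<^bsub>K\<^esub>" using cu w0 uc b by auto
    hence cU: "c \<in> Units K" using cu K.field_Units by auto
    obtain T where T: "finite T" "T \<subseteq> W \<inter> ?L" "lin_span K V T = W \<inter> ?L"
      using insert.IH[OF S submodule_Int[OF V insert.prems(2) L]] by auto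
    have Wc: "W \<subseteq> carrier V" by (rule submodule_subset[OF V insert.prems(2)])
    have Tc: "T \<subseteq> carrier V" using T Wc by auto
    have "W \<subseteq> lin_span K V (insert w0 T)"
    proof
      fix w assume w: "w \<in> W"
      then obtain d v where dv: "d \<in> carrier K" "v \<in> ?L" "w = (d \<odot>\<^bsub>V\<^esub> b) \<oplus>\<^bsub>V\<^esub> v"
        using insert.prems(3) lin_span_insert[OF V S b] by blast
      have vc: "v \<in> carrier V" using dv lin_span_subset_carrier[OF V S] by auto
      define e where "e = d \<otimes>\<^bsub>K\<^esub> inv\<^bsub>K\<^esub> c"
      have e: "e \<in> carrier K" using cU dv e_def by auto
      have ec: "e \<otimes>\<^bsub>K\<^esub> c = d" using cU cu dv e_def by (simp add: K.m_assoc)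
      have eq: "w \<ominus>\<^bsub>V\<^esub> e \<odot>\<^bsub>V\<^esub> w0 = v \<ominus>\<^bsub>V\<^esub> e \<odot>\<^bsub>V\<^esub> u"
        using e cu dv b uc vc ec
        by (simp add: V.smult_r_distr V.minus_add_minus flip: V.smult_assoc1)
      have "w \<ominus>\<^bsub>V\<^esub> e \<odot>\<^bsub>V\<^esub> w0 \<in> W" 
        by (rule submodule_minus[OF V insert.prems(2) w submodule_smult[OF V insert.prems(2) e w0(1)]])
      moreover have "v \<ominus>\<^bsub>V\<^esub> e \<odot>\<^bsub>V\<^esub> u \<in> ?L"
        by (rule submodule_minus[OF V L dv(2) submodule_smult[OF V L e cu(2)]])
      ultimately have "w \<ominus>\<^bsub>V\<^esub> e \<odot>\<^bsub>V\<^esub> w0 \<in> lin_span K V T" using T eq by auto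
      moreover have "w = (e \<odot>\<^bsub>V\<^esub> w0) \<oplus>\<^bsub>V\<^esub> (w \<ominus>\<^bsub>V\<^esub> e \<odot>\<^bsub>V\<^esub> w0)"
        using w w0 e Wc by (simp add: V.minus_add_cancel subset_iff)
      ultimately show "w \<in> lin_span K V (insert w0 T)"
        unfolding lin_span_insert[OF V Tc subsetD[OF Wc w0(1)]] using e
        by (intro CollectI exI[of _ e] exI[of _ "w \<ominus>\<^bsub>V\<^esub> e \<odot>\<^bsub>V\<^esub> w0"] conjI)
    qed
    moreover have "lin_span K V (insert w0 T) \<subseteq> W"
      by (rule lin_span_minimal) (use insert.prems w0 T in auto)
    ultimately show ?thesis using T w0 by (intro exI[of _ "insert w0 T"]) auto
  qed
qed

lemma submodule_sum:
  assumes V: "module K V" and U: "submodule U K V" and W: "submodule W K V"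
  shows "submodule {u \<oplus>\<^bsub>V\<^esub> w | u w. u \<in> U \<and> w \<in> W} K V"
proof -
  interpret V: module K V by fact
  note sU = subsetD[OF submodule_subset[OF V U]] and sW = subsetD[OF submodule_subset[OF V W]]
  have "\<zero>\<^bsub>V\<^esub> \<in> {u \<oplus>\<^bsub>V\<^esub> w | u w. u \<in> U \<and> w \<in> W}"
    using submodule_zero[OF V U] submodule_zero[OF V W]
    by (intro CollectI exI[of _ "\<zero>\<^bsub>V\<^esub>"]) simp
  moreover have "(u \<oplus>\<^bsub>V\<^esub> w) \<oplus>\<^bsub>V\<^esub> (u' \<oplus>\<^bsub>V\<^esub> w') \<in> {u \<oplus>\<^bsub>V\<^esub> w | u w. u \<in> U \<and> w \<in> W}"
    if "u \<in> U" "u' \<in> U" "w \<in> W" "w' \<in> W" for u u' w w'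
    using that submodule_add[OF V U that(1,2)] submodule_add[OF V W that(3,4)]
    by (intro CollectI exI[of _ "u \<oplus>\<^bsub>V\<^esub> u'"] exI[of _ "w \<oplus>\<^bsub>V\<^esub> w'"]) (simp add: sU sW V.M.a_ac)
  moreover have "c \<odot>\<^bsub>V\<^esub> (u \<oplus>\<^bsub>V\<^esub> w) \<in> {u \<oplus>\<^bsub>V\<^esub> w | u w. u \<in> U \<and> w \<in> W}"
    if "c \<in> carrier K" "u \<in> U" "w \<in> W" for c u w
    using that submodule_smult[OF V U that(1,2)] submodule_smult[OF V W that(1,3)]
    by (intro CollectI exI[of _ "c \<odot>\<^bsub>V\<^esub> u"] exI[of _ "c \<odot>\<^bsub>V\<^esub> w"]) (simp add: sU sW V.smult_r_distr)
  ultimately show ?thesis unfolding submodule_iff[OF V] using sU sW by blast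
qed

lemma submodule_sum_superset:
  assumes V: "module K V" and U: "submodule U K V" and W: "submodule W K V"
  shows "U \<subseteq> {u \<oplus>\<^bsub>V\<^esub> w | u w. u \<in> U \<and> w \<in> W}" "W \<subseteq> {u \<oplus>\<^bsub>V\<^esub> w | u w. u \<in> U \<and> w \<in> W}"
proof -
  interpret V: module K V by fact
  note sU = subsetD[OF submodule_subset[OF V U]] and sW = subsetD[OF submodule_subset[OF V W]]
  show "U \<subseteq> {u \<oplus>\<^bsub>V\<^esub> w | u w. u \<in> U \<and> w \<in> W}"
  proof
    fix u assume "u \<in> U" thus "u \<in> {u \<oplus>\<^bsub>V\<^esub> w | u w. u \<in> U \<and> w \<in> W}"
      using submodule_zero[OF V W] sU by (intro CollectI exI[of _ u] exI[of _ "\<zero>\<^bsub>V\<^esub>"]) simp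
  qed
  show "W \<subseteq> {u \<oplus>\<^bsub>V\<^esub> w | u w. u \<in> U \<and> w \<in> W}"
  proof
    fix w assume "w \<in> W" thus "w \<in> {u \<oplus>\<^bsub>V\<^esub> w | u w. u \<in> U \<and> w \<in> W}"
      using submodule_zero[OF V U] sW by (intro CollectI exI[of _ "\<zero>\<^bsub>V\<^esub>"] exI[of _ w]) simp
  qed
qed


section \<open>Modules over a linear category\<close>

lemma left_moduleD:
  assumes "left_module K C M"
  shows left_module_val: "\<And>x. x \<in> obj C \<Longrightarrow> module K (val M x)"
    and left_module_act: "\<And>x y g. x \<in> obj C \<Longrightarrow> y \<in> obj C \<Longrightarrow> g \<in> carrier (mor C x y) \<Longrightarrow>
      linear_hom K (val M x) (val M y) (act M x y g)"
    and left_module_act_mor: "\<And>x y v. x \<in> obj C \<Longrightarrow> y \<in> obj C \<Longrightarrow> v \<in> carrier (val M x) \<Longrightarrow>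
      linear_hom K (mor C x y) (val M y) (\<lambda>g. act M x y g v)"
    and left_module_idm: "\<And>x v. x \<in> obj C \<Longrightarrow> v \<in> carrier (val M x) \<Longrightarrow> act M x x (idm C x) v = v"
    and left_module_comp: "\<And>x y z f g v. x \<in> obj C \<Longrightarrow> y \<in> obj C \<Longrightarrow> z \<in> obj C \<Longrightarrow>
      f \<in> carrier (mor C x y) \<Longrightarrow> g \<in> carrier (mor C y z) \<Longrightarrow> v \<in> carrier (val M x) \<Longrightarrow>
      act M x z (comp C x y z g f) v = act M y z g (act M x y f v)"
  using assms unfolding left_module_def by (blast+)

lemma left_module_act_closed:
  assumes "left_module K C M" "x \<in> obj C" "y \<in> obj C" "g \<in> carrier (mor C x y)"
    "v \<in> carrier (val M x)"
  shows "act M x y g v \<in> carrier (val M y)"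
  by (rule linear_hom_closed[OF left_module_act[OF assms(1-4)] assms(5)])

lemma catmod_subD:
  assumes "catmod_sub K C M U"
  shows catmod_sub_submodule: "\<And>x. x \<in> obj C \<Longrightarrow> submodule (U x) K (val M x)"
    and catmod_sub_act: "\<And>x y g v. x \<in> obj C \<Longrightarrow> y \<in> obj C \<Longrightarrow> g \<in> carrier (mor C x y) \<Longrightarrow>
      v \<in> U x \<Longrightarrow> act M x y g v \<in> U y"
  using assms unfolding catmod_sub_def by blast+

lemma catmod_homD:
  assumes "catmod_hom K C M L \<phi>"
  shows catmod_hom_linear: "\<And>x. x \<in> obj C \<Longrightarrow> linear_hom K (val M x) (val L x) (\<phi> x)"
    and catmod_hom_act: "\<And>x y g v. x \<in> obj C \<Longrightarrow> y \<in> obj C \<Longrightarrow> g \<in> carrier (mor C x y) \<Longrightarrow>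
      v \<in> carrier (val M x) \<Longrightarrow> \<phi> y (act M x y g v) = act L x y g (\<phi> x v)"
  using assms unfolding catmod_hom_def by blast+

lemma linear_hom_comp:
  "linear_hom K U V f \<Longrightarrow> linear_hom K V W g \<Longrightarrow> linear_hom K U W (\<lambda>u. g (f u))"
  by (auto simp: linear_hom_def Pi_def)

lemma linear_hom_cong:
  assumes U: "module K U" and f: "linear_hom K U V f" and eq: "\<And>u. u \<in> carrier U \<Longrightarrow> f u = g u"
  shows "linear_hom K U V g"
proof -
  interpret U: module K U by fact
  show ?thesis using f by (simp add: linear_hom_def Pi_def flip: eq)
qed

text \<open>The homomorphism theorem in relational form: if \<open>V\<close> and \<open>W\<close> are both described by elements of \<open>Q\<close>, a linear
  map from \<open>V\<close> to \<open>W\<close> is defined on representatives.\<close>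

lemma linear_hom_lift:
  assumes Q: "module K Q" and V: "module K V" and W: "module K W"
    and \<alpha>: "linear_hom K Q V \<alpha>" and \<beta>: "linear_hom K Q W \<beta>"
    and surj: "\<alpha> ` carrier Q = carrier V"
    and ker: "\<And>q. q \<in> carrier Q \<Longrightarrow> \<alpha> q = \<zero>\<^bsub>V\<^esub> \<Longrightarrow> \<beta> q = \<zero>\<^bsub>W\<^esub>"
  obtains \<phi> where "linear_hom K V W \<phi>" "\<And>q. q \<in> carrier Q \<Longrightarrow> \<phi> (\<alpha> q) = \<beta> q"
proof -
  interpret Q: module K Q by fact
  interpret V: module K V by fact
  interpret W: module K W by fact
  have eq: "\<beta> p = \<beta> q" if p: "p \<in> carrier Q" and q: "q \<in> carrier Q" and e: "\<alpha> p = \<alpha> q" for p q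
  proof -
    have "\<alpha> (p \<ominus>\<^bsub>Q\<^esub> q) = \<zero>\<^bsub>V\<^esub>"
      using linear_hom_minus[OF Q V \<alpha> p q] e linear_hom_closed[OF \<alpha> q] by (simp add: V.r_neg a_minus_def)
    hence "\<beta> p \<ominus>\<^bsub>W\<^esub> \<beta> q = \<zero>\<^bsub>W\<^esub>"
      using ker[of "p \<ominus>\<^bsub>Q\<^esub> q"] p q linear_hom_minus[OF Q W \<beta> p q] by simp
    thus ?thesis using linear_hom_closed[OF \<beta>] p q using W.minus_zero_imp_eq by simp
  qed
  define \<phi> where "\<phi> v = \<beta> (SOME q. q \<in> carrier Q \<and> \<alpha> q = v)" for v
  have \<phi>: "\<phi> (\<alpha> q) = \<beta> q" if "q \<in> carrier Q" for q
  proof -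
    let ?p = "SOME p. p \<in> carrier Q \<and> \<alpha> p = \<alpha> q"
    have "?p \<in> carrier Q \<and> \<alpha> ?p = \<alpha> q" by (rule someI[of _ q]) (use that in auto)
    thus ?thesis unfolding \<phi>_def using eq that by blast
  qed
  have "linear_hom K V W \<phi>"
    unfolding linear_hom_def surj[symmetric]
    by (auto simp: \<phi> linear_hom_closed[OF \<beta>] linear_hom_add[OF \<beta>] linear_hom_smult[OF \<beta>]
        simp flip: linear_hom_add[OF \<alpha>] linear_hom_smult[OF \<alpha>])
  thus ?thesis using \<phi> that by blast
qed

lemma linear_hom_from_surj:
  assumes Q: "module K Q" and \<alpha>: "linear_hom K Q V \<alpha>" and surj: "\<alpha> ` carrier Q = carrier V"
    and h: "linear_hom K Q W (\<lambda>q. h (\<alpha> q))"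
  shows "linear_hom K V W h"
proof -
  interpret Q: module K Q by fact
  note a = linear_hom_add[OF \<alpha>, symmetric] linear_hom_smult[OF \<alpha>, symmetric]
  show ?thesis unfolding linear_hom_def surj[symmetric]
  proof (intro conjI ballI Pi_I; elim imageE; hypsubst)
    fix p assume p: "p \<in> carrier Q"
    show "h (\<alpha> p) \<in> carrier W" using linear_hom_closed[OF h p] .
    show "h (c \<odot>\<^bsub>V\<^esub> \<alpha> p) = c \<odot>\<^bsub>W\<^esub> h (\<alpha> p)" if "c \<in> carrier K" for c
      using linear_hom_smult[OF h that p] by (simp add: a that p)
    show "h (\<alpha> p \<oplus>\<^bsub>V\<^esub> \<alpha> q) = h (\<alpha> p) \<oplus>\<^bsub>W\<^esub> h (\<alpha> q)" if "q \<in> carrier Q" for q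
      using linear_hom_add[OF h p that] by (simp add: a that p)
  qed
qed

text \<open>The axioms of a module are equations, so they need not be checked for an image of a module.\<close>

lemma left_module_surj:
  assumes C: "linear_category K C"
    and M: "left_module K C M" and \<phi>: "catmod_hom K C M L \<phi>"
    and L: "\<And>x. x \<in> obj C \<Longrightarrow> module K (val L x)"
    and surj: "\<And>x. x \<in> obj C \<Longrightarrow> \<phi> x ` carrier (val M x) = carrier (val L x)"
  shows "left_module K C L"
proof -
  interpret C: linear_category K C by fact
  note lin = linear_homD[OF catmod_hom_linear[OF \<phi>]]
  note act = catmod_hom_act[OF \<phi>, symmetric]
  note cl = left_module_act_closed[OF M]
  have "linear_hom K (val L x) (val L y) (act L x y g)"
    if xy: "x \<in> obj C" "y \<in> obj C" and g: "g \<in> carrier (mor C x y)" for x y g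
  proof -
    note M1 = linear_homD[OF left_module_act[OF M xy g]]
    interpret V: module K "val M x" by (rule left_module_val[OF M xy(1)])
    show ?thesis unfolding linear_hom_def surj[OF xy(1), symmetric]
    proof (intro conjI ballI Pi_I; elim imageE; hypsubst)
      fix v assume v: "v \<in> carrier (val M x)"
      show "act L x y g (\<phi> x v) \<in> carrier (val L y)" using xy g v by (simp add: act cl lin)
      show "act L x y g (c \<odot>\<^bsub>val L x\<^esub> \<phi> x v) = c \<odot>\<^bsub>val L y\<^esub> act L x y g (\<phi> x v)"
        if "c \<in> carrier K" for c
        using that xy g v act[OF xy g V.smult_closed[OF that v]] by (simp add: act cl lin M1)
      fix u assume u: "u \<in> carrier (val M x)"
      show "act L x y g (\<phi> x v \<oplus>\<^bsub>val L x\<^esub> \<phi> x u) = act L x y g (\<phi> x v) \<oplus>\<^bsub>val L y\<^esub> act L x y g (\<phi> x u)"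
        using u xy g v act[OF xy g V.a_closed[OF v u]] by (simp add: act cl lin M1)
    qed
  qed
  moreover have "linear_hom K (mor C x y) (val L y) (\<lambda>g. act L x y g w)"
    if xy: "x \<in> obj C" "y \<in> obj C" and w: "w \<in> carrier (val L x)" for x y w
  proof -
    obtain v where v: "v \<in> carrier (val M x)" "w = \<phi> x v" using w surj[OF xy(1)] by auto
    show ?thesis
      by (rule linear_hom_cong[OF C.mor_module[OF xy]
            linear_hom_comp[OF left_module_act_mor[OF M xy v(1)] catmod_hom_linear[OF \<phi> xy(2)]]])
        (simp add: xy v act)
  qed
  moreover have "act L x x (idm C x) w = w" if x: "x \<in> obj C" and w: "w \<in> carrier (val L x)" for x w
  proof -
    obtain v where v: "v \<in> carrier (val M x)" "w = \<phi> x v" using w surj[OF x] by auto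
    thus ?thesis using left_module_idm[OF M x v(1)] C.idm_closed[OF x] x by (simp add: act)
  qed
  moreover have "act L x z (comp C x y z g f) w = act L y z g (act L x y f w)"
    if o: "x \<in> obj C" "y \<in> obj C" "z \<in> obj C" and f: "f \<in> carrier (mor C x y)"
      and g: "g \<in> carrier (mor C y z)" and w: "w \<in> carrier (val L x)" for x y z f g w
  proof -
    obtain v where v: "v \<in> carrier (val M x)" "w = \<phi> x v" using w surj[OF o(1)] by auto
    have "comp C x y z g f \<in> carrier (mor C x z)"
      using linear_hom_closed[OF C.comp_linear_right[OF o g] f] .
    thus ?thesis using left_module_comp[OF M o f g v(1)] o f g v by (simp add: act cl)
  qed
  ultimately show ?thesis using L unfolding left_module_def by blast
qed

text \<open>A presentation assigns to every element \<open>q\<close> of \<open>Q x\<close> an element of \<open>M\<close> and one of \<open>L\<close>.  Instead of an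
  action on \<open>Q\<close>, it is only required that the action can be lifted to representatives; this makes the lemma
  applicable to quotients whose representatives do not form a module.\<close>

lemma presentation_hom:
  assumes M: "left_module K C M"
    and L: "\<And>x. x \<in> obj C \<Longrightarrow> module K (val L x)"
    and Q: "\<And>x. x \<in> obj C \<Longrightarrow> module K (Q x)"
    and \<alpha>: "\<And>x. x \<in> obj C \<Longrightarrow> linear_hom K (Q x) (val M x) (\<alpha> x)"
    and \<alpha>s: "\<And>x. x \<in> obj C \<Longrightarrow> \<alpha> x ` carrier (Q x) = carrier (val M x)"
    and \<beta>: "\<And>x. x \<in> obj C \<Longrightarrow> linear_hom K (Q x) (val L x) (\<beta> x)"
    and ker: "\<And>x q. x \<in> obj C \<Longrightarrow> q \<in> carrier (Q x) \<Longrightarrow> \<alpha> x q = \<zero>\<^bsub>val M x\<^esub> \<Longrightarrow> \<beta> x q = \<zero>\<^bsub>val L x\<^esub>"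
    and lift: "\<And>x y g q. x \<in> obj C \<Longrightarrow> y \<in> obj C \<Longrightarrow> g \<in> carrier (mor C x y) \<Longrightarrow> q \<in> carrier (Q x) \<Longrightarrow>
       \<exists>q'\<in>carrier (Q y). \<alpha> y q' = act M x y g (\<alpha> x q) \<and> \<beta> y q' = act L x y g (\<beta> x q)"
  obtains \<phi> where "catmod_hom K C M L \<phi>"
    "\<And>x q. x \<in> obj C \<Longrightarrow> q \<in> carrier (Q x) \<Longrightarrow> \<phi> x (\<alpha> x q) = \<beta> x q"
proof -
  have "\<exists>\<phi>. linear_hom K (val M x) (val L x) \<phi> \<and> (\<forall>q\<in>carrier (Q x). \<phi> (\<alpha> x q) = \<beta> x q)"
    if x: "x \<in> obj C" for x
    by (rule linear_hom_lift[OF Q[OF x] left_module_val[OF M x] L[OF x] \<alpha>[OF x] \<beta>[OF x] \<alpha>s[OF x] ker[OF x]])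
      (assumption | blast)+
  then obtain \<phi> where \<phi>: "\<And>x. x \<in> obj C \<Longrightarrow> linear_hom K (val M x) (val L x) (\<phi> x)"
    "\<And>x q. x \<in> obj C \<Longrightarrow> q \<in> carrier (Q x) \<Longrightarrow> \<phi> x (\<alpha> x q) = \<beta> x q" by metis
  have "\<phi> y (act M x y g v) = act L x y g (\<phi> x v)"
    if xy: "x \<in> obj C" "y \<in> obj C" and g: "g \<in> carrier (mor C x y)" and v: "v \<in> carrier (val M x)" for x y g v
  proof -
    obtain q where q: "q \<in> carrier (Q x)" "v = \<alpha> x q" using v \<alpha>s[OF xy(1)] by blast
    obtain q' where "q' \<in> carrier (Q y)" "\<alpha> y q' = act M x y g (\<alpha> x q)" "\<beta> y q' = act L x y g (\<beta> x q)"
      using lift[OF xy g q(1)] by blast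
    thus ?thesis using \<phi>(2)[OF xy(1) q(1)] \<phi>(2)[OF xy(2), of q'] q by simp
  qed
  hence "catmod_hom K C M L \<phi>" using \<phi>(1) by (simp add: catmod_hom_def)
  thus ?thesis using \<phi>(2) that by blast
qed

text \<open>Two modules with the same representatives and the same relations are isomorphic.  The identification of
  the entry modules and of the layers of the filtrations with standard modules rests on this lemma.\<close>

lemma common_presentation_iso:
  assumes C: "linear_category K C" and M: "left_module K C M"
    and L: "\<And>x. x \<in> obj C \<Longrightarrow> module K (val L x)"
    and Q: "\<And>x. x \<in> obj C \<Longrightarrow> module K (Q x)"
    and \<alpha>: "\<And>x. x \<in> obj C \<Longrightarrow> linear_hom K (Q x) (val M x) (\<alpha> x)"
    and \<alpha>s: "\<And>x. x \<in> obj C \<Longrightarrow> \<alpha> x ` carrier (Q x) = carrier (val M x)"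
    and \<beta>: "\<And>x. x \<in> obj C \<Longrightarrow> linear_hom K (Q x) (val L x) (\<beta> x)"
    and \<beta>s: "\<And>x. x \<in> obj C \<Longrightarrow> \<beta> x ` carrier (Q x) = carrier (val L x)"
    and ker: "\<And>x q. x \<in> obj C \<Longrightarrow> q \<in> carrier (Q x) \<Longrightarrow> \<alpha> x q = \<zero>\<^bsub>val M x\<^esub> \<longleftrightarrow> \<beta> x q = \<zero>\<^bsub>val L x\<^esub>"
    and lift: "\<And>x y g q. x \<in> obj C \<Longrightarrow> y \<in> obj C \<Longrightarrow> g \<in> carrier (mor C x y) \<Longrightarrow> q \<in> carrier (Q x) \<Longrightarrow>
       \<exists>q'\<in>carrier (Q y). \<alpha> y q' = act M x y g (\<alpha> x q) \<and> \<beta> y q' = act L x y g (\<beta> x q)"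
  shows "catmod_iso K C M L"
proof -
  have "\<exists>\<phi>. catmod_hom K C M L \<phi> \<and> (\<forall>x\<in>obj C. \<forall>q\<in>carrier (Q x). \<phi> x (\<alpha> x q) = \<beta> x q)"
    by (rule presentation_hom[OF M, of L Q \<alpha> \<beta>]) (fact L Q \<alpha> \<alpha>s \<beta> lift | simp add: ker | blast)+
  then obtain \<phi> where \<phi>: "catmod_hom K C M L \<phi>"
    "\<And>x q. x \<in> obj C \<Longrightarrow> q \<in> carrier (Q x) \<Longrightarrow> \<phi> x (\<alpha> x q) = \<beta> x q"
    by blast
  have surj: "\<phi> x ` carrier (val M x) = carrier (val L x)" if x: "x \<in> obj C" for x
    unfolding \<alpha>s[OF x, symmetric] \<beta>s[OF x, symmetric] using \<phi>(2)[OF x] by (simp add: image_image)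
  have "inj_on (\<phi> x) (carrier (val M x))" if x: "x \<in> obj C" for x
  proof (rule inj_onI)
    interpret M: module K "val M x" by (rule left_module_val[OF M x])
    interpret L: module K "val L x" by (rule L[OF x])
    fix u v assume u: "u \<in> carrier (val M x)" and v: "v \<in> carrier (val M x)" and e: "\<phi> x u = \<phi> x v"
    obtain q where q: "q \<in> carrier (Q x)" "u \<ominus>\<^bsub>val M x\<^esub> v = \<alpha> x q"
      using M.minus_closed[OF u v] \<alpha>s[OF x] by (metis imageE)
    have "\<beta> x q = \<phi> x u \<ominus>\<^bsub>val L x\<^esub> \<phi> x v"
      using linear_hom_minus[OF left_module_val[OF M x] L[OF x] catmod_hom_linear[OF \<phi>(1) x] u v]
        \<phi>(2)[OF x q(1)] q(2) by simp
    also have "\<dots> = \<zero>\<^bsub>val L x\<^esub>"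
      using e linear_hom_closed[OF catmod_hom_linear[OF \<phi>(1) x] v] by (simp add: L.r_neg a_minus_def)
    finally have "\<alpha> x q = \<zero>\<^bsub>val M x\<^esub>" using ker[OF x q(1)] by simp
    thus "u = v" using q(2) u v using M.minus_zero_imp_eq by simp
  qed
  hence "\<forall>x\<in>obj C. bij_betw (\<phi> x) (carrier (val M x)) (carrier (val L x))"
    using surj by (simp add: bij_betw_def)
  thus ?thesis unfolding catmod_iso_def
    using M left_module_surj[OF C M \<phi>(1) L surj] \<phi>(1) by blast
qed

lemma catmod_quot_val: "val (catmod_quot M U) x = quot_space (val M x) (U x)"
  by (simp add: catmod_quot_def)

lemma catmod_quot_act:
  assumes M: "left_module K C M" and U: "catmod_sub K C M U"
    and xy: "x \<in> obj C" "y \<in> obj C" and g: "g \<in> carrier (mor C x y)" and v: "v \<in> carrier (val M x)"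
  shows "act (catmod_quot M U) x y g (U x +>\<^bsub>val M x\<^esub> v) = U y +>\<^bsub>val M y\<^esub> act M x y g v"
  using UN_coset_linear[OF left_module_val[OF M xy(1)] catmod_sub_submodule[OF U xy(1)]
      left_module_val[OF M xy(2)] catmod_sub_submodule[OF U xy(2)] left_module_act[OF M xy g]
      catmod_sub_act[OF U xy g] v]
  by (simp add: catmod_quot_def)

lemma catmod_quot_hom:
  assumes M: "left_module K C M" and U: "catmod_sub K C M U"
  shows "catmod_hom K C M (catmod_quot M U) (\<lambda>x v. U x +>\<^bsub>val M x\<^esub> v)"
  using quot_space_linear_hom[OF left_module_val[OF M] catmod_sub_submodule[OF U]]
    catmod_quot_act[OF M U]
  by (auto simp: catmod_hom_def catmod_quot_val)

lemma catmod_quot_left_module: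
  assumes C: "linear_category K C" and M: "left_module K C M" and U: "catmod_sub K C M U"
  shows "left_module K C (catmod_quot M U)"
  by (rule left_module_surj[OF C M catmod_quot_hom[OF M U]])
    (auto simp: catmod_quot_val quot_space_carrier quot_space_module left_module_val[OF M]
      catmod_sub_submodule[OF U])

lemma linear_hom_restrict:
  assumes "module K V" "submodule U K V" "linear_hom K V W f" "\<And>u. u \<in> U \<Longrightarrow> f u \<in> U'"
  shows "linear_hom K (V\<lparr>carrier := U\<rparr>) (W\<lparr>carrier := U'\<rparr>) f"
  using linear_hom_subset[OF assms(1-3)] assms(4) by (auto simp: linear_hom_def)

lemma catmod_restrict_val: "val (catmod_restrict M U) x = (val M x)\<lparr>carrier := U x\<rparr>"
  and catmod_restrict_act: "act (catmod_restrict M U) = act M"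
  by (simp_all add: catmod_restrict_def)

lemma catmod_restrict_left_module:
  assumes M: "left_module K C M" and U: "catmod_sub K C M U"
  shows "left_module K C (catmod_restrict M U)"
proof -
  note sub = subsetD[OF submodule_subset[OF left_module_val[OF M] catmod_sub_submodule[OF U]]]
  have "linear_hom K (mor C x y) ((val M y)\<lparr>carrier := U y\<rparr>) (\<lambda>g. act M x y g v)"
    if "x \<in> obj C" "y \<in> obj C" "v \<in> U x" for x y v
    using left_module_act_mor[OF M that(1,2) sub[OF that(1,1,3)]] catmod_sub_act[OF U that(1,2) _ that(3)]
    by (auto simp: linear_hom_def)
  moreover have "linear_hom K ((val M x)\<lparr>carrier := U x\<rparr>) ((val M y)\<lparr>carrier := U y\<rparr>) (act M x y g)"
    if "x \<in> obj C" "y \<in> obj C" "g \<in> carrier (mor C x y)" for x y g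
    by (rule linear_hom_restrict[OF left_module_val[OF M that(1)] catmod_sub_submodule[OF U that(1)]
          left_module_act[OF M that] catmod_sub_act[OF U that]])
  moreover have "module K ((val M x)\<lparr>carrier := U x\<rparr>)" if "x \<in> obj C" for x
    by (rule submodule.submodule_is_module[OF catmod_sub_submodule[OF U that] left_module_val[OF M that]])
  ultimately show ?thesis
    using left_module_idm[OF M] left_module_comp[OF M] sub
    unfolding left_module_def catmod_restrict_val catmod_restrict_act by (simp add: Ball_def)
qed

lemma catmod_sub_restrict:
  assumes M: "left_module K C M" and U: "catmod_sub K C M U" and W: "catmod_sub K C M W"
    and le: "\<And>x. x \<in> obj C \<Longrightarrow> W x \<subseteq> U x"
  shows "catmod_sub K C (catmod_restrict M U) W"
  using W submodule_restrict_iff[OF left_module_val[OF M] catmod_sub_submodule[OF U]] le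
  unfolding catmod_sub_def catmod_restrict_val catmod_restrict_act by simp

context linear_category
begin

lemma comp_closed:
  "\<lbrakk>x \<in> obj C; y \<in> obj C; z \<in> obj C; f \<in> carrier (mor C x y); g \<in> carrier (mor C y z)\<rbrakk>
   \<Longrightarrow> comp C x y z g f \<in> carrier (mor C x z)"
  by (rule linear_hom_closed[OF comp_linear_right])

lemma projective_simps [simp]:
  "val (projective C l) = mor C l" "act (projective C l) = comp C l"
  by (simp_all add: projective_def)

lemma projective_left_module: "l \<in> obj C \<Longrightarrow> left_module K C (projective C l)"
  unfolding left_module_def projective_simps
  using mor_module comp_linear_left comp_linear_right comp_idm_left comp_assoc
  by (simp add: Ball_def)

end


section \<open>Standard modules and their filtrations\<close>

context linear_category
begin

text \<open>The Yoneda lemma: homomorphisms from \<open>P(m)\<close> to \<open>P(l)\<close> are right multiplications by morphisms from \<open>l\<close> to \<open>m\<close>, so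
  the trace is spanned by the morphisms that factor through some \<open>m > l\<close>.\<close>

lemma standard_trace_eq:
  assumes l: "l \<in> obj C" and x: "x \<in> obj C"
  shows "standard_trace K C lt l x = lin_span K (mor C l x)
    {comp C l m x g a | m a g. m \<in> obj C \<and> lt l m \<and> a \<in> carrier (mor C l m) \<and> g \<in> carrier (mor C m x)}"
proof -
  have "(\<exists>\<phi>. catmod_hom K C (projective C m) (projective C l) \<phi> \<and> f \<in> \<phi> x ` carrier (mor C m x)) \<longleftrightarrow>
      (\<exists>a\<in>carrier (mor C l m). \<exists>g\<in>carrier (mor C m x). f = comp C l m x g a)" (is "?L \<longleftrightarrow> ?R")
    if m: "m \<in> obj C" for m f
  proof
    assume ?L
    then obtain \<phi> g where \<phi>: "catmod_hom K C (projective C m) (projective C l) \<phi>"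
      and g: "g \<in> carrier (mor C m x)" "f = \<phi> x g" by blast
    have "\<phi> x (comp C m m x g (idm C m)) = comp C l m x g (\<phi> m (idm C m))"
      using catmod_hom_act[OF \<phi> m x g(1)] idm_closed[OF m] by simp
    hence "f = comp C l m x g (\<phi> m (idm C m))" using g comp_idm_right[OF m x g(1)] by simp
    moreover have "\<phi> m (idm C m) \<in> carrier (mor C l m)"
      using linear_hom_closed[OF catmod_hom_linear[OF \<phi> m]] idm_closed[OF m] by simp
    ultimately show ?R using g(1) by blast
  next
    assume ?R
    then obtain a g where a: "a \<in> carrier (mor C l m)" and g: "g \<in> carrier (mor C m x)"
      "f = comp C l m x g a" by blast
    have "catmod_hom K C (projective C m) (projective C l) (\<lambda>y g. comp C l m y g a)"
      using comp_linear_left[OF l m _ a] comp_assoc[OF l m _ _ a]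
      by (simp add: catmod_hom_def)
    thus ?L using g by blast
  qed
  note * = this
  have "\<Union>{\<phi> x ` carrier (val (projective C m) x) | m \<phi>.
      m \<in> obj C \<and> lt l m \<and> catmod_hom K C (projective C m) (projective C l) \<phi>} =
    {comp C l m x g a | m a g. m \<in> obj C \<and> lt l m \<and> a \<in> carrier (mor C l m) \<and> g \<in> carrier (mor C m x)}"
    (is "?A = ?B")
  proof -
    have "f \<in> ?A \<longleftrightarrow> (\<exists>m\<in>obj C. lt l m \<and> (\<exists>\<phi>. catmod_hom K C (projective C m) (projective C l) \<phi> \<and> f \<in> \<phi> x ` carrier (mor C m x)))" for f
      by auto
    also have "\<dots> f \<longleftrightarrow> (\<exists>m\<in>obj C. lt l m \<and> (\<exists>a\<in>carrier (mor C l m). \<exists>g\<in>carrier (mor C m x). f = comp C l m x g a))" for f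
      using * by (intro bex_cong refl) blast
    also have "\<dots> f \<longleftrightarrow> f \<in> ?B" for f by auto
    finally have "f \<in> ?A \<longleftrightarrow> f \<in> ?B" for f .
    thus ?thesis by (rule Set.set_eqI)
  qed
  thus ?thesis by (simp add: standard_trace_def)
qed

lemma projective_submodule_vimage:
  assumes "l \<in> obj C" "x \<in> obj C" "y \<in> obj C" "h \<in> carrier (mor C x y)" "submodule U K (mor C l y)"
  shows "submodule {v \<in> carrier (mor C l x). comp C l x y h v \<in> U} K (mor C l x)"
  by (rule linear_hom_vimage_submodule[OF mor_module mor_module comp_linear_right])
    (use assms in auto)

lemma standard_trace_sub:
  assumes l: "l \<in> obj C"
  shows "catmod_sub K C (projective C l) (standard_trace K C lt l)"
proof -
  let ?G = "\<lambda>x. {comp C l m x g a | m a g. m \<in> obj C \<and> lt l m \<and> a \<in> carrier (mor C l m) \<and> g \<in> carrier (mor C m x)}"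
  have G: "?G x \<subseteq> carrier (mor C l x)" if "x \<in> obj C" for x
    using comp_closed[OF l _ that] by auto
  have sub: "submodule (lin_span K (mor C l x) (?G x)) K (mor C l x)" if "x \<in> obj C" for x
    by (rule lin_span_submodule[OF mor_module[OF l that] G[OF that]])
  have "comp C l x y h v \<in> lin_span K (mor C l y) (?G y)"
    if x: "x \<in> obj C" and y: "y \<in> obj C" and h: "h \<in> carrier (mor C x y)"
      and v: "v \<in> lin_span K (mor C l x) (?G x)" for x y h v
  proof -
    let ?U = "{v \<in> carrier (mor C l x). comp C l x y h v \<in> lin_span K (mor C l y) (?G y)}"
    have "?G x \<subseteq> ?U"
    proof
      fix f assume f: "f \<in> ?G x"
      then obtain m a g where m: "m \<in> obj C" "lt l m" "a \<in> carrier (mor C l m)"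
        "g \<in> carrier (mor C m x)" "f = comp C l m x g a" by blast
      have "comp C l x y h f = comp C l m y (comp C m x y h g) a"
        using comp_assoc[OF l m(1) x y m(3,4) h] m(5) by simp
      hence "comp C l x y h f \<in> ?G y" using comp_closed[OF m(1) x y m(4) h] m by blast
      from subsetD[OF lin_span_superset this] show "f \<in> ?U" using subsetD[OF G[OF x] f] by simp
    qed
    from subsetD[OF lin_span_minimal[OF projective_submodule_vimage[OF l x y h sub[OF y]] this] v]
    show ?thesis by simp
  qed
  thus ?thesis using sub by (simp add: catmod_sub_def standard_trace_eq[OF l])
qed

text \<open>The form in which traces are computed: in the applications every element of the trace is a single
  composite, so that no linear combinations are needed.\<close>

lemma standard_trace_eqI:
  assumes l: "l \<in> obj C" and U: "catmod_sub K C (projective C l) U"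
    and le: "\<And>m a. m \<in> obj C \<Longrightarrow> lt l m \<Longrightarrow> a \<in> carrier (mor C l m) \<Longrightarrow> a \<in> U m"
    and ge: "\<And>x f. x \<in> obj C \<Longrightarrow> f \<in> U x \<Longrightarrow> f = \<zero>\<^bsub>mor C l x\<^esub> \<or>
      (\<exists>m a g. m \<in> obj C \<and> lt l m \<and> a \<in> carrier (mor C l m) \<and> g \<in> carrier (mor C m x) \<and> f = comp C l m x g a)"
    and x: "x \<in> obj C"
  shows "standard_trace K C lt l x = U x"
proof
  have "comp C l m x g a \<in> U x" if "m \<in> obj C" "lt l m" "a \<in> carrier (mor C l m)" "g \<in> carrier (mor C m x)" for m a g
    using catmod_sub_act[OF U that(1) x that(4) le[OF that(1-3)]] by simp
  thus "standard_trace K C lt l x \<subseteq> U x"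
    unfolding standard_trace_eq[OF l x]
    using catmod_sub_submodule[OF U x] by (intro lin_span_minimal) auto
  note tr = catmod_sub_submodule[OF standard_trace_sub[OF l, of lt] x, unfolded projective_simps]
  show "U x \<subseteq> standard_trace K C lt l x"
  proof
    fix f assume "f \<in> U x"
    from ge[OF x this] show "f \<in> standard_trace K C lt l x"
    proof
      assume "f = \<zero>\<^bsub>mor C l x\<^esub>"
      thus ?thesis using submodule_zero[OF mor_module[OF l x] tr] by simp
    next
      assume "\<exists>m a g. m \<in> obj C \<and> lt l m \<and> a \<in> carrier (mor C l m) \<and> g \<in> carrier (mor C m x) \<and> f = comp C l m x g a"
      hence "f \<in> {comp C l m x g a | m a g. m \<in> obj C \<and> lt l m \<and> a \<in> carrier (mor C l m) \<and> g \<in> carrier (mor C m x)}"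
        by blast
      thus ?thesis unfolding standard_trace_eq[OF l x] by (rule subsetD[OF lin_span_superset])
    qed
  qed
qed

text \<open>Right multiplication by \<open>b\<close> maps \<open>P(m)\<close> onto \<open>F/F'\<close> with kernel \<open>U\<close>.  This identifies the layers of the
  filtrations with standard modules.\<close>

lemma generated_subquotient_iso:
  assumes l: "l \<in> obj C" and m: "m \<in> obj C"
    and F: "catmod_sub K C (projective C l) F" and F': "catmod_sub K C (projective C l) F'"
    and le: "\<And>x. x \<in> obj C \<Longrightarrow> F' x \<subseteq> F x"
    and U: "catmod_sub K C (projective C m) U"
    and b: "b \<in> F m"
    and gen: "\<And>x f. x \<in> obj C \<Longrightarrow> f \<in> F x \<Longrightarrow>
      \<exists>g\<in>carrier (mor C m x). f \<ominus>\<^bsub>mor C l x\<^esub> comp C l m x g b \<in> F' x"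
    and ker: "\<And>x g. x \<in> obj C \<Longrightarrow> g \<in> carrier (mor C m x) \<Longrightarrow> comp C l m x g b \<in> F' x \<longleftrightarrow> g \<in> U x"
  shows "catmod_iso K C (catmod_quot (catmod_restrict (projective C l) F) F')
    (catmod_quot (projective C m) U)"
proof -
  let ?P = "catmod_restrict (projective C l) F"
  note lin_cat = linear_category_axioms
  note P = catmod_restrict_left_module[OF projective_left_module[OF l] F]
  note S = catmod_sub_restrict[OF projective_left_module[OF l] F F' le]
  have valP: "val ?P x = (mor C l x)\<lparr>carrier := F x\<rparr>" for x
    by (simp add: catmod_restrict_val)
  have actP: "act ?P = comp C l" by (simp add: catmod_restrict_act)
  have modP: "module K ((mor C l x)\<lparr>carrier := F x\<rparr>)" if "x \<in> obj C" for x
    using left_module_val[OF P that] by (simp add: valP)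
  have subF: "submodule (F x) K (mor C l x)" if "x \<in> obj C" for x
    using catmod_sub_submodule[OF F that] by simp
  have subF': "submodule (F' x) K ((mor C l x)\<lparr>carrier := F x\<rparr>)" if "x \<in> obj C" for x
    using catmod_sub_submodule[OF S that] by (simp add: valP)
  have gb: "comp C l m x g b \<in> F x" if "x \<in> obj C" "g \<in> carrier (mor C m x)" for x g
    using catmod_sub_act[OF F m that b] by simp
  have bm: "b \<in> carrier (mor C l m)" using submodule_subset[OF mor_module[OF l m] subF[OF m]] b by blast
  have quotval: "val (catmod_quot ?P F') x = quot_space ((mor C l x)\<lparr>carrier := F x\<rparr>) (F' x)" for x
    by (simp add: catmod_quot_val valP)
  have gb_lin: "linear_hom K (mor C m x) ((mor C l x)\<lparr>carrier := F x\<rparr>) (\<lambda>g. comp C l m x g b)"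
    if "x \<in> obj C" for x
    using comp_linear_left[OF l m that bm] gb[OF that] by (auto simp: linear_hom_def)
  show ?thesis
  proof (rule common_presentation_iso[where Q = "mor C m" and
        \<alpha> = "\<lambda>x g. F' x +>\<^bsub>mor C l x\<^esub> comp C l m x g b" and \<beta> = "\<lambda>x g. U x +>\<^bsub>mor C m x\<^esub> g",
        OF lin_cat catmod_quot_left_module[OF lin_cat P S]])
    fix x assume x: "x \<in> obj C"
    note Ux = catmod_sub_submodule[OF U x, unfolded projective_simps]
    show "module K (val (catmod_quot (projective C m) U) x)"
      using quot_space_module[OF mor_module[OF m x] Ux] by (simp add: catmod_quot_val)
    show "module K (mor C m x)" by (rule mor_module[OF m x])
    show "linear_hom K (mor C m x) (val (catmod_quot ?P F') x) (\<lambda>g. F' x +>\<^bsub>mor C l x\<^esub> comp C l m x g b)"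
      using linear_hom_comp[OF gb_lin[OF x] quot_space_linear_hom[OF modP[OF x] subF'[OF x]]]
      by (simp add: quotval)
    show "linear_hom K (mor C m x) (val (catmod_quot (projective C m) U) x) (\<lambda>g. U x +>\<^bsub>mor C m x\<^esub> g)"
      using quot_space_linear_hom[OF mor_module[OF m x] Ux] by (simp add: catmod_quot_val)
    show "(\<lambda>g. U x +>\<^bsub>mor C m x\<^esub> g) ` carrier (mor C m x) = carrier (val (catmod_quot (projective C m) U) x)"
      by (simp add: catmod_quot_val quot_space_carrier)
    show "(\<lambda>g. F' x +>\<^bsub>mor C l x\<^esub> comp C l m x g b) ` carrier (mor C m x) = carrier (val (catmod_quot ?P F') x)"
    proof
      show "(\<lambda>g. F' x +>\<^bsub>mor C l x\<^esub> comp C l m x g b) ` carrier (mor C m x) \<subseteq> carrier (val (catmod_quot ?P F') x)"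
        using gb[OF x] by (auto simp: quotval quot_space_carrier)
      show "carrier (val (catmod_quot ?P F') x) \<subseteq> (\<lambda>g. F' x +>\<^bsub>mor C l x\<^esub> comp C l m x g b) ` carrier (mor C m x)"
      proof
        fix Y assume "Y \<in> carrier (val (catmod_quot ?P F') x)"
        then obtain f where f: "f \<in> F x" "Y = F' x +>\<^bsub>mor C l x\<^esub> f" by (auto simp: quotval quot_space_carrier)
        obtain g where g: "g \<in> carrier (mor C m x)" "f \<ominus>\<^bsub>mor C l x\<^esub> comp C l m x g b \<in> F' x"
          using gen[OF x f(1)] by blast
        have "F' x +>\<^bsub>mor C l x\<^esub> f = F' x +>\<^bsub>mor C l x\<^esub> comp C l m x g b"
          using coset_eq_iff[OF mor_module[OF l x], of "F' x" f "comp C l m x g b"] g(2)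
            catmod_sub_submodule[OF F' x] subsetD[OF submodule_subset[OF mor_module[OF l x] subF[OF x]] f(1)]
            comp_closed[OF l m x bm g(1)] by simp
        thus "Y \<in> (\<lambda>g. F' x +>\<^bsub>mor C l x\<^esub> comp C l m x g b) ` carrier (mor C m x)" using f g by blast
      qed
    qed
    fix g assume g: "g \<in> carrier (mor C m x)"
    show "F' x +>\<^bsub>mor C l x\<^esub> comp C l m x g b = \<zero>\<^bsub>val (catmod_quot ?P F') x\<^esub> \<longleftrightarrow>
        U x +>\<^bsub>mor C m x\<^esub> g = \<zero>\<^bsub>val (catmod_quot (projective C m) U) x\<^esub>"
      using coset_zero_iff[OF modP[OF x] subF'[OF x], of "comp C l m x g b"] gb[OF x g] ker[OF x g]
        coset_zero_iff[OF mor_module[OF m x] Ux g]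
      by (simp add: catmod_quot_val quot_space_zero)
    fix y h assume y: "y \<in> obj C" and h: "h \<in> carrier (mor C x y)"
    have "F' y +>\<^bsub>mor C l y\<^esub> comp C l m y (comp C m x y h g) b =
        act (catmod_quot ?P F') x y h (F' x +>\<^bsub>mor C l x\<^esub> comp C l m x g b)"
      using catmod_quot_act[OF P S x y h, of "comp C l m x g b"] gb[OF x g] comp_assoc[OF l m x y bm g h]
      by (simp add: valP actP)
    moreover have "U y +>\<^bsub>mor C m y\<^esub> comp C m x y h g =
        act (catmod_quot (projective C m) U) x y h (U x +>\<^bsub>mor C m x\<^esub> g)"
      using catmod_quot_act[OF projective_left_module[OF m] U x y h, of g] g by simp
    ultimately show "\<exists>q'\<in>carrier (mor C m y).
        F' y +>\<^bsub>mor C l y\<^esub> comp C l m y q' b =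
          act (catmod_quot ?P F') x y h (F' x +>\<^bsub>mor C l x\<^esub> comp C l m x g b) \<and>
        U y +>\<^bsub>mor C m y\<^esub> q' = act (catmod_quot (projective C m) U) x y h (U x +>\<^bsub>mor C m x\<^esub> g)"
      using comp_closed[OF m x y g h] by blast
  qed
qed

text \<open>A quotient of \<open>P(l)\<close> is generated by the class of the identity, so an endomorphism is determined by the image
  of that class, which is a scalar multiple of it when the value at \<open>l\<close> is one-dimensional.\<close>

lemma end_is_ground_field_quotient:
  assumes l: "l \<in> obj C" and U: "catmod_sub K C (projective C l) U"
    and scalar: "\<And>f. f \<in> carrier (mor C l l) \<Longrightarrow>
      \<exists>c\<in>carrier K. f \<ominus>\<^bsub>mor C l l\<^esub> c \<odot>\<^bsub>mor C l l\<^esub> idm C l \<in> U l"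
    and nz: "idm C l \<notin> U l"
  shows "end_is_ground_field K C (catmod_quot (projective C l) U)"
  unfolding end_is_ground_field_def
proof (intro allI impI)
  let ?D = "catmod_quot (projective C l) U"
  let ?e = "U l +>\<^bsub>mor C l l\<^esub> idm C l"
  note lin_cat = linear_category_axioms
  note P = projective_left_module[OF l]
  note Dm = catmod_quot_left_module[OF lin_cat P U]
  have valD: "val ?D x = quot_space (mor C l x) (U x)" for x by (simp add: catmod_quot_val)
  have Us: "submodule (U x) K (mor C l x)" if "x \<in> obj C" for x
    using catmod_sub_submodule[OF U that] by simp
  interpret L: module K "mor C l l" by (rule mor_module[OF l l])
  interpret Dl: module K "val ?D l" by (rule left_module_val[OF Dm l])
  have id: "idm C l \<in> carrier (mor C l l)" by (rule idm_closed[OF l])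
  have e: "?e \<in> carrier (val ?D l)" using id by (simp add: valD quot_space_carrier)
  have act_e: "act ?D l x g ?e = U x +>\<^bsub>mor C l x\<^esub> g" if x: "x \<in> obj C" and g: "g \<in> carrier (mor C l x)" for x g
    using catmod_quot_act[OF P U l x g, of "idm C l"] id comp_idm_right[OF l x g] by simp
  fix \<phi> assume \<phi>: "catmod_hom K C ?D ?D \<phi>"
  have "\<phi> l ?e \<in> carrier (val ?D l)" by (rule linear_hom_closed[OF catmod_hom_linear[OF \<phi> l] e])
  then obtain f where f: "f \<in> carrier (mor C l l)" "\<phi> l ?e = U l +>\<^bsub>mor C l l\<^esub> f"
    by (auto simp: valD quot_space_carrier)
  obtain c where c: "c \<in> carrier K" "f \<ominus>\<^bsub>mor C l l\<^esub> c \<odot>\<^bsub>mor C l l\<^esub> idm C l \<in> U l"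
    using scalar[OF f(1)] by blast
  have \<phi>e: "\<phi> l ?e = c \<odot>\<^bsub>val ?D l\<^esub> ?e"
    using coset_eq_iff[OF mor_module[OF l l] Us[OF l] f(1) L.smult_closed[OF c(1) id]] c f(2)
      quot_space_smult[OF mor_module[OF l l] Us[OF l] c(1) id] by (simp add: valD)
  have \<phi>c: "\<phi> x v = c \<odot>\<^bsub>val ?D x\<^esub> v" if x: "x \<in> obj C" and v: "v \<in> carrier (val ?D x)" for x v
  proof -
    obtain g where g: "g \<in> carrier (mor C l x)" "v = U x +>\<^bsub>mor C l x\<^esub> g"
      using v by (auto simp: valD quot_space_carrier)
    have v: "v = act ?D l x g ?e" using act_e[OF x g(1)] g(2) by simp
    have "\<phi> x v = act ?D l x g (\<phi> l ?e)" using catmod_hom_act[OF \<phi> l x g(1) e] v by simp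
    also have "\<dots> = c \<odot>\<^bsub>val ?D x\<^esub> act ?D l x g ?e"
      unfolding \<phi>e by (rule linear_hom_smult[OF left_module_act[OF Dm l x g(1)] c(1) e])
    finally show ?thesis using v by simp
  qed
  have uniq: "d = c" if d: "d \<in> carrier K" "d \<odot>\<^bsub>val ?D l\<^esub> ?e = c \<odot>\<^bsub>val ?D l\<^esub> ?e" for d
  proof (rule ccontr)
    assume ne: "d \<noteq> c"
    let ?d = "d \<ominus>\<^bsub>K\<^esub> c"
    have dK: "?d \<in> carrier K" "?d \<noteq> \<zero>\<^bsub>K\<^esub>" using d c ne K.minus_zero_imp_eq[of d c] by auto
    have "d \<odot>\<^bsub>mor C l l\<^esub> idm C l \<ominus>\<^bsub>mor C l l\<^esub> c \<odot>\<^bsub>mor C l l\<^esub> idm C l \<in> U l"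
      using d(2) coset_eq_iff[OF mor_module[OF l l] Us[OF l] L.smult_closed[OF d(1) id] L.smult_closed[OF c(1) id]]
      by (simp add: valD quot_space_smult[OF mor_module[OF l l] Us[OF l] _ id] c d)
    hence "?d \<odot>\<^bsub>mor C l l\<^esub> idm C l \<in> U l"
      using c d id L.smult_l_minus[of c] by (simp add: a_minus_def L.smult_l_distr)
    hence "inv\<^bsub>K\<^esub> ?d \<odot>\<^bsub>mor C l l\<^esub> (?d \<odot>\<^bsub>mor C l l\<^esub> idm C l) \<in> U l"
      using dK by (intro submodule_smult[OF mor_module[OF l l] Us[OF l] _ \<open>?d \<odot>\<^bsub>mor C l l\<^esub> idm C l \<in> U l\<close>])
        (auto simp: K.field_Units)
    moreover have "inv\<^bsub>K\<^esub> ?d \<odot>\<^bsub>mor C l l\<^esub> (?d \<odot>\<^bsub>mor C l l\<^esub> idm C l) = idm C l"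
      using dK id by (subst L.smult_assoc1[symmetric]) (auto simp: K.field_Units)
    ultimately show False using nz by simp
  qed
  show "\<exists>!c. c \<in> carrier K \<and> (\<forall>x\<in>obj C. \<forall>v\<in>carrier (val ?D x). \<phi> x v = c \<odot>\<^bsub>val ?D x\<^esub> v)"
  proof (rule ex1I[of _ c])
    show "c \<in> carrier K \<and> (\<forall>x\<in>obj C. \<forall>v\<in>carrier (val ?D x). \<phi> x v = c \<odot>\<^bsub>val ?D x\<^esub> v)"
      using c(1) \<phi>c by simp
    fix d assume "d \<in> carrier K \<and> (\<forall>x\<in>obj C. \<forall>v\<in>carrier (val ?D x). \<phi> x v = d \<odot>\<^bsub>val ?D x\<^esub> v)"
    thus "d = c" using uniq[of d] l e \<phi>e by auto
  qed
qed

end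

lemma catmod_iso_cong:
  assumes "catmod_iso K C M L"
    and "\<And>x. x \<in> obj C \<Longrightarrow> val M' x = val M x"
    and "\<And>x y. x \<in> obj C \<Longrightarrow> y \<in> obj C \<Longrightarrow> act M' x y = act M x y"
  shows "catmod_iso K C M' L"
proof -
  have "left_module K C M \<Longrightarrow> left_module K C M'"
    unfolding left_module_def using assms(2,3) by simp
  moreover have "catmod_hom K C M L \<phi> \<Longrightarrow> catmod_hom K C M' L \<phi>" for \<phi>
    unfolding catmod_hom_def using assms(2,3) by simp
  ultimately show ?thesis using assms unfolding catmod_iso_def by auto
qed

text \<open>Standard filtrations grow from the bottom in the proofs below, one layer at a time, so they are built
  inductively before they are turned into the numbered chain of the definition.\<close>

inductive std_filtered :: "('k, 'c) ring_scheme \<Rightarrow> ('k, 'o, 'm) lincat \<Rightarrow> ('o \<Rightarrow> 'o \<Rightarrow> bool) \<Rightarrow> 'o \<Rightarrow>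
    ('o \<Rightarrow> 'm set) \<Rightarrow> bool"
  for K C lt l where
  zero: "catmod_sub K C (projective C l) F \<Longrightarrow> (\<And>x. x \<in> obj C \<Longrightarrow> F x = {\<zero>\<^bsub>mor C l x\<^esub>}) \<Longrightarrow>
    std_filtered K C lt l F"
| step: "catmod_sub K C (projective C l) F \<Longrightarrow> std_filtered K C lt l F' \<Longrightarrow>
    (\<And>x. x \<in> obj C \<Longrightarrow> F' x \<subseteq> F x) \<Longrightarrow> m \<in> obj C \<Longrightarrow> lt l m \<Longrightarrow>
    catmod_iso K C (catmod_quot (catmod_restrict (projective C l) F) F') (standard K C lt m) \<Longrightarrow>
    std_filtered K C lt l F"

lemma std_filtered_sub: "std_filtered K C lt l F \<Longrightarrow> catmod_sub K C (projective C l) F"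
  by (erule std_filtered.cases) auto

lemma catmod_sub_cong:
  "catmod_sub K C M F \<Longrightarrow> (\<And>x. x \<in> obj C \<Longrightarrow> F x = G x) \<Longrightarrow> catmod_sub K C M G"
  unfolding catmod_sub_def by simp

lemma std_filtered_cong:
  assumes "std_filtered K C lt l F" and eq: "\<And>x. x \<in> obj C \<Longrightarrow> F x = G x"
  shows "std_filtered K C lt l G"
  using assms(1)
proof cases
  case zero
  thus ?thesis using eq by (intro std_filtered.zero[OF catmod_sub_cong[OF zero(1) eq]]) auto
next
  case (step F' m)
  show ?thesis
  proof (rule std_filtered.step[OF catmod_sub_cong[OF step(1) eq] step(2) _ step(4,5)])
    show "F' x \<subseteq> G x" if "x \<in> obj C" for x using step(3) eq that by blast
    show "catmod_iso K C (catmod_quot (catmod_restrict (projective C l) G) F') (standard K C lt m)"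
      by (rule catmod_iso_cong[OF step(6)])
        (simp_all add: catmod_quot_def catmod_restrict_def eq)
  qed auto
qed

lemma catmod_iso_refl: "left_module K C M \<Longrightarrow> catmod_iso K C M M"
  unfolding catmod_iso_def catmod_hom_def
  by (intro conjI exI[of _ "\<lambda>x v. v"]) (auto simp: linear_hom_def bij_betw_def)

lemma std_filtered_chain:
  assumes "std_filtered K C lt l F"
  shows "\<exists>(n::nat) G m. G 0 = F \<and> (\<forall>x\<in>obj C. G n x = {\<zero>\<^bsub>mor C l x\<^esub>}) \<and>
    (\<forall>k\<le>n. catmod_sub K C (projective C l) (G k)) \<and>
    (\<forall>k<n. \<forall>x\<in>obj C. G (Suc k) x \<subseteq> G k x) \<and>
    (\<forall>k<n. m k \<in> obj C \<and> lt l (m k)) \<and>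
    (\<forall>k<n. catmod_iso K C (catmod_quot (catmod_restrict (projective C l) (G k)) (G (Suc k)))
       (standard K C lt (m k)))"
  using assms
proof induction
  case (zero F)
  thus ?case by (intro exI[of _ 0] exI[of _ "\<lambda>_. F"]) auto
next
  case (step F F' m)
  then obtain n G ms where *: "G 0 = F'" "\<forall>x\<in>obj C. G n x = {\<zero>\<^bsub>mor C l x\<^esub>}"
    "\<forall>k\<le>n. catmod_sub K C (projective C l) (G k)"
    "\<forall>k<n. \<forall>x\<in>obj C. G (Suc k) x \<subseteq> G k x"
    "\<forall>k<n. ms k \<in> obj C \<and> lt l (ms k)"
    "\<forall>k<n. catmod_iso K C (catmod_quot (catmod_restrict (projective C l) (G k)) (G (Suc k)))
       (standard K C lt (ms k))" by (elim exE conjE) blast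
  show ?case
    by (rule exI[of _ "Suc n"], rule exI[of _ "case_nat F G"], rule exI[of _ "case_nat m ms"])
      (use * step in \<open>auto split: nat.splits simp: less_Suc_eq_0_disj\<close>)
qed

text \<open>The top layer is the standard module of \<open>l\<close> by definition, so only the trace has to be filtered.\<close>

lemma has_standard_filtrationI:
  assumes C: "linear_category K C" and l: "l \<in> obj C"
    and filtered: "std_filtered K C lt l (standard_trace K C lt l)"
  shows "has_standard_filtration K C lt l"
proof -
  interpret linear_category K C by fact
  define F where "F = standard_trace K C lt l"
  have F: "std_filtered K C lt l F" using filtered by (simp add: F_def)
  have iso: "catmod_iso K C (catmod_quot (projective C l) F) (standard K C lt l)"
    unfolding standard_def F_def
    by (rule catmod_iso_refl[OF catmod_quot_left_module[OF C projective_left_module[OF l] standard_trace_sub[OF l]]])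
  obtain n G m where *: "G 0 = F" "\<forall>x\<in>obj C. G n x = {\<zero>\<^bsub>mor C l x\<^esub>}"
    "\<forall>k\<le>n. catmod_sub K C (projective C l) (G k)"
    "\<forall>k<n. \<forall>x\<in>obj C. G (Suc k) x \<subseteq> G k x"
    "\<forall>k<n. m k \<in> obj C \<and> lt l (m k)"
    "\<forall>k<n. catmod_iso K C (catmod_quot (catmod_restrict (projective C l) (G k)) (G (Suc k)))
       (standard K C lt (m k))" using std_filtered_chain[OF F] by (elim exE conjE) blast
  let ?G = "case_nat (\<lambda>x. carrier (mor C l x)) G" and ?m = "case_nat l m"
  have all: "catmod_sub K C (projective C l) (\<lambda>x. carrier (mor C l x))"
    using submodule_carrier[OF mor_module[OF l]] comp_closed[OF l] by (simp add: catmod_sub_def)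
  have "catmod_restrict (projective C l) (\<lambda>x. carrier (mor C l x)) = projective C l"
    by (simp add: catmod_restrict_def)
  hence iso0: "catmod_iso K C (catmod_quot (catmod_restrict (projective C l) (\<lambda>x. carrier (mor C l x))) (G 0)) (standard K C lt l)"
    using iso *(1) by simp
  have sub: "G 0 x \<subseteq> carrier (mor C l x)" if "x \<in> obj C" for x
    using catmod_sub_submodule[OF std_filtered_sub[OF F] that] submodule_subset[OF mor_module[OF l that]] *(1)
    by simp
  show ?thesis unfolding has_standard_filtration_def
    by (rule exI[of _ n], rule exI[of _ ?G], rule exI[of _ ?m], intro conjI allI impI ballI)
      (use * all iso0 sub in \<open>auto split: nat.splits simp: Suc_le_eq\<close>)
qed


section \<open>Direct sums\<close>

lemma dsum_carrier_iff:
  "f \<in> carrier (dsum J V) \<longleftrightarrow> f \<in> extensional J \<and> (\<forall>j\<in>J. f j \<in> carrier (V j)) \<and>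
    finite {j\<in>J. f j \<noteq> \<zero>\<^bsub>V j\<^esub>}"
  by (auto simp: dsum_def PiE_def)

lemma dsum_simps:
  "\<zero>\<^bsub>dsum J V\<^esub> = (\<lambda>j\<in>J. \<zero>\<^bsub>V j\<^esub>)"
  "f \<oplus>\<^bsub>dsum J V\<^esub> g = (\<lambda>j\<in>J. f j \<oplus>\<^bsub>V j\<^esub> g j)"
  "c \<odot>\<^bsub>dsum J V\<^esub> f = (\<lambda>j\<in>J. c \<odot>\<^bsub>V j\<^esub> f j)"
  by (simp_all add: dsum_def)

text \<open>Finite supports are preserved because the maps send zero to zero.\<close>

lemma dsum_map_closed:
  assumes "f \<in> carrier (dsum J V)" "\<And>j v. j \<in> J \<Longrightarrow> v \<in> carrier (V j) \<Longrightarrow> h j v \<in> carrier (W j)"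
    "\<And>j. j \<in> J \<Longrightarrow> h j \<zero>\<^bsub>V j\<^esub> = \<zero>\<^bsub>W j\<^esub>"
  shows "(\<lambda>j\<in>J. h j (f j)) \<in> carrier (dsum J W)"
proof -
  have "{j\<in>J. h j (f j) \<noteq> \<zero>\<^bsub>W j\<^esub>} \<subseteq> {j\<in>J. f j \<noteq> \<zero>\<^bsub>V j\<^esub>}" using assms(3) by auto
  hence "finite {j\<in>J. h j (f j) \<noteq> \<zero>\<^bsub>W j\<^esub>}" using assms(1) finite_subset
    by (auto simp: dsum_carrier_iff)
  moreover have "{j\<in>J. (\<lambda>j\<in>J. h j (f j)) j \<noteq> \<zero>\<^bsub>W j\<^esub>} = {j\<in>J. h j (f j) \<noteq> \<zero>\<^bsub>W j\<^esub>}" by auto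
  ultimately show ?thesis using assms(1,2) by (auto simp: dsum_carrier_iff)
qed

lemma dsum_add_closed:
  assumes V: "\<And>j. j \<in> J \<Longrightarrow> module K (V j)"
    and f: "f \<in> carrier (dsum J V)" and g: "g \<in> carrier (dsum J V)"
  shows "f \<oplus>\<^bsub>dsum J V\<^esub> g \<in> carrier (dsum J V)"
proof -
  have mon: "abelian_monoid (V j)" if "j \<in> J" for j
    using V[OF that] by (simp add: module_def abelian_group_def)
  have "{j\<in>J. f j \<oplus>\<^bsub>V j\<^esub> g j \<noteq> \<zero>\<^bsub>V j\<^esub>} \<subseteq> {j\<in>J. f j \<noteq> \<zero>\<^bsub>V j\<^esub>} \<union> {j\<in>J. g j \<noteq> \<zero>\<^bsub>V j\<^esub>}"
    using abelian_monoid.l_zero[OF mon] abelian_monoid.zero_closed[OF mon] by auto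
  hence "finite {j\<in>J. f j \<oplus>\<^bsub>V j\<^esub> g j \<noteq> \<zero>\<^bsub>V j\<^esub>}" using f g
    by (auto simp: dsum_carrier_iff intro: finite_subset)
  moreover have "{j\<in>J. (f \<oplus>\<^bsub>dsum J V\<^esub> g) j \<noteq> \<zero>\<^bsub>V j\<^esub>} = {j\<in>J. f j \<oplus>\<^bsub>V j\<^esub> g j \<noteq> \<zero>\<^bsub>V j\<^esub>}"
    by (auto simp: dsum_simps)
  ultimately show ?thesis using f g abelian_monoid.a_closed[OF mon]
    by (auto simp: dsum_carrier_iff dsum_simps(2))
qed

lemma dsum_module:
  assumes K: "cring K" and V: "\<And>j. j \<in> J \<Longrightarrow> module K (V j)"
  shows "module K (dsum J V)"
proof -
  have ab: "abelian_group (V j)" if "j \<in> J" for j using V[OF that] by (simp add: module_def)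
  have mon: "abelian_monoid (V j)" if "j \<in> J" for j using ab[OF that] by (simp add: abelian_group_def)
  have mem: "f j \<in> carrier (V j)" if "f \<in> carrier (dsum J V)" "j \<in> J" for f j
    using that by (auto simp: dsum_carrier_iff)
  have ext: "f \<in> extensional J" if "f \<in> carrier (dsum J V)" for f
    using that by (auto simp: dsum_carrier_iff)
  note eqI = extensionalityI[OF restrict_extensional]
  have sm: "c \<odot>\<^bsub>dsum J V\<^esub> f \<in> carrier (dsum J V)" if "c \<in> carrier K" "f \<in> carrier (dsum J V)" for c f
    unfolding dsum_simps
    by (rule dsum_map_closed[OF that(2)])
      (use that(1) in \<open>auto intro: module.smult_closed[OF V] module.smult_r_null[OF V]\<close>)
  have A: "abelian_group (dsum J V)"
  proof (rule abelian_groupI)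
    fix f g h assume f: "f \<in> carrier (dsum J V)" and g: "g \<in> carrier (dsum J V)" and h: "h \<in> carrier (dsum J V)"
    show "f \<oplus>\<^bsub>dsum J V\<^esub> g \<oplus>\<^bsub>dsum J V\<^esub> h = f \<oplus>\<^bsub>dsum J V\<^esub> (g \<oplus>\<^bsub>dsum J V\<^esub> h)"
      using f g h mem abelian_monoid.a_assoc[OF mon] by (simp add: dsum_simps cong: restrict_cong)
  next
    fix f g assume f: "f \<in> carrier (dsum J V)" and g: "g \<in> carrier (dsum J V)"
    show "f \<oplus>\<^bsub>dsum J V\<^esub> g \<in> carrier (dsum J V)" by (rule dsum_add_closed[OF V f g])
    show "f \<oplus>\<^bsub>dsum J V\<^esub> g = g \<oplus>\<^bsub>dsum J V\<^esub> f"
      using f g mem abelian_monoid.a_comm[OF mon] by (simp add: dsum_simps cong: restrict_cong)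
  next
    have "{j\<in>J. (\<lambda>j\<in>J. \<zero>\<^bsub>V j\<^esub>) j \<noteq> \<zero>\<^bsub>V j\<^esub>} = {}" by auto
    thus "\<zero>\<^bsub>dsum J V\<^esub> \<in> carrier (dsum J V)"
      using abelian_monoid.zero_closed[OF mon] by (auto simp: dsum_carrier_iff dsum_simps)
  next
    fix f assume f: "f \<in> carrier (dsum J V)"
    show "\<zero>\<^bsub>dsum J V\<^esub> \<oplus>\<^bsub>dsum J V\<^esub> f = f" unfolding dsum_simps
      by (rule eqI[OF ext[OF f]]) (use f mem abelian_monoid.l_zero[OF mon] in auto)
    have "(\<ominus>\<^bsub>K\<^esub> \<one>\<^bsub>K\<^esub>) \<odot>\<^bsub>dsum J V\<^esub> f \<oplus>\<^bsub>dsum J V\<^esub> f = \<zero>\<^bsub>dsum J V\<^esub>" unfolding dsum_simps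
    proof (rule eqI[OF restrict_extensional], unfold restrict_def)
      fix j assume j: "j \<in> J"
      interpret V: module K "V j" by (rule V[OF j])
      show "(if j \<in> J then (if j \<in> J then (\<ominus>\<^bsub>K\<^esub> \<one>\<^bsub>K\<^esub>) \<odot>\<^bsub>V j\<^esub> f j else undefined) \<oplus>\<^bsub>V j\<^esub> f j else undefined) =
         (if j \<in> J then \<zero>\<^bsub>V j\<^esub> else undefined)"
        using j mem[OF f j] V.smult_l_minus[of "\<one>\<^bsub>K\<^esub>" "f j"] by (simp add: V.M.l_neg)
    qed
    moreover have "(\<ominus>\<^bsub>K\<^esub> \<one>\<^bsub>K\<^esub>) \<in> carrier K"
      using abelian_group.a_inv_closed[OF ring.is_abelian_group[OF cring.axioms(1)[OF K]]]
        ring.ring_simprules(6)[OF cring.axioms(1)[OF K]] by simp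
    ultimately show "\<exists>g\<in>carrier (dsum J V). g \<oplus>\<^bsub>dsum J V\<^esub> f = \<zero>\<^bsub>dsum J V\<^esub>" using sm[OF _ f] by blast
  qed
  show ?thesis
  proof (rule moduleI[OF K A sm])
    fix a b f assume a: "a \<in> carrier K" and b: "b \<in> carrier K" and f: "f \<in> carrier (dsum J V)"
    show "(a \<oplus>\<^bsub>K\<^esub> b) \<odot>\<^bsub>dsum J V\<^esub> f = a \<odot>\<^bsub>dsum J V\<^esub> f \<oplus>\<^bsub>dsum J V\<^esub> b \<odot>\<^bsub>dsum J V\<^esub> f"
      using a b mem[OF f] module.smult_l_distr[OF V] by (simp add: dsum_simps cong: restrict_cong)
    show "a \<otimes>\<^bsub>K\<^esub> b \<odot>\<^bsub>dsum J V\<^esub> f = a \<odot>\<^bsub>dsum J V\<^esub> (b \<odot>\<^bsub>dsum J V\<^esub> f)"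
      using a b mem[OF f] module.smult_assoc1[OF V] by (simp add: dsum_simps cong: restrict_cong)
  next
    fix a f g assume a: "a \<in> carrier K" and f: "f \<in> carrier (dsum J V)" and g: "g \<in> carrier (dsum J V)"
    show "a \<odot>\<^bsub>dsum J V\<^esub> (f \<oplus>\<^bsub>dsum J V\<^esub> g) = a \<odot>\<^bsub>dsum J V\<^esub> f \<oplus>\<^bsub>dsum J V\<^esub> a \<odot>\<^bsub>dsum J V\<^esub> g"
      using a mem[OF f] mem[OF g] module.smult_r_distr[OF V] by (simp add: dsum_simps cong: restrict_cong)
  next
    fix f assume f: "f \<in> carrier (dsum J V)"
    show "\<one>\<^bsub>K\<^esub> \<odot>\<^bsub>dsum J V\<^esub> f = f" unfolding dsum_simps
      by (rule eqI[OF ext[OF f]]) (use mem[OF f] module.smult_one[OF V] in auto)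
  qed
qed

lemma dsum_map_linear:
  assumes V: "\<And>j. j \<in> J \<Longrightarrow> module K (V j)" and W: "\<And>j. j \<in> J \<Longrightarrow> module K (W j)"
    and h: "\<And>j. j \<in> J \<Longrightarrow> linear_hom K (V j) (W j) (h j)"
  shows "linear_hom K (dsum J V) (dsum J W) (\<lambda>f. \<lambda>j\<in>J. h j (f j))"
proof -
  have "(\<lambda>j\<in>J. h j (f j)) \<in> carrier (dsum J W)" if "f \<in> carrier (dsum J V)" for f
    by (rule dsum_map_closed[OF that, of h W])
      (auto intro: linear_hom_closed[OF h] linear_hom_zero[OF V W h])
  moreover have "f j \<in> carrier (V j)" if "f \<in> carrier (dsum J V)" "j \<in> J" for f j
    using that by (auto simp: dsum_carrier_iff)
  ultimately show ?thesis
    using linear_hom_add[OF h] linear_hom_smult[OF h]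
    by (auto simp: linear_hom_def dsum_simps cong: restrict_cong)
qed

lemma catmod_dsum_val: "val (catmod_dsum J M) x = dsum J (\<lambda>j. val (M j) x)"
  and catmod_dsum_act: "act (catmod_dsum J M) x y g f = (\<lambda>j\<in>J. act (M j) x y g (f j))"
  by (simp_all add: catmod_dsum_def)

lemma catmod_dsum_left_module:
  assumes C: "linear_category K C" and M: "\<And>j. j \<in> J \<Longrightarrow> left_module K C (M j)"
  shows "left_module K C (catmod_dsum J M)"
proof -
  interpret C: linear_category K C by fact
  have mem: "f j \<in> carrier (val (M j) x)" if "f \<in> carrier (dsum J (\<lambda>j. val (M j) x))" "j \<in> J" for f j x
    using that by (auto simp: dsum_carrier_iff)
  have 1: "module K (dsum J (\<lambda>j. val (M j) x))" if "x \<in> obj C" for x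
    by (rule dsum_module[OF C.K.is_cring left_module_val[OF M that]])
  have 2: "linear_hom K (dsum J (\<lambda>j. val (M j) x)) (dsum J (\<lambda>j. val (M j) y)) (\<lambda>f. \<lambda>j\<in>J. act (M j) x y g (f j))"
    if "x \<in> obj C" "y \<in> obj C" "g \<in> carrier (mor C x y)" for x y g
    by (rule dsum_map_linear[OF left_module_val[OF M that(1)] left_module_val[OF M that(2)]
          left_module_act[OF M that]])
  have 3: "linear_hom K (mor C x y) (dsum J (\<lambda>j. val (M j) y)) (\<lambda>g. \<lambda>j\<in>J. act (M j) x y g (f j))"
    if x: "x \<in> obj C" and y: "y \<in> obj C" and f: "f \<in> carrier (dsum J (\<lambda>j. val (M j) x))" for x y f
    unfolding linear_hom_def
  proof (intro conjI ballI Pi_I)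
    fix g assume g: "g \<in> carrier (mor C x y)"
    show "(\<lambda>j\<in>J. act (M j) x y g (f j)) \<in> carrier (dsum J (\<lambda>j. val (M j) y))"
      by (rule linear_hom_closed[OF 2[OF x y g] f])
    show "(\<lambda>j\<in>J. act (M j) x y (c \<odot>\<^bsub>mor C x y\<^esub> g) (f j)) =
        c \<odot>\<^bsub>dsum J (\<lambda>j. val (M j) y)\<^esub> (\<lambda>j\<in>J. act (M j) x y g (f j))" if c: "c \<in> carrier K" for c
      using linear_hom_smult[OF left_module_act_mor[OF M x y mem[OF f]] c g]
      by (simp add: dsum_simps cong: restrict_cong)
    show "(\<lambda>j\<in>J. act (M j) x y (g \<oplus>\<^bsub>mor C x y\<^esub> h) (f j)) =
        (\<lambda>j\<in>J. act (M j) x y g (f j)) \<oplus>\<^bsub>dsum J (\<lambda>j. val (M j) y)\<^esub> (\<lambda>j\<in>J. act (M j) x y h (f j))"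
      if h: "h \<in> carrier (mor C x y)" for h
      using linear_hom_add[OF left_module_act_mor[OF M x y mem[OF f]] g h]
      by (simp add: dsum_simps cong: restrict_cong)
  qed
  have 4: "(\<lambda>j\<in>J. act (M j) x x (idm C x) (f j)) = f"
    if x: "x \<in> obj C" and f: "f \<in> carrier (dsum J (\<lambda>j. val (M j) x))" for x f
    by (rule extensionalityI[OF restrict_extensional])
      (use f left_module_idm[OF M x] in \<open>auto simp: dsum_carrier_iff\<close>)
  have 5: "(\<lambda>j\<in>J. act (M j) x z (comp C x y z g h) (f j)) =
      (\<lambda>j\<in>J. act (M j) y z g ((\<lambda>j\<in>J. act (M j) x y h (f j)) j))"
    if "x \<in> obj C" "y \<in> obj C" "z \<in> obj C" "h \<in> carrier (mor C x y)" "g \<in> carrier (mor C y z)"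
      "f \<in> carrier (dsum J (\<lambda>j. val (M j) x))" for x y z h g f
    using left_module_comp[OF M that(1-5) mem[OF that(6)]] by (simp cong: restrict_cong)
  have act: "act (catmod_dsum J M) x y g = (\<lambda>f. \<lambda>j\<in>J. act (M j) x y g (f j))" for x y g
    by (simp add: catmod_dsum_def)
  show ?thesis unfolding left_module_def catmod_dsum_val act using 1 2 3 4 5 by (simp add: Ball_def)
qed

lemma catmod_dsum_iso:
  assumes C: "linear_category K C" and iso: "\<And>j. j \<in> J \<Longrightarrow> catmod_iso K C (M j) (L j)"
  shows "catmod_iso K C (catmod_dsum J M) (catmod_dsum J L)"
proof -
  have M: "left_module K C (M j)" and L: "left_module K C (L j)" if "j \<in> J" for j
    using iso[OF that] by (auto simp: catmod_iso_def)
  have "\<forall>j\<in>J. \<exists>\<phi>. catmod_hom K C (M j) (L j) \<phi> \<and>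
      (\<forall>x\<in>obj C. bij_betw (\<phi> x) (carrier (val (M j) x)) (carrier (val (L j) x)))"
    using iso by (auto simp: catmod_iso_def)
  from bchoice[OF this] obtain \<phi> where \<phi>: "\<And>j. j \<in> J \<Longrightarrow> catmod_hom K C (M j) (L j) (\<phi> j)"
    and bij: "\<And>j x. j \<in> J \<Longrightarrow> x \<in> obj C \<Longrightarrow> bij_betw (\<phi> j x) (carrier (val (M j) x)) (carrier (val (L j) x))"
    by blast
  define \<Phi> where "\<Phi> x f = (\<lambda>j\<in>J. \<phi> j x (f j))" for x f
  have lin: "linear_hom K (dsum J (\<lambda>j. val (M j) x)) (dsum J (\<lambda>j. val (L j) x)) (\<Phi> x)" if x: "x \<in> obj C" for x
    unfolding \<Phi>_def
    by (rule dsum_map_linear[OF left_module_val[OF M x] left_module_val[OF L x] catmod_hom_linear[OF \<phi> x]])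
  have hom: "catmod_hom K C (catmod_dsum J M) (catmod_dsum J L) \<Phi>"
    unfolding catmod_hom_def catmod_dsum_val catmod_dsum_act
  proof (intro conjI ballI lin)
    fix x y g f assume a: "x \<in> obj C" "y \<in> obj C" "g \<in> carrier (mor C x y)"
      and f: "f \<in> carrier (dsum J (\<lambda>j. val (M j) x))"
    have "f j \<in> carrier (val (M j) x)" if "j \<in> J" for j using that f by (auto simp: dsum_carrier_iff)
    thus "\<Phi> y (\<lambda>j\<in>J. act (M j) x y g (f j)) = (\<lambda>j\<in>J. act (L j) x y g (\<Phi> x f j))"
      using catmod_hom_act[OF \<phi> a] by (simp add: \<Phi>_def cong: restrict_cong)
  qed
  have "bij_betw (\<Phi> x) (carrier (dsum J (\<lambda>j. val (M j) x))) (carrier (dsum J (\<lambda>j. val (L j) x)))"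
    (is "bij_betw _ ?A ?B") if x: "x \<in> obj C" for x
  proof (rule bij_betw_imageI)
    show "inj_on (\<Phi> x) ?A"
    proof (rule inj_onI, rule extensionalityI[of _ J])
      fix f g j assume f: "f \<in> ?A" and g: "g \<in> ?A" and e: "\<Phi> x f = \<Phi> x g"
      show "f \<in> extensional J" "g \<in> extensional J" using f g by (auto simp: dsum_carrier_iff)
      assume j: "j \<in> J"
      have "\<phi> j x (f j) = \<phi> j x (g j)" using fun_cong[OF e, of j] j by (simp add: \<Phi>_def)
      thus "f j = g j" using inj_onD[OF bij_betw_imp_inj_on[OF bij[OF j x]]] f g j
        by (auto simp: dsum_carrier_iff)
    qed
    show "\<Phi> x ` ?A = ?B"
    proof
      show "\<Phi> x ` ?A \<subseteq> ?B" using linear_hom_closed[OF lin[OF x]] by blast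
      show "?B \<subseteq> \<Phi> x ` ?A"
      proof
        fix g assume g: "g \<in> ?B"
        let ?\<psi> = "\<lambda>j. inv_into (carrier (val (M j) x)) (\<phi> j x)"
        have inv: "?\<psi> j v \<in> carrier (val (M j) x)" "\<phi> j x (?\<psi> j v) = v"
          if "j \<in> J" "v \<in> carrier (val (L j) x)" for j v
          using bij_betw_imp_surj_on[OF bij[OF that(1) x]] that(2)
          by (auto intro: inv_into_into f_inv_into_f)
        have z: "?\<psi> j \<zero>\<^bsub>val (L j) x\<^esub> = \<zero>\<^bsub>val (M j) x\<^esub>" if j: "j \<in> J" for j
        proof -
          interpret M: module K "val (M j) x" by (rule left_module_val[OF M[OF j] x])
          show ?thesis
            using inv_into_f_f[OF bij_betw_imp_inj_on[OF bij[OF j x]] M.zero_closed]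
              linear_hom_zero[OF left_module_val[OF M[OF j] x] left_module_val[OF L[OF j] x]
                catmod_hom_linear[OF \<phi>[OF j] x]] by simp
        qed
        have f: "(\<lambda>j\<in>J. ?\<psi> j (g j)) \<in> ?A" 
          by (rule dsum_map_closed[OF g, of ?\<psi> "\<lambda>j. val (M j) x"]) (use inv(1) z in auto)
        have eq: "\<Phi> x (\<lambda>j\<in>J. ?\<psi> j (g j)) = g" unfolding \<Phi>_def
          by (rule extensionalityI[OF restrict_extensional])
            (use g inv(2) in \<open>auto simp: dsum_carrier_iff\<close>)
        show "g \<in> \<Phi> x ` ?A" using imageI[OF f, of "\<Phi> x"] unfolding eq .
      qed
    qed
  qed
  thus ?thesis unfolding catmod_iso_def
    using catmod_dsum_left_module[OF C M] catmod_dsum_left_module[OF C L] hom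
    by (auto simp: catmod_dsum_val)
qed

text \<open>Isomorphisms of the summands assemble to an isomorphism of the direct sums, so the statement about whole
  columns or rows follows from the one about summands.\<close>

lemma standards_are_summandsI:
  assumes "linear_category K C" "\<And>i x. x \<in> Ob \<Longrightarrow> catmod_iso K C (standard K C lt (x, i)) (E i x)"
  shows "standards_are_summands K C Ob lt E"
  using assms catmod_dsum_iso[OF assms(1), of Ob "\<lambda>x. standard K C lt (x, i)" "E i" for i]
  by (simp add: standards_are_summands_def)


text \<open>The nonzero components of a finite spanning set of the direct sum span every single component; in particular
  almost all components vanish.\<close>

lemma fin_dim_dsum_span:
  assumes K: "cring K" and V: "\<And>j. j \<in> J \<Longrightarrow> module K (V j)" and fd: "fin_dim K (dsum J V)"
  obtains S where "finite S" "\<And>j v. (j, v) \<in> S \<Longrightarrow> j \<in> J \<and> v \<in> carrier (V j)"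
    "\<And>j. j \<in> J \<Longrightarrow> lin_span K (V j) {v. (j, v) \<in> S} = carrier (V j)"
proof -
  obtain T where T: "finite T" "T \<subseteq> carrier (dsum J V)" "lin_span K (dsum J V) T = carrier (dsum J V)"
    using fd by (auto simp: fin_dim_def)
  define S where "S = (\<Union>f\<in>T. (\<lambda>j. (j, f j)) ` {j\<in>J. f j \<noteq> \<zero>\<^bsub>V j\<^esub>})"
  have mem: "f j \<in> carrier (V j)" if "f \<in> carrier (dsum J V)" "j \<in> J" for f j
    using that by (auto simp: dsum_carrier_iff)
  have fin: "finite S"
    unfolding S_def using T(1,2) by (intro finite_UN_I finite_imageI) (auto simp: dsum_carrier_iff)
  have SV: "j \<in> J \<and> v \<in> carrier (V j)" if "(j, v) \<in> S" for j v
    using that mem T(2) by (auto simp: S_def)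
  have "lin_span K (V j) {v. (j, v) \<in> S} = carrier (V j)" if j: "j \<in> J" for j
  proof
    note Vj = V[OF j]
    interpret Vj: module K "V j" by (rule Vj)
    let ?L = "lin_span K (V j) {v. (j, v) \<in> S}"
    have sub: "{v. (j, v) \<in> S} \<subseteq> carrier (V j)" using SV by auto
    show "?L \<subseteq> carrier (V j)" by (rule lin_span_subset_carrier[OF Vj sub])
    have L: "submodule ?L K (V j)" by (rule lin_span_submodule[OF Vj sub])
    have "linear_hom K (dsum J V) (V j) (\<lambda>f. f j)"
      using j by (simp add: linear_hom_def mem dsum_simps)
    from linear_hom_vimage_submodule[OF dsum_module[OF K V] Vj this L]
    have H: "submodule {f \<in> carrier (dsum J V). f j \<in> ?L} K (dsum J V)" .
    have "T \<subseteq> {f \<in> carrier (dsum J V). f j \<in> ?L}"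
    proof
      fix f assume f: "f \<in> T"
      have "f j \<in> ?L"
      proof (cases "f j = \<zero>\<^bsub>V j\<^esub>")
        case True thus ?thesis using submodule_zero[OF Vj L] by simp
      next
        case False
        hence "f j \<in> {v. (j, v) \<in> S}" using f j by (auto simp: S_def)
        thus ?thesis by (rule subsetD[OF lin_span_superset])
      qed
      thus "f \<in> {f \<in> carrier (dsum J V). f j \<in> ?L}" using f T(2) by auto
    qed
    from lin_span_minimal[OF H this] have all: "f j \<in> ?L" if "f \<in> carrier (dsum J V)" for f
      using that T(3) by auto
    show "carrier (V j) \<subseteq> ?L"
    proof
      fix v assume v: "v \<in> carrier (V j)"
      \<comment> \<open>Every vector of the component extends by zero to an element of the direct sum.\<close>
      let ?f = "\<lambda>i\<in>J. if i = j then v else \<zero>\<^bsub>V i\<^esub>"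
      have "{i\<in>J. ?f i \<noteq> \<zero>\<^bsub>V i\<^esub>} \<subseteq> {j}" by auto
      hence "finite {i\<in>J. ?f i \<noteq> \<zero>\<^bsub>V i\<^esub>}" by (rule finite_subset) simp
      moreover have "\<zero>\<^bsub>V i\<^esub> \<in> carrier (V i)" if "i \<in> J" for i
        using submodule_zero[OF V[OF that] submodule_carrier[OF V[OF that]]] .
      ultimately have "?f \<in> carrier (dsum J V)" using v by (auto simp: dsum_carrier_iff)
      from all[OF this] show "v \<in> ?L" using j by simp
    qed
  qed
  thus ?thesis using fin SV that by blast
qed


section \<open>Relabelling objects along an involution\<close>

text \<open>Relabelling along a map \<open>\<sigma>\<close> of objects turns the order \<open>lt\<close> into its pullback along \<open>\<sigma>\<close>; for an involution every notion
  of the theory is transported in both directions.\<close>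

definition relabel_cat :: "('o \<Rightarrow> 'o) \<Rightarrow> ('k, 'o, 'm) lincat \<Rightarrow> ('k, 'o, 'm) lincat" where
  "relabel_cat \<sigma> C = \<lparr>obj = \<sigma> -` obj C, mor = (\<lambda>x y. mor C (\<sigma> x) (\<sigma> y)),
     comp = (\<lambda>x y z. comp C (\<sigma> x) (\<sigma> y) (\<sigma> z)), idm = (\<lambda>x. idm C (\<sigma> x))\<rparr>"

definition relabel_mod :: "('o \<Rightarrow> 'o) \<Rightarrow> ('k, 'o, 'm, 'v) catmod \<Rightarrow> ('k, 'o, 'm, 'v) catmod" where
  "relabel_mod \<sigma> M = \<lparr>val = (\<lambda>x. val M (\<sigma> x)), act = (\<lambda>x y. act M (\<sigma> x) (\<sigma> y))\<rparr>"

lemma relabel_simps: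
  "obj (relabel_cat \<sigma> C) = \<sigma> -` obj C" "mor (relabel_cat \<sigma> C) x y = mor C (\<sigma> x) (\<sigma> y)"
  "comp (relabel_cat \<sigma> C) x y z = comp C (\<sigma> x) (\<sigma> y) (\<sigma> z)" "idm (relabel_cat \<sigma> C) x = idm C (\<sigma> x)"
  "val (relabel_mod \<sigma> M) x = val M (\<sigma> x)" "act (relabel_mod \<sigma> M) x y = act M (\<sigma> x) (\<sigma> y)"
  by (simp_all add: relabel_cat_def relabel_mod_def)

lemma relabel_linear_category: "linear_category K C \<Longrightarrow> linear_category K (relabel_cat \<sigma> C)"
  by (simp add: linear_category_def linear_category_axioms_def relabel_simps)

lemma relabel_left_module: "left_module K C M \<Longrightarrow> left_module K (relabel_cat \<sigma> C) (relabel_mod \<sigma> M)"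
  by (simp add: left_module_def relabel_simps)

lemma relabel_hom:
  "catmod_hom K C M L \<phi> \<Longrightarrow> catmod_hom K (relabel_cat \<sigma> C) (relabel_mod \<sigma> M) (relabel_mod \<sigma> L) (\<lambda>x. \<phi> (\<sigma> x))"
  by (simp add: catmod_hom_def relabel_simps)

lemma relabel_iso:
  assumes "catmod_iso K C M L"
  shows "catmod_iso K (relabel_cat \<sigma> C) (relabel_mod \<sigma> M) (relabel_mod \<sigma> L)"
proof -
  obtain \<phi> where \<phi>: "catmod_hom K C M L \<phi>" "\<forall>x\<in>obj C. bij_betw (\<phi> x) (carrier (val M x)) (carrier (val L x))"
    using assms by (auto simp: catmod_iso_def)
  show ?thesis unfolding catmod_iso_def
    using assms relabel_left_module[of K C M] relabel_left_module[of K C L] relabel_hom[OF \<phi>(1), of \<sigma>] \<phi>(2)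
    by (auto simp: catmod_iso_def relabel_simps intro!: exI[of _ "\<lambda>x. \<phi> (\<sigma> x)"])
qed

lemma relabel_sub:
  "catmod_sub K C M U \<Longrightarrow> catmod_sub K (relabel_cat \<sigma> C) (relabel_mod \<sigma> M) (\<lambda>x. U (\<sigma> x))"
  by (simp add: catmod_sub_def relabel_simps)

lemma relabel_quot: "catmod_quot (relabel_mod \<sigma> M) (\<lambda>x. U (\<sigma> x)) = relabel_mod \<sigma> (catmod_quot M U)"
  by (simp add: catmod_quot_def relabel_mod_def)

lemma relabel_restrict: "catmod_restrict (relabel_mod \<sigma> M) (\<lambda>x. U (\<sigma> x)) = relabel_mod \<sigma> (catmod_restrict M U)"
  by (simp add: catmod_restrict_def relabel_mod_def)

lemma relabel_projective: "projective (relabel_cat \<sigma> C) l = relabel_mod \<sigma> (projective C (\<sigma> l))"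
  by (simp add: projective_def relabel_mod_def relabel_cat_def)

context
  fixes \<sigma> :: "'o \<Rightarrow> 'o"
  assumes invol: "\<And>x. \<sigma> (\<sigma> x) = x"
begin

lemma relabel_hom_iff:
  fixes C :: "('k, 'o, 'm) lincat"
  shows "catmod_hom K (relabel_cat \<sigma> C) (relabel_mod \<sigma> M) (relabel_mod \<sigma> L) \<phi> \<longleftrightarrow>
    catmod_hom K C M L (\<lambda>x. \<phi> (\<sigma> x))"
proof
  assume "catmod_hom K (relabel_cat \<sigma> C) (relabel_mod \<sigma> M) (relabel_mod \<sigma> L) \<phi>"
  from relabel_hom[OF this, of \<sigma>] show "catmod_hom K C M L (\<lambda>x. \<phi> (\<sigma> x))"
    by (simp add: catmod_hom_def relabel_simps invol)
next
  assume "catmod_hom K C M L (\<lambda>x. \<phi> (\<sigma> x))"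
  from relabel_hom[OF this, of \<sigma>]
  show "catmod_hom K (relabel_cat \<sigma> C) (relabel_mod \<sigma> M) (relabel_mod \<sigma> L) \<phi>" by (simp add: invol)
qed

lemma relabel_standard_trace:
  fixes C :: "('k, 'o, 'm) lincat"
  shows "standard_trace K (relabel_cat \<sigma> C) lt l x =
    standard_trace K C (\<lambda>p q. lt (\<sigma> p) (\<sigma> q)) (\<sigma> l) (\<sigma> x)"
proof -
  let ?C = "relabel_cat \<sigma> C"
  have "{\<phi> x ` carrier (val (projective ?C m) x) | m \<phi>.
           m \<in> obj ?C \<and> lt l m \<and> catmod_hom K ?C (projective ?C m) (projective ?C l) \<phi>} =
    {\<phi> (\<sigma> x) ` carrier (val (projective C m) (\<sigma> x)) | m \<phi>.
           m \<in> obj C \<and> lt l (\<sigma> m) \<and> catmod_hom K C (projective C m) (projective C (\<sigma> l)) \<phi>}" (is "?A = ?B")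
  proof (intro subset_antisym subsetI)
    fix Y assume "Y \<in> ?A"
    then obtain m \<phi> where "Y = \<phi> x ` carrier (val (projective ?C m) x)" "m \<in> obj ?C" "lt l m"
      "catmod_hom K ?C (projective ?C m) (projective ?C l) \<phi>" by blast
    thus "Y \<in> ?B"
      by (intro CollectI exI[of _ "\<sigma> m"] exI[of _ "\<lambda>x. \<phi> (\<sigma> x)"])
        (simp add: relabel_projective relabel_hom_iff relabel_simps invol)
  next
    fix Y assume "Y \<in> ?B"
    then obtain m \<phi> where "Y = \<phi> (\<sigma> x) ` carrier (val (projective C m) (\<sigma> x))" "m \<in> obj C" "lt l (\<sigma> m)"
      "catmod_hom K C (projective C m) (projective C (\<sigma> l)) \<phi>" by blast
    thus "Y \<in> ?A"
      by (intro CollectI exI[of _ "\<sigma> m"] exI[of _ "\<lambda>x. \<phi> (\<sigma> x)"])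
        (simp add: relabel_projective relabel_hom_iff relabel_simps invol)
  qed
  thus ?thesis by (simp add: standard_trace_def relabel_projective relabel_simps invol)
qed

lemma relabel_standard:
  fixes C :: "('k, 'o, 'm) lincat"
  shows "standard K (relabel_cat \<sigma> C) lt l = relabel_mod \<sigma> (standard K C (\<lambda>p q. lt (\<sigma> p) (\<sigma> q)) (\<sigma> l))"
proof -
  have "standard_trace K (relabel_cat \<sigma> C) lt l =
      (\<lambda>x. standard_trace K C (\<lambda>p q. lt (\<sigma> p) (\<sigma> q)) (\<sigma> l) (\<sigma> x))"
    by (rule ext, rule relabel_standard_trace)
  thus ?thesis by (simp add: standard_def relabel_projective relabel_quot[symmetric])
qed

lemma relabel_end_is_ground_field:
  fixes C :: "('k, 'o, 'm) lincat"
  assumes "end_is_ground_field K C M"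
  shows "end_is_ground_field K (relabel_cat \<sigma> C) (relabel_mod \<sigma> M)"
  unfolding end_is_ground_field_def relabel_hom_iff
proof (intro allI impI)
  fix \<phi> assume "catmod_hom K C M M (\<lambda>x. \<phi> (\<sigma> x))"
  hence *: "\<exists>!c. c \<in> carrier K \<and> (\<forall>x\<in>obj C. \<forall>v\<in>carrier (val M x). \<phi> (\<sigma> x) v = c \<odot>\<^bsub>val M x\<^esub> v)"
    using assms unfolding end_is_ground_field_def by blast
  have "(\<forall>x\<in>obj C. \<forall>v\<in>carrier (val M x). \<phi> (\<sigma> x) v = c \<odot>\<^bsub>val M x\<^esub> v) \<longleftrightarrow>
    (\<forall>x\<in>obj (relabel_cat \<sigma> C). \<forall>v\<in>carrier (val (relabel_mod \<sigma> M) x). \<phi> x v = c \<odot>\<^bsub>val (relabel_mod \<sigma> M) x\<^esub> v)" for c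
    unfolding relabel_simps using invol by (metis vimageD vimageI2)
  thus "\<exists>!c. c \<in> carrier K \<and> (\<forall>x\<in>obj (relabel_cat \<sigma> C). \<forall>v\<in>carrier (val (relabel_mod \<sigma> M) x).
      \<phi> x v = c \<odot>\<^bsub>val (relabel_mod \<sigma> M) x\<^esub> v)" using * by simp
qed

lemma relabel_has_standard_filtration:
  fixes C :: "('k, 'o, 'm) lincat"
  assumes "has_standard_filtration K C (\<lambda>p q. lt (\<sigma> p) (\<sigma> q)) (\<sigma> l)"
  shows "has_standard_filtration K (relabel_cat \<sigma> C) lt l"
proof -
  let ?lt = "\<lambda>p q. lt (\<sigma> p) (\<sigma> q)"
  obtain n F m where *:
    "\<forall>x\<in>obj C. F 0 x = carrier (val (projective C (\<sigma> l)) x)"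
    "\<forall>x\<in>obj C. F (Suc n) x = {\<zero>\<^bsub>val (projective C (\<sigma> l)) x\<^esub>}"
    "\<forall>k\<le>Suc n. catmod_sub K C (projective C (\<sigma> l)) (F k)"
    "\<forall>k\<le>n. \<forall>x\<in>obj C. F (Suc k) x \<subseteq> F k x"
    "m 0 = \<sigma> l" "\<forall>k\<in>{1..n}. m k \<in> obj C \<and> ?lt (\<sigma> l) (m k)"
    "\<forall>k\<le>n. catmod_iso K C (catmod_quot (catmod_restrict (projective C (\<sigma> l)) (F k)) (F (Suc k)))
            (standard K C ?lt (m k))"
    using assms unfolding has_standard_filtration_def by (elim exE conjE) blast
  have iso: "catmod_iso K (relabel_cat \<sigma> C)
      (catmod_quot (catmod_restrict (projective (relabel_cat \<sigma> C) l) (\<lambda>x. F k (\<sigma> x))) (\<lambda>x. F (Suc k) (\<sigma> x)))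
      (standard K (relabel_cat \<sigma> C) lt (\<sigma> (m k)))" if "k \<le> n" for k
    using relabel_iso[of K C _ _ \<sigma>] *(7) that
    unfolding relabel_standard invol relabel_projective relabel_restrict relabel_quot by blast
  have sub: "catmod_sub K (relabel_cat \<sigma> C) (projective (relabel_cat \<sigma> C) l) (\<lambda>x. F k (\<sigma> x))"
    if "k \<le> Suc n" for k
    unfolding relabel_projective by (rule relabel_sub) (use *(3) that in blast)
  show ?thesis unfolding has_standard_filtration_def
    by (rule exI[of _ n], rule exI[of _ "\<lambda>k x. F k (\<sigma> x)"], rule exI[of _ "\<lambda>k. \<sigma> (m k)"], intro conjI)
      (use * iso sub in \<open>simp_all add: relabel_simps relabel_projective invol\<close>)
qed

lemma relabel_left_quasi_hereditary:
  fixes C :: "('k, 'o, 'm) lincat"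
  assumes "left_quasi_hereditary K C (\<lambda>p q. lt (\<sigma> p) (\<sigma> q))"
  shows "left_quasi_hereditary K (relabel_cat \<sigma> C) lt"
  unfolding left_quasi_hereditary_def relabel_standard relabel_simps(1)
proof (intro conjI ballI)
  show "linear_category K (relabel_cat \<sigma> C)"
    using assms by (simp add: left_quasi_hereditary_def relabel_linear_category)
  fix l assume l: "l \<in> \<sigma> -` obj C"
  show "end_is_ground_field K (relabel_cat \<sigma> C) (relabel_mod \<sigma> (standard K C (\<lambda>p q. lt (\<sigma> p) (\<sigma> q)) (\<sigma> l)))"
    by (rule relabel_end_is_ground_field) (use assms l in \<open>auto simp: left_quasi_hereditary_def\<close>)
  show "has_standard_filtration K (relabel_cat \<sigma> C) lt l"
    by (rule relabel_has_standard_filtration) (use assms l in \<open>auto simp: left_quasi_hereditary_def\<close>)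
qed

end


section \<open>Local endomorphism rings\<close>

context linear_category
begin

lemma comp_minus_left:
  "\<lbrakk>x \<in> obj C; y \<in> obj C; z \<in> obj C; f \<in> carrier (mor C x y); g \<in> carrier (mor C y z); h \<in> carrier (mor C y z)\<rbrakk>
   \<Longrightarrow> comp C x y z (g \<ominus>\<^bsub>mor C y z\<^esub> h) f = comp C x y z g f \<ominus>\<^bsub>mor C x z\<^esub> comp C x y z h f"
  by (rule linear_hom_minus[OF mor_module mor_module comp_linear_left])

lemma comp_minus_right:
  "\<lbrakk>x \<in> obj C; y \<in> obj C; z \<in> obj C; f \<in> carrier (mor C x y); h \<in> carrier (mor C x y); g \<in> carrier (mor C y z)\<rbrakk>
   \<Longrightarrow> comp C x y z g (f \<ominus>\<^bsub>mor C x y\<^esub> h) = comp C x y z g f \<ominus>\<^bsub>mor C x z\<^esub> comp C x y z g h"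
  by (rule linear_hom_minus[OF mor_module mor_module comp_linear_right])

lemma comp_zero_right:
  "\<lbrakk>x \<in> obj C; y \<in> obj C; z \<in> obj C; g \<in> carrier (mor C y z)\<rbrakk>
   \<Longrightarrow> comp C x y z g \<zero>\<^bsub>mor C x y\<^esub> = \<zero>\<^bsub>mor C x z\<^esub>"
  by (rule linear_hom_zero[OF mor_module mor_module comp_linear_right])

lemma comp_zero_left:
  "\<lbrakk>x \<in> obj C; y \<in> obj C; z \<in> obj C; f \<in> carrier (mor C x y)\<rbrakk>
   \<Longrightarrow> comp C x y z \<zero>\<^bsub>mor C y z\<^esub> f = \<zero>\<^bsub>mor C x z\<^esub>"
  by (rule linear_hom_zero[OF mor_module mor_module comp_linear_left])

lemma end_ring_simps:
  "carrier (end_ring C x) = carrier (mor C x x)" "monoid.mult (end_ring C x) = comp C x x x"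
  "one (end_ring C x) = idm C x" "\<zero>\<^bsub>end_ring C x\<^esub> = \<zero>\<^bsub>mor C x x\<^esub>"
  "ring.add (end_ring C x) = ring.add (mor C x x)"
  by (simp_all add: end_ring_def)

lemma end_ring_ring:
  assumes x: "x \<in> obj C"
  shows "ring (end_ring C x)"
proof (rule ringI)
  interpret M: module K "mor C x x" by (rule mor_module[OF x x])
  show "abelian_group (end_ring C x)"
  proof (rule abelian_groupI, goal_cases)
    case (6 f)
    thus ?case using M.M.l_neg[of f] M.M.a_inv_closed[of f] by (auto simp: end_ring_simps)
  qed (auto simp: end_ring_simps M.M.a_ac)
  show "monoid (end_ring C x)"
    by (rule monoidI)
      (simp_all add: end_ring_simps x comp_closed idm_closed comp_assoc comp_idm_left comp_idm_right)
qed (simp_all add: end_ring_simps linear_hom_add[OF comp_linear_left[OF x x x]]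
      linear_hom_add[OF comp_linear_right[OF x x x]])

text \<open>Nakayama's lemma for the endomorphism ring of \<open>x\<close> and a left ideal \<open>J\<close>, by induction on the set \<open>S\<close> of
  generators.  The last hypothesis says \<open>S \<subseteq> J + m S\<close>; it quantifies over the subspaces containing \<open>J\<close> and
  \<open>m S\<close> in order to avoid sums.  For the induction step replace \<open>J\<close> by \<open>J + End(x) v\<close>: modulo this left ideal the
  other generators satisfy the hypothesis, hence vanish; then \<open>v \<in> J + m v\<close>, and \<open>1 - c\<close> is invertible for
  \<open>c \<in> m\<close>.\<close>

lemma nakayama:
  assumes x: "x \<in> obj C"
    and m: "submodule m K (mor C x x)"
    and m_right: "\<And>c r. c \<in> m \<Longrightarrow> r \<in> carrier (mor C x x) \<Longrightarrow> comp C x x x c r \<in> m"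
    and m_unit: "\<And>c. c \<in> m \<Longrightarrow> \<exists>u\<in>carrier (mor C x x). comp C x x x u (idm C x \<ominus>\<^bsub>mor C x x\<^esub> c) = idm C x"
  shows "finite S \<Longrightarrow> S \<subseteq> carrier (mor C x x) \<Longrightarrow> submodule J K (mor C x x) \<Longrightarrow>
    (\<And>r j. r \<in> carrier (mor C x x) \<Longrightarrow> j \<in> J \<Longrightarrow> comp C x x x r j \<in> J) \<Longrightarrow>
    (\<And>s H. s \<in> S \<Longrightarrow> submodule H K (mor C x x) \<Longrightarrow> J \<subseteq> H \<Longrightarrow>
      (\<And>c t. c \<in> m \<Longrightarrow> t \<in> S \<Longrightarrow> comp C x x x c t \<in> H) \<Longrightarrow> s \<in> H) \<Longrightarrow> S \<subseteq> J"
proof (induction S arbitrary: J rule: finite_induct)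
  case empty
  show ?case by simp
next
  case (insert v S)
  let ?V = "mor C x x" and ?m = "comp C x x x"
  note V = mor_module[OF x x]
  interpret V: module K ?V by (rule V)
  note J = insert.prems(2) and Jl = insert.prems(3)
  have v: "v \<in> carrier ?V" and S: "S \<subseteq> carrier ?V" using insert.prems(1) by auto
  note Jc = subsetD[OF submodule_subset[OF V J]] and mc = subsetD[OF submodule_subset[OF V m]]
  note cl = comp_closed[OF x x x]
  note lin = comp_linear_left[OF x x x v]
  define Rv where "Rv = (\<lambda>r. ?m r v) ` carrier ?V"
  define mv where "mv = (\<lambda>r. ?m r v) ` m"
  have Rv: "submodule Rv K ?V" unfolding Rv_def
    by (rule linear_hom_image_submodule[OF V V lin submodule_carrier[OF V]])
  have mv: "submodule mv K ?V" unfolding mv_def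
    by (rule linear_hom_image_submodule[OF V V lin m])
  define J' where "J' = {u \<oplus>\<^bsub>?V\<^esub> w | u w. u \<in> Rv \<and> w \<in> J}"
  define H where "H = {u \<oplus>\<^bsub>?V\<^esub> w | u w. u \<in> mv \<and> w \<in> J}"
  have J'I: "?m a v \<oplus>\<^bsub>?V\<^esub> w \<in> J'" if "a \<in> carrier ?V" "w \<in> J" for a w
    using that unfolding J'_def Rv_def by blast
  have HI: "?m a v \<oplus>\<^bsub>?V\<^esub> w \<in> H" if "a \<in> m" "w \<in> J" for a w
    using that unfolding H_def mv_def by blast
  have J': "submodule J' K ?V" unfolding J'_def by (rule submodule_sum[OF V Rv J])
  have H: "submodule H K ?V" unfolding H_def by (rule submodule_sum[OF V mv J])
  have JJ': "J \<subseteq> J'" "Rv \<subseteq> J'" unfolding J'_def using submodule_sum_superset[OF V Rv J] by auto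
  have JH: "J \<subseteq> H" "mv \<subseteq> H" unfolding H_def using submodule_sum_superset[OF V mv J] by auto
  have J'l: "?m r j \<in> J'" if r: "r \<in> carrier ?V" and j: "j \<in> J'" for r j
  proof -
    obtain a w where a: "a \<in> carrier ?V" "w \<in> J" "j = ?m a v \<oplus>\<^bsub>?V\<^esub> w"
      using j by (auto simp: J'_def Rv_def)
    have "?m r j = ?m (?m r a) v \<oplus>\<^bsub>?V\<^esub> ?m r w"
      using a r v Jc[OF a(2)] linear_hom_add[OF comp_linear_right[OF x x x r], of "?m a v" w]
      by (simp add: cl comp_assoc[OF x x x x v a(1) r])
    thus ?thesis using J'I[OF cl[OF a(1) r] Jl[OF r a(2)]] by simp
  qed
  have SJ': "S \<subseteq> J'"
  proof (rule insert.IH[OF S J' J'l])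
    fix s H' assume s: "s \<in> S" and H': "submodule H' K ?V" "J' \<subseteq> H'"
      and c: "\<And>c t. c \<in> m \<Longrightarrow> t \<in> S \<Longrightarrow> ?m c t \<in> H'"
    show "s \<in> H'"
    proof (rule insert.prems(4)[OF _ H'(1)])
      show "s \<in> insert v S" using s by simp
      show "J \<subseteq> H'" using JJ' H' by blast
      fix d t assume d: "d \<in> m" and t: "t \<in> insert v S"
      have "?m d v \<in> Rv" using mc[OF d] by (auto simp: Rv_def)
      thus "?m d t \<in> H'" using t c[OF d] JJ' H'(2) by auto
    qed
  qed
  have "v \<in> H"
  proof (rule insert.prems(4)[OF _ H JH(1)])
    show "v \<in> insert v S" by simp
    fix c t assume c: "c \<in> m" and t: "t \<in> insert v S"
    show "?m c t \<in> H"
    proof (cases "t = v")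
      case True thus ?thesis using JH(2) c by (auto simp: mv_def)
    next
      case False
      then obtain a w where a: "a \<in> carrier ?V" "w \<in> J" "t = ?m a v \<oplus>\<^bsub>?V\<^esub> w"
        using t SJ' by (auto simp: J'_def Rv_def)
      have "?m c t = ?m (?m c a) v \<oplus>\<^bsub>?V\<^esub> ?m c w"
        using a mc[OF c] v Jc[OF a(2)] linear_hom_add[OF comp_linear_right[OF x x x mc[OF c]], of "?m a v" w]
        by (simp add: cl comp_assoc[OF x x x x v a(1) mc[OF c]])
      thus ?thesis using HI[OF m_right[OF c a(1)] Jl[OF mc[OF c] a(2)]] by simp
    qed
  qed
  then obtain c w where c: "c \<in> m" "w \<in> J" "v = ?m c v \<oplus>\<^bsub>?V\<^esub> w" by (auto simp: H_def mv_def)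
  obtain u where u: "u \<in> carrier ?V" "?m u (idm C x \<ominus>\<^bsub>?V\<^esub> c) = idm C x" using m_unit[OF c(1)] by blast
  have id: "idm C x \<in> carrier ?V" by (rule idm_closed[OF x])
  have "?m (idm C x \<ominus>\<^bsub>?V\<^esub> c) v = v \<ominus>\<^bsub>?V\<^esub> ?m c v"
    using comp_minus_left[OF x x x v id mc[OF c(1)]] comp_idm_left[OF x x v] by simp
  also have "\<dots> = w" using V.minus_add_cancel(4)[OF Jc[OF c(2)] cl[OF v mc[OF c(1)]]] c(3) by simp
  finally have "v = ?m u w"
    using comp_assoc[OF x x x x v V.minus_closed[OF id mc[OF c(1)]] u(1)] u(2) comp_idm_left[OF x x v] by simp
  hence vJ: "v \<in> J" using Jl[OF u(1) c(2)] by simp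
  have "J' \<subseteq> J"
    using submodule_add[OF V J Jl[OF _ vJ]] by (auto simp: J'_def Rv_def)
  thus ?case using vJ SJ' by blast
qed

lemma nonunits_facts:
  assumes x: "x \<in> obj C" and loc: "local_ring (end_ring C x)"
  defines "m \<equiv> carrier (mor C x x) - Units (end_ring C x)"
  shows nonunits_submodule: "submodule m K (mor C x x)"
    and nonunits_left: "\<And>c r. c \<in> m \<Longrightarrow> r \<in> carrier (mor C x x) \<Longrightarrow> comp C x x x r c \<in> m"
    and nonunits_right: "\<And>c r. c \<in> m \<Longrightarrow> r \<in> carrier (mor C x x) \<Longrightarrow> comp C x x x c r \<in> m"
    and nonunits_one_minus: "\<And>c. c \<in> m \<Longrightarrow>
      \<exists>u\<in>carrier (mor C x x). comp C x x x u (idm C x \<ominus>\<^bsub>mor C x x\<^esub> c) = idm C x"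
    and idm_nonzero: "idm C x \<noteq> \<zero>\<^bsub>mor C x x\<^esub>"
proof -
  interpret V: module K "mor C x x" by (rule mor_module[OF x x])
  interpret R: ring "end_ring C x" by (rule end_ring_ring[OF x])
  interpret I: ideal m "end_ring C x" using loc by (simp add: local_ring_def m_def end_ring_simps)
  have mc: "m \<subseteq> carrier (mor C x x)" by (auto simp: m_def)
  show l: "comp C x x x r c \<in> m" if "c \<in> m" "r \<in> carrier (mor C x x)" for c r
    using I.I_l_closed[of c r] that by (simp add: end_ring_simps)
  show r: "comp C x x x c r \<in> m" if "c \<in> m" "r \<in> carrier (mor C x x)" for c r
    using I.I_r_closed[of c r] that by (simp add: end_ring_simps)
  have id: "idm C x \<in> carrier (mor C x x)" by (rule idm_closed[OF x])
  have z: "\<zero>\<^bsub>mor C x x\<^esub> \<in> m" using I.zero_closed by (simp add: end_ring_simps)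
  have a: "u \<oplus>\<^bsub>mor C x x\<^esub> v \<in> m" if "u \<in> m" "v \<in> m" for u v
    using I.a_closed[OF that] by (simp add: end_ring_simps)
  have s: "c \<odot>\<^bsub>mor C x x\<^esub> v \<in> m" if c: "c \<in> carrier K" and v: "v \<in> m" for c v
  proof -
    have "c \<odot>\<^bsub>mor C x x\<^esub> v = comp C x x x (c \<odot>\<^bsub>mor C x x\<^esub> idm C x) v"
      using linear_hom_smult[OF comp_linear_left[OF x x x subsetD[OF mc v]] c id]
        comp_idm_left[OF x x subsetD[OF mc v]] by simp
    thus ?thesis using l[OF v V.smult_closed[OF c id]] by simp
  qed
  show "submodule m K (mor C x x)"
    unfolding submodule_iff[OF mor_module[OF x x]] by (intro conjI ballI mc z a s)
  have one: "idm C x \<notin> m" using R.Units_one_closed by (simp add: m_def end_ring_simps)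
  thus "idm C x \<noteq> \<zero>\<^bsub>mor C x x\<^esub>" using z by auto
  show "\<exists>u\<in>carrier (mor C x x). comp C x x x u (idm C x \<ominus>\<^bsub>mor C x x\<^esub> c) = idm C x"
    if c: "c \<in> m" for c
  proof -
    have cc: "c \<in> carrier (mor C x x)" using c mc by auto
    have "idm C x \<ominus>\<^bsub>mor C x x\<^esub> c \<in> Units (end_ring C x)"
    proof (rule ccontr)
      assume "idm C x \<ominus>\<^bsub>mor C x x\<^esub> c \<notin> Units (end_ring C x)"
      hence "idm C x \<ominus>\<^bsub>mor C x x\<^esub> c \<in> m" using V.minus_closed[OF id cc] by (simp add: m_def)
      from a[OF this c] show False using one V.minus_add_cancel(1)[OF id cc] by simp
    qed
    thus ?thesis by (auto simp: Units_def end_ring_simps)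
  qed
qed

text \<open>If \<open>a r\<close> were invertible, \<open>r\<close> would have a left inverse \<open>b\<close>, and \<open>r b\<close> would be an idempotent of the local ring
  \<open>End(y)\<close>, hence \<open>0\<close> or \<open>1\<close>; the first would give \<open>r = 0\<close>, the second an isomorphism.\<close>

lemma composite_nonunit:
  assumes xy: "x \<in> obj C" "y \<in> obj C"
    and locx: "local_ring (end_ring C x)" and locy: "local_ring (end_ring C y)"
    and r: "r \<in> carrier (mor C x y)" and a: "a \<in> carrier (mor C y x)"
    and ni: "\<not> isomorphic_objs C x y"
  shows "comp C x y x a r \<notin> Units (end_ring C x)"
proof
  note x = xy(1) and y = xy(2)
  assume "comp C x y x a r \<in> Units (end_ring C x)"
  then obtain u where u: "u \<in> carrier (mor C x x)" "comp C x x x u (comp C x y x a r) = idm C x"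
    by (auto simp: Units_def end_ring_simps)
  define b where "b = comp C y x x u a"
  have b: "b \<in> carrier (mor C y x)" unfolding b_def by (rule comp_closed[OF y x x a u(1)])
  have br: "comp C x y x b r = idm C x" using u comp_assoc[OF x y x x r a u(1)] by (simp add: b_def)
  define e where "e = comp C y x y r b"
  have e: "e \<in> carrier (mor C y y)" unfolding e_def by (rule comp_closed[OF y x y b r])
  have er: "comp C x y y e r = r"
    using comp_assoc[OF x y x y r b r] br comp_idm_right[OF x y r] by (simp add: e_def)
  have ee: "comp C y y y e e = e"
    using comp_assoc[OF y x y y b r e] er by (simp add: e_def)
  have idy: "idm C y \<in> carrier (mor C y y)" by (rule idm_closed[OF y])
  interpret V: module K "mor C y y" by (rule mor_module[OF y y])
  show False
  proof (cases "e \<in> Units (end_ring C y)")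
    case True
    then obtain w where w: "w \<in> carrier (mor C y y)" "comp C y y y w e = idm C y"
      by (auto simp: Units_def end_ring_simps)
    have "e = idm C y" using comp_assoc[OF y y y y e e w(1)] w(2) ee comp_idm_left[OF y y e] by simp
    thus False using ni r b br by (auto simp: isomorphic_objs_def e_def)
  next
    case False
    then obtain w where w: "w \<in> carrier (mor C y y)"
      "comp C y y y w (idm C y \<ominus>\<^bsub>mor C y y\<^esub> e) = idm C y"
      using nonunits_one_minus[OF y locy, of e] e by auto
    have "comp C y y y (idm C y \<ominus>\<^bsub>mor C y y\<^esub> e) e = \<zero>\<^bsub>mor C y y\<^esub>"
      using comp_minus_left[OF y y y e idy e] comp_idm_left[OF y y e] ee e by (simp add: a_minus_def V.M.r_neg)
    hence "e = \<zero>\<^bsub>mor C y y\<^esub>"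
      using comp_assoc[OF y y y y e V.minus_closed[OF idy e] w(1)] w(2) comp_idm_left[OF y y e]
        comp_zero_right[OF y y y w(1)] by simp
    hence "r = \<zero>\<^bsub>mor C x y\<^esub>" using er comp_zero_left[OF x y y r] by simp
    hence "idm C x = \<zero>\<^bsub>mor C x x\<^esub>" using br comp_zero_right[OF x y x b] by simp
    thus False using idm_nonzero[OF x locx] by simp
  qed
qed

lemma cat_idealD:
  assumes "cat_ideal K C J"
  shows cat_ideal_submodule: "\<And>x y. x \<in> obj C \<Longrightarrow> y \<in> obj C \<Longrightarrow> submodule (J x y) K (mor C x y)"
    and cat_ideal_left: "\<And>x y z f g. \<lbrakk>x \<in> obj C; y \<in> obj C; z \<in> obj C; f \<in> J x y; g \<in> carrier (mor C y z)\<rbrakk>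
      \<Longrightarrow> comp C x y z g f \<in> J x z"
    and cat_ideal_right: "\<And>x y z f g. \<lbrakk>x \<in> obj C; y \<in> obj C; z \<in> obj C; f \<in> carrier (mor C x y); g \<in> J y z\<rbrakk>
      \<Longrightarrow> comp C x y z g f \<in> J x z"
  using assms unfolding cat_ideal_def by blast+

end


section \<open>Semisimple bimodules and the radical\<close>

context linear_category
begin

text \<open>Otherwise \<open>r s\<close> generates the simple subbimodule, so that \<open>s \<in> J + m s End(x)\<close> with the maximal ideal \<open>m\<close> of
  \<open>End(x)\<close>.  For a finite spanning set \<open>B\<close> of \<open>End(x)\<close>, Nakayama's lemma applied to the elements \<open>s b\<close> with \<open>b \<in> B\<close>
  gives \<open>s \<in> J\<close>.\<close>

lemma simple_killed_by_radical:
  assumes xy: "x \<in> obj C" "y \<in> obj C" and loc: "local_ring (end_ring C x)"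
    and J: "cat_ideal K C J"
    and T: "\<And>p q. p \<in> obj C \<Longrightarrow> q \<in> obj C \<Longrightarrow> T p q = carrier (mor C p q)"
    and B: "finite B" "B \<subseteq> carrier (mor C x x)" "lin_span K (mor C x x) B = carrier (mor C x x)"
    and U: "simple_sub_bimod K C (ideal_quot_bimod C T J) U"
    and s: "s \<in> carrier (mor C x x)" "J x x +>\<^bsub>mor C x x\<^esub> s \<in> U x x"
    and r: "r \<in> carrier (mor C x y)"
    and rad: "\<And>a. a \<in> carrier (mor C y x) \<Longrightarrow> comp C x y x a r \<notin> Units (end_ring C x)"
  shows "comp C x x y r s \<in> J x y"
proof (rule ccontr)
  note x = xy(1) and y = xy(2)
  let ?Q = "ideal_quot_bimod C T J"
  assume notJ: "comp C x x y r s \<notin> J x y"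
  define t where "t = comp C x x y r s"
  have t: "t \<in> carrier (mor C x y)" unfolding t_def by (rule comp_closed[OF x x y s(1) r])
  define m where "m = carrier (mor C x x) - Units (end_ring C x)"
  note m_facts = nonunits_facts[OF x loc, folded m_def]
  \<comment> \<open>The family \<open>W\<close> is the ideal generated by \<open>J\<close> and \<open>t = r s\<close>; its image \<open>V\<close> in the quotient is the subbimodule
    generated by the class of \<open>t\<close>.\<close>
  define G where "G p q = J p q \<union> {comp C p y q a (comp C p x y t b) | a b.
    a \<in> carrier (mor C y q) \<and> b \<in> carrier (mor C p x)}" for p q
  define W where "W p q = lin_span K (mor C p q) (G p q)" for p q
  note Js = cat_ideal_submodule[OF J]
  have G: "G p q \<subseteq> carrier (mor C p q)" if p: "p \<in> obj C" and q: "q \<in> obj C" for p q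
    unfolding G_def using submodule_subset[OF mor_module[OF p q] Js[OF p q]]
      comp_closed[OF p y q comp_closed[OF p x y _ t]] by auto
  have W: "submodule (W p q) K (mor C p q)" if "p \<in> obj C" "q \<in> obj C" for p q
    unfolding W_def by (rule lin_span_submodule[OF mor_module[OF that] G[OF that]])
  have Wc: "w \<in> carrier (mor C p q)" if "p \<in> obj C" "q \<in> obj C" "w \<in> W p q" for p q w
    using subsetD[OF submodule_subset[OF mor_module[OF that(1,2)] W[OF that(1,2)]] that(3)] .
  have GW: "g \<in> W p q" if "g \<in> G p q" for g p q
    unfolding W_def by (rule subsetD[OF lin_span_superset that])
  have W_left: "comp C p q q' g w \<in> W p q'"
    if p: "p \<in> obj C" and q: "q \<in> obj C" and q': "q' \<in> obj C" and g: "g \<in> carrier (mor C q q')" and w: "w \<in> W p q"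
    for p q q' g w
  proof -
    let ?H = "{w \<in> carrier (mor C p q). comp C p q q' g w \<in> W p q'}"
    have H: "submodule ?H K (mor C p q)"
      by (rule linear_hom_vimage_submodule[OF mor_module[OF p q] mor_module[OF p q'] comp_linear_right[OF p q q' g] W[OF p q']])
    have "comp C p q q' g f \<in> G p q'" if f: "f \<in> G p q" for f
      using f unfolding G_def
    proof (elim UnE CollectE exE conjE)
      assume "f \<in> J p q"
      thus "comp C p q q' g f \<in> J p q' \<union> {comp C p y q' a (comp C p x y t b) | a b.
        a \<in> carrier (mor C y q') \<and> b \<in> carrier (mor C p x)}"
        using cat_ideal_left[OF J p q q' _ g] by blast
    next
      fix a b assume ab: "f = comp C p y q a (comp C p x y t b)" "a \<in> carrier (mor C y q)" "b \<in> carrier (mor C p x)"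
      have "comp C p q q' g f = comp C p y q' (comp C y q q' g a) (comp C p x y t b)"
        using comp_assoc[OF p y q q' comp_closed[OF p x y ab(3) t] ab(2) g] ab(1) by simp
      thus "comp C p q q' g f \<in> J p q' \<union> {comp C p y q' a (comp C p x y t b) | a b.
        a \<in> carrier (mor C y q') \<and> b \<in> carrier (mor C p x)}"
        using comp_closed[OF y q q' ab(2) g] ab(3) by blast
    qed
    hence "G p q \<subseteq> ?H" using G[OF p q] GW[of _ p q'] by blast
    from subsetD[OF lin_span_minimal[OF H this]] w show ?thesis by (simp add: W_def)
  qed
  have W_right: "comp C p' p q w f \<in> W p' q"
    if p': "p' \<in> obj C" and p: "p \<in> obj C" and q: "q \<in> obj C" and f: "f \<in> carrier (mor C p' p)" and w: "w \<in> W p q"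
    for p p' q f w
  proof -
    let ?H = "{w \<in> carrier (mor C p q). comp C p' p q w f \<in> W p' q}"
    have H: "submodule ?H K (mor C p q)"
      by (rule linear_hom_vimage_submodule[OF mor_module[OF p q] mor_module[OF p' q] comp_linear_left[OF p' p q f] W[OF p' q]])
    have "comp C p' p q h f \<in> G p' q" if h: "h \<in> G p q" for h
      using h unfolding G_def
    proof (elim UnE CollectE exE conjE)
      assume "h \<in> J p q"
      thus "comp C p' p q h f \<in> J p' q \<union> {comp C p' y q a (comp C p' x y t b) | a b.
        a \<in> carrier (mor C y q) \<and> b \<in> carrier (mor C p' x)}"
        using cat_ideal_right[OF J p' p q f] by blast
    next
      fix a b assume ab: "h = comp C p y q a (comp C p x y t b)" "a \<in> carrier (mor C y q)" "b \<in> carrier (mor C p x)"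
      have "comp C p' p q h f = comp C p' y q a (comp C p' x y t (comp C p' p x b f))"
        using comp_assoc[OF p' p y q f comp_closed[OF p x y ab(3) t] ab(2)]
          comp_assoc[OF p' p x y f ab(3) t] ab(1) by simp
      thus "comp C p' p q h f \<in> J p' q \<union> {comp C p' y q a (comp C p' x y t b) | a b.
        a \<in> carrier (mor C y q) \<and> b \<in> carrier (mor C p' x)}"
        using comp_closed[OF p' p x f ab(3)] ab(2) by blast
    qed
    hence "G p q \<subseteq> ?H" using G[OF p q] GW[of _ p' q] by blast
    from subsetD[OF lin_span_minimal[OF H this]] w show ?thesis by (simp add: W_def)
  qed

  have bval: "bval ?Q p q = quot_space (mor C p q) (J p q)" if "p \<in> obj C" "q \<in> obj C" for p q
    using T[OF that] by (simp add: ideal_quot_bimod_def)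
  have lact: "lact ?Q p q q' g (J p q +>\<^bsub>mor C p q\<^esub> f) = J p q' +>\<^bsub>mor C p q'\<^esub> comp C p q q' g f"
    if p: "p \<in> obj C" and q: "q \<in> obj C" and q': "q' \<in> obj C" and g: "g \<in> carrier (mor C q q')"
      and f: "f \<in> carrier (mor C p q)" for p q q' g f
    using UN_coset_linear[OF mor_module[OF p q] Js[OF p q] mor_module[OF p q'] Js[OF p q']
        comp_linear_right[OF p q q' g] cat_ideal_left[OF J p q q' _ g] f]
    by (simp add: ideal_quot_bimod_def)
  have ract: "ract ?Q p' p q f (J p q +>\<^bsub>mor C p q\<^esub> g) = J p' q +>\<^bsub>mor C p' q\<^esub> comp C p' p q g f"
    if p': "p' \<in> obj C" and p: "p \<in> obj C" and q: "q \<in> obj C" and f: "f \<in> carrier (mor C p' p)"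
      and g: "g \<in> carrier (mor C p q)" for p p' q f g
    using UN_coset_linear[OF mor_module[OF p q] Js[OF p q] mor_module[OF p' q] Js[OF p' q]
        comp_linear_left[OF p' p q f] cat_ideal_right[OF J p' p q f] g]
    by (simp add: ideal_quot_bimod_def)
  note qhom = quot_space_linear_hom[OF mor_module Js]
  note qmod = quot_space_module[OF mor_module Js]
  define V where "V p q = (\<lambda>w. J p q +>\<^bsub>mor C p q\<^esub> w) ` W p q" for p q
  have subU: "sub_bimod K C ?Q U" using U by (simp add: simple_sub_bimod_def)
  have Us: "submodule (U p q) K (quot_space (mor C p q) (J p q))" if "p \<in> obj C" "q \<in> obj C" for p q
    using subU that unfolding bval[OF that, symmetric] sub_bimod_def by blast
  have U_lact: "lact ?Q p q q' g v \<in> U p q'"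
    if "p \<in> obj C" "q \<in> obj C" "q' \<in> obj C" "g \<in> carrier (mor C q q')" "v \<in> U p q" for p q q' g v
    using subU that unfolding sub_bimod_def by blast
  have U_ract: "ract ?Q p' p q f v \<in> U p' q"
    if "p' \<in> obj C" "p \<in> obj C" "q \<in> obj C" "f \<in> carrier (mor C p' p)" "v \<in> U p q" for p p' q f v
    using subU that unfolding sub_bimod_def by blast
  have subV: "sub_bimod K C ?Q V"
    unfolding sub_bimod_def
  proof (intro conjI ballI)
    fix p q assume pq: "p \<in> obj C" "q \<in> obj C"
    show "submodule (V p q) K (bval ?Q p q)" unfolding bval[OF pq] V_def
      by (rule linear_hom_image_submodule[OF mor_module[OF pq] qmod[OF pq pq] qhom[OF pq pq] W[OF pq]])
  next
    fix p q q' g v assume a: "p \<in> obj C" "q \<in> obj C" "q' \<in> obj C" "g \<in> carrier (mor C q q')" "v \<in> V p q"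
    then obtain w where w: "w \<in> W p q" "v = J p q +>\<^bsub>mor C p q\<^esub> w" by (auto simp: V_def)
    show "lact ?Q p q q' g v \<in> V p q'"
      unfolding w(2) lact[OF a(1-4) Wc[OF a(1,2) w(1)]] V_def by (rule imageI[OF W_left[OF a(1-4) w(1)]])
  next
    fix p' p q f v assume a: "p' \<in> obj C" "p \<in> obj C" "q \<in> obj C" "f \<in> carrier (mor C p' p)" "v \<in> V p q"
    then obtain w where w: "w \<in> W p q" "v = J p q +>\<^bsub>mor C p q\<^esub> w" by (auto simp: V_def)
    show "ract ?Q p' p q f v \<in> V p' q"
      unfolding w(2) ract[OF a(1-4) Wc[OF a(2,3) w(1)]] V_def by (rule imageI[OF W_right[OF a(1-4) w(1)]])
  qed
  have tU: "J x y +>\<^bsub>mor C x y\<^esub> t \<in> U x y"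
    using U_lact[OF x x y r s(2)] lact[OF x x y r s(1)] by (simp add: t_def)
  have VU: "V p q \<subseteq> U p q" if p: "p \<in> obj C" and q: "q \<in> obj C" for p q
  proof -
    let ?H = "{w \<in> carrier (mor C p q). J p q +>\<^bsub>mor C p q\<^esub> w \<in> U p q}"
    have H: "submodule ?H K (mor C p q)"
      by (rule linear_hom_vimage_submodule[OF mor_module[OF p q] qmod[OF p q p q] qhom[OF p q p q] Us[OF p q]])
    have "J p q +>\<^bsub>mor C p q\<^esub> g \<in> U p q" if g: "g \<in> G p q" for g
      using g unfolding G_def
    proof (elim UnE CollectE exE conjE)
      assume gJ: "g \<in> J p q"
      have "J p q +>\<^bsub>mor C p q\<^esub> g = J p q"
        using coset_zero_iff[OF mor_module[OF p q] Js[OF p q], of g] gJ subsetD[OF G[OF p q] g] by simp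
      thus ?thesis using submodule_zero[OF qmod[OF p q p q] Us[OF p q]] by (simp add: quot_space_zero)
    next
      fix a b assume ab: "g = comp C p y q a (comp C p x y t b)" "a \<in> carrier (mor C y q)" "b \<in> carrier (mor C p x)"
      have "ract ?Q p x y b (J x y +>\<^bsub>mor C x y\<^esub> t) \<in> U p y" by (rule U_ract[OF p x y ab(3) tU])
      hence "J p y +>\<^bsub>mor C p y\<^esub> comp C p x y t b \<in> U p y" by (simp add: ract[OF p x y ab(3) t])
      from U_lact[OF p y q ab(2) this] show ?thesis
        by (simp add: lact[OF p y q ab(2) comp_closed[OF p x y ab(3) t]] ab(1))
    qed
    hence "G p q \<subseteq> ?H" using G[OF p q] by blast
    from lin_span_minimal[OF H this] show ?thesis unfolding V_def W_def by blast
  qed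
  have idx: "idm C x \<in> carrier (mor C x x)" and idy: "idm C y \<in> carrier (mor C y y)"
    using idm_closed x y by auto
  have "t = comp C x y y (idm C y) (comp C x x y t (idm C x))"
    using comp_idm_right[OF x y t] comp_idm_left[OF x y t] by simp
  hence "t \<in> G x y" unfolding G_def using idx idy by blast
  hence "J x y +>\<^bsub>mor C x y\<^esub> t \<in> V x y" using GW by (simp add: V_def)
  moreover have "J x y +>\<^bsub>mor C x y\<^esub> t \<noteq> J x y"
    using coset_zero_iff[OF mor_module[OF x y] Js[OF x y] t] notJ by (simp add: t_def)
  ultimately have "V x y \<noteq> {\<zero>\<^bsub>bval ?Q x y\<^esub>}" by (auto simp: bval[OF x y] quot_space_zero)
  hence "V x x = U x x" using U subV VU x y unfolding simple_sub_bimod_def by blast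
  then obtain w where w: "w \<in> W x x" "J x x +>\<^bsub>mor C x x\<^esub> s = J x x +>\<^bsub>mor C x x\<^esub> w"
    using s(2) by (auto simp: V_def)
  interpret Vx: module K "mor C x x" by (rule mor_module[OF x x])
  have "s \<ominus>\<^bsub>mor C x x\<^esub> w \<in> J x x"
    using w coset_eq_iff[OF mor_module[OF x x] Js[OF x x] s(1) Wc[OF x x w(1)]] by simp
  hence "s \<ominus>\<^bsub>mor C x x\<^esub> w \<in> W x x" using GW[of _ x x] by (simp add: G_def)
  from submodule_add[OF mor_module[OF x x] W[OF x x] this w(1)]
  have sW: "s \<in> W x x" using Vx.minus_add_cancel(1)[OF s(1) Wc[OF x x w(1)]] by simp

  \<comment> \<open>Regroup the generators as \<open>a (r s b) = (a r) (s b)\<close>: the factors \<open>a r\<close> are nonunits.\<close>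
  have s_mem: "s \<in> H" if H: "submodule H K (mor C x x)" and JH: "J x x \<subseteq> H"
    and cH: "\<And>c b. c \<in> m \<Longrightarrow> b \<in> carrier (mor C x x) \<Longrightarrow> comp C x x x c (comp C x x x s b) \<in> H" for H
  proof -
    have "comp C x y x a (comp C x x y t b) \<in> H" if a: "a \<in> carrier (mor C y x)" and b: "b \<in> carrier (mor C x x)" for a b
    proof -
      have "comp C x x y t b = comp C x x y r (comp C x x x s b)"
        unfolding t_def by (rule comp_assoc[OF x x x y b s(1) r, symmetric])
      hence "comp C x y x a (comp C x x y t b) = comp C x x x (comp C x y x a r) (comp C x x x s b)"
        using comp_assoc[OF x x y x comp_closed[OF x x x b s(1)] r a] by simp
      moreover have "comp C x y x a r \<in> m" using rad[OF a] comp_closed[OF x y x r a] by (simp add: m_def)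
      ultimately show ?thesis using cH b by simp
    qed
    hence "G x x \<subseteq> H" using JH unfolding G_def by blast
    from subsetD[OF lin_span_minimal[OF H this]] sW show ?thesis by (simp add: W_def)
  qed
  let ?S = "(\<lambda>b. comp C x x x s b) ` B"
  have SJ: "?S \<subseteq> J x x"
  proof (rule nakayama[OF x m_facts(1,3,4)])
    show "finite ?S" using B by simp
    show "?S \<subseteq> carrier (mor C x x)" using B(2) comp_closed[OF x x x _ s(1)] by auto
    show "submodule (J x x) K (mor C x x)" by (rule Js[OF x x])
    show "comp C x x x r j \<in> J x x" if "r \<in> carrier (mor C x x)" "j \<in> J x x" for r j
      by (rule cat_ideal_left[OF J x x x that(2,1)])
    fix u H assume u: "u \<in> ?S" and H: "submodule H K (mor C x x)" and JH: "J x x \<subseteq> H"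
      and cH: "\<And>c t. c \<in> m \<Longrightarrow> t \<in> ?S \<Longrightarrow> comp C x x x c t \<in> H"
    obtain b0 where b0: "b0 \<in> B" "u = comp C x x x s b0" using u by auto
    have b0c: "b0 \<in> carrier (mor C x x)" using b0 B by auto
    have cs: "comp C x x x c (comp C x x x s b) \<in> H" if c: "c \<in> m" and b: "b \<in> carrier (mor C x x)" for c b
    proof -
      have cc: "c \<in> carrier (mor C x x)" using c by (simp add: m_def)
      have "linear_hom K (mor C x x) (mor C x x) (\<lambda>b. comp C x x x c (comp C x x x s b))"
        by (rule linear_hom_comp[OF comp_linear_right[OF x x x s(1)] comp_linear_right[OF x x x cc]])
      note H' = linear_hom_vimage_submodule[OF mor_module[OF x x] mor_module[OF x x] this H]
      have "B \<subseteq> {b \<in> carrier (mor C x x). comp C x x x c (comp C x x x s b) \<in> H}"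
        using B(2) cH[OF c] by blast
      from lin_span_minimal[OF H' this] show ?thesis using b B(3) by blast
    qed
    \<comment> \<open>The generator \<open>s b0\<close> lies in \<open>H\<close> if and only if \<open>s\<close> lies in the preimage of \<open>H\<close> under right multiplication by \<open>b0\<close>.\<close>
    have "s \<in> {h \<in> carrier (mor C x x). comp C x x x h b0 \<in> H}"
    proof (rule s_mem)
      show "submodule {h \<in> carrier (mor C x x). comp C x x x h b0 \<in> H} K (mor C x x)"
        by (rule linear_hom_vimage_submodule[OF mor_module[OF x x] mor_module[OF x x] comp_linear_left[OF x x x b0c] H])
      show "J x x \<subseteq> {h \<in> carrier (mor C x x). comp C x x x h b0 \<in> H}"
        using cat_ideal_right[OF J x x x b0c] JH submodule_subset[OF mor_module[OF x x] Js[OF x x]] by blast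
      fix c b assume c: "c \<in> m" and b: "b \<in> carrier (mor C x x)"
      have cc: "c \<in> carrier (mor C x x)" using c by (simp add: m_def)
      have "comp C x x x (comp C x x x c (comp C x x x s b)) b0 = comp C x x x c (comp C x x x s (comp C x x x b b0))"
        using comp_assoc[OF x x x x b0c comp_closed[OF x x x b s(1)] cc] comp_assoc[OF x x x x b0c b s(1)] by simp
      thus "comp C x x x c (comp C x x x s b) \<in> {h \<in> carrier (mor C x x). comp C x x x h b0 \<in> H}"
        using cs[OF c comp_closed[OF x x x b0c b]] comp_closed[OF x x x comp_closed[OF x x x b s(1)] cc] by simp
    qed
    thus "u \<in> H" using b0(2) by simp
  qed
  have "submodule {b \<in> carrier (mor C x x). comp C x x x s b \<in> J x x} K (mor C x x)"
    by (rule linear_hom_vimage_submodule[OF mor_module[OF x x] mor_module[OF x x] comp_linear_right[OF x x x s(1)] Js[OF x x]])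
  from lin_span_minimal[OF this, of B] B SJ idx
  have "comp C x x x s (idm C x) \<in> J x x" by blast
  hence "s \<in> J x x" using comp_idm_right[OF x x s(1)] by simp
  hence "comp C x x y r s \<in> J x y" by (rule cat_ideal_left[OF J x x y _ r])
  thus False using notJ by simp
qed

text \<open>The identity of \<open>x\<close> is a sum of elements of simple subbimodules modulo \<open>J\<close>, and \<open>r\<close> kills each of them.\<close>

lemma radical_in_semisimple_ideal:
  assumes xy: "x \<in> obj C" "y \<in> obj C" and loc: "local_ring (end_ring C x)"
    and J: "cat_ideal K C J"
    and T: "\<And>p q. p \<in> obj C \<Longrightarrow> q \<in> obj C \<Longrightarrow> T p q = carrier (mor C p q)"
    and B: "finite B" "B \<subseteq> carrier (mor C x x)" "lin_span K (mor C x x) B = carrier (mor C x x)"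
    and ss: "semisimple_bimod K C (ideal_quot_bimod C T J)"
    and r: "r \<in> carrier (mor C x y)"
    and rad: "\<And>a. a \<in> carrier (mor C y x) \<Longrightarrow> comp C x y x a r \<notin> Units (end_ring C x)"
  shows "r \<in> J x y"
proof -
  note x = xy(1) and y = xy(2)
  let ?Q = "ideal_quot_bimod C T J"
  note Js = cat_ideal_submodule[OF J]
  have bval: "bval ?Q x x = quot_space (mor C x x) (J x x)"
    using T[OF x x] by (simp add: ideal_quot_bimod_def)
  note Vx = mor_module[OF x x]
  let ?H = "{s \<in> carrier (mor C x x). comp C x x y r s \<in> J x y}"
  have H: "submodule ?H K (mor C x x)"
    by (rule linear_hom_vimage_submodule[OF Vx mor_module[OF x y] comp_linear_right[OF x x y r] Js[OF x y]])
  let ?I = "(\<lambda>s. J x x +>\<^bsub>mor C x x\<^esub> s) ` ?H"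
  have I: "submodule ?I K (bval ?Q x x)" unfolding bval
    by (rule linear_hom_image_submodule[OF Vx quot_space_module[OF Vx Js[OF x x]] quot_space_linear_hom[OF Vx Js[OF x x]] H])
  have "\<Union>{U x x | U. simple_sub_bimod K C ?Q U} \<subseteq> ?I"
  proof
    fix Y assume "Y \<in> \<Union>{U x x | U. simple_sub_bimod K C ?Q U}"
    then obtain U where U: "simple_sub_bimod K C ?Q U" "Y \<in> U x x" by blast
    have "submodule (U x x) K (bval ?Q x x)" using U(1) x by (simp add: simple_sub_bimod_def sub_bimod_def)
    hence "Y \<in> carrier (quot_space (mor C x x) (J x x))"
      using U(2) submodule_subset[OF quot_space_module[OF Vx Js[OF x x]], of "U x x"] by (auto simp: bval)
    then obtain s where s: "s \<in> carrier (mor C x x)" "Y = J x x +>\<^bsub>mor C x x\<^esub> s" by (auto simp: quot_space_carrier)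
    have "comp C x x y r s \<in> J x y"
      by (rule simple_killed_by_radical[OF xy loc J T B U(1) s(1) _ r rad]) (use s U in auto)
    thus "Y \<in> ?I" using s by blast
  qed
  from lin_span_minimal[OF I this] ss x have "carrier (bval ?Q x x) \<subseteq> ?I"
    by (simp add: semisimple_bimod_def)
  moreover have idx: "idm C x \<in> carrier (mor C x x)" by (rule idm_closed[OF x])
  hence "J x x +>\<^bsub>mor C x x\<^esub> idm C x \<in> carrier (bval ?Q x x)" by (simp add: bval quot_space_carrier)
  ultimately obtain s where s: "s \<in> carrier (mor C x x)" "comp C x x y r s \<in> J x y"
    "J x x +>\<^bsub>mor C x x\<^esub> idm C x = J x x +>\<^bsub>mor C x x\<^esub> s" by blast
  have "idm C x \<ominus>\<^bsub>mor C x x\<^esub> s \<in> J x x" using s coset_eq_iff[OF Vx Js[OF x x] idx s(1)] by simp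
  hence "comp C x x y r (idm C x \<ominus>\<^bsub>mor C x x\<^esub> s) \<in> J x y" by (rule cat_ideal_left[OF J x x y _ r])
  hence d: "r \<ominus>\<^bsub>mor C x y\<^esub> comp C x x y r s \<in> J x y"
    using comp_minus_right[OF x x y idx s(1) r] comp_idm_right[OF x y r] by simp
  interpret V: module K "mor C x y" by (rule mor_module[OF x y])
  show ?thesis using submodule_add[OF mor_module[OF x y] Js[OF x y] d s(2)]
      V.minus_add_cancel(1)[OF r comp_closed[OF x x y s(1) r]] by simp
qed

end


section \<open>Endomorphisms over an algebraically closed field\<close>

text \<open>Horner's scheme, started at \<open>v\<close>, for the value at \<open>f\<close> of a polynomial; coefficient lists begin with the
  leading coefficient.  The start value is a parameter because additivity is proved by induction on the list.\<close>

definition horner :: "('k, 'o, 'm) lincat \<Rightarrow> 'o \<Rightarrow> 'm \<Rightarrow> 'm \<Rightarrow> 'k list \<Rightarrow> 'm" where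
  "horner C x f = foldl (\<lambda>v a. comp C x x x f v \<oplus>\<^bsub>mor C x x\<^esub> a \<odot>\<^bsub>mor C x x\<^esub> idm C x)"

context linear_category
begin

context
  fixes x f
  assumes x: "x \<in> obj C" and f: "f \<in> carrier (mor C x x)"
begin

interpretation V: module K "mor C x x" by (rule mor_module[OF x x])

lemma horner_simps:
  "horner C x f v [] = v"
  "horner C x f v (a # p) = horner C x f (comp C x x x f v \<oplus>\<^bsub>mor C x x\<^esub> a \<odot>\<^bsub>mor C x x\<^esub> idm C x) p"
  "horner C x f v (p @ [a]) = comp C x x x f (horner C x f v p) \<oplus>\<^bsub>mor C x x\<^esub> a \<odot>\<^bsub>mor C x x\<^esub> idm C x"
  by (simp_all add: horner_def)

lemma horner_closed:
  "v \<in> carrier (mor C x x) \<Longrightarrow> set p \<subseteq> carrier K \<Longrightarrow> horner C x f v p \<in> carrier (mor C x x)"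
  by (induction p arbitrary: v) (simp_all add: horner_simps comp_closed[OF x x x _ f] idm_closed[OF x])

lemma horner_add:
  "length p = length q \<Longrightarrow> u \<in> carrier (mor C x x) \<Longrightarrow> v \<in> carrier (mor C x x) \<Longrightarrow>
   set p \<subseteq> carrier K \<Longrightarrow> set q \<subseteq> carrier K \<Longrightarrow>
   horner C x f (u \<oplus>\<^bsub>mor C x x\<^esub> v) (map2 (\<oplus>\<^bsub>K\<^esub>) p q) = horner C x f u p \<oplus>\<^bsub>mor C x x\<^esub> horner C x f v q"
proof (induction p q arbitrary: u v rule: list_induct2)
  case (Cons a p b q)
  let ?m = "comp C x x x"
  have id: "idm C x \<in> carrier (mor C x x)" by (rule idm_closed[OF x])
  have "?m f (u \<oplus>\<^bsub>mor C x x\<^esub> v) \<oplus>\<^bsub>mor C x x\<^esub> (a \<oplus>\<^bsub>K\<^esub> b) \<odot>\<^bsub>mor C x x\<^esub> idm C x =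
    (?m f u \<oplus>\<^bsub>mor C x x\<^esub> a \<odot>\<^bsub>mor C x x\<^esub> idm C x) \<oplus>\<^bsub>mor C x x\<^esub> (?m f v \<oplus>\<^bsub>mor C x x\<^esub> b \<odot>\<^bsub>mor C x x\<^esub> idm C x)"
    using Cons.prems id linear_hom_add[OF comp_linear_right[OF x x x f], of u v]
    by (simp add: V.smult_l_distr comp_closed[OF x x x _ f] V.M.a_ac)
  thus ?case using Cons id by (simp add: horner_simps comp_closed[OF x x x _ f])
qed (simp add: horner_simps)

lemma horner_smult:
  "c \<in> carrier K \<Longrightarrow> v \<in> carrier (mor C x x) \<Longrightarrow> set p \<subseteq> carrier K \<Longrightarrow>
   horner C x f (c \<odot>\<^bsub>mor C x x\<^esub> v) (map (\<lambda>a. c \<otimes>\<^bsub>K\<^esub> a) p) = c \<odot>\<^bsub>mor C x x\<^esub> horner C x f v p"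
proof (induction p arbitrary: v)
  case (Cons a p)
  let ?m = "comp C x x x"
  have id: "idm C x \<in> carrier (mor C x x)" by (rule idm_closed[OF x])
  have "?m f (c \<odot>\<^bsub>mor C x x\<^esub> v) \<oplus>\<^bsub>mor C x x\<^esub> (c \<otimes>\<^bsub>K\<^esub> a) \<odot>\<^bsub>mor C x x\<^esub> idm C x =
    c \<odot>\<^bsub>mor C x x\<^esub> (?m f v \<oplus>\<^bsub>mor C x x\<^esub> a \<odot>\<^bsub>mor C x x\<^esub> idm C x)"
    using Cons.prems id linear_hom_smult[OF comp_linear_right[OF x x x f], of c v]
    by (simp add: V.smult_r_distr V.smult_assoc1 comp_closed[OF x x x _ f])
  thus ?case using Cons id by (simp add: horner_simps comp_closed[OF x x x _ f])
qed (simp add: horner_simps)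

lemma map2_closed:
  "set p \<subseteq> carrier K \<Longrightarrow> set q \<subseteq> carrier K \<Longrightarrow> set (map2 (\<oplus>\<^bsub>K\<^esub>) p q) \<subseteq> carrier K"
proof
  fix c assume pq: "set p \<subseteq> carrier K" "set q \<subseteq> carrier K" and "c \<in> set (map2 (\<oplus>\<^bsub>K\<^esub>) p q)"
  then obtain a b where "(a, b) \<in> set (zip p q)" "c = a \<oplus>\<^bsub>K\<^esub> b" by auto
  thus "c \<in> carrier K" using pq set_zip_leftD[of a b p q] set_zip_rightD[of a b p q] by auto
qed

lemma K_eval_snoc:
  assumes "set p \<subseteq> carrier K" "a \<in> carrier K" "c \<in> carrier K"
  shows "K.eval (p @ [a]) c = K.eval p c \<otimes>\<^bsub>K\<^esub> c \<oplus>\<^bsub>K\<^esub> a"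
  using K.eval_append[of p "[a]" c] assms K.eval_in_carrier[of p c] by simp

text \<open>Division of a polynomial by \<open>X - c\<close>, evaluated at \<open>f\<close>; the remainder is the value at \<open>c\<close>.  The length and the
  head of \<open>q\<close> record that the degree drops by one and that the leading coefficient is unchanged.\<close>

lemma horner_division:
  assumes c: "c \<in> carrier K"
  shows "p \<noteq> [] \<Longrightarrow> set p \<subseteq> carrier K \<Longrightarrow> \<exists>q. set q \<subseteq> carrier K \<and> length p = Suc (length q) \<and>
    (q \<noteq> [] \<longrightarrow> hd q = hd p) \<and>
    horner C x f \<zero>\<^bsub>mor C x x\<^esub> p =
      comp C x x x (f \<ominus>\<^bsub>mor C x x\<^esub> c \<odot>\<^bsub>mor C x x\<^esub> idm C x) (horner C x f \<zero>\<^bsub>mor C x x\<^esub> q)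
      \<oplus>\<^bsub>mor C x x\<^esub> K.eval p c \<odot>\<^bsub>mor C x x\<^esub> idm C x"
proof (induction p rule: rev_induct)
  case (snoc a p)
  let ?V = "mor C x x" and ?m = "comp C x x x" and ?h = "horner C x f \<zero>\<^bsub>mor C x x\<^esub>" and ?i = "idm C x"
  have id: "?i \<in> carrier ?V" by (rule idm_closed[OF x])
  have a: "a \<in> carrier K" and p: "set p \<subseteq> carrier K" using snoc.prems by auto
  define g where "g = f \<ominus>\<^bsub>?V\<^esub> c \<odot>\<^bsub>?V\<^esub> ?i"
  have g: "g \<in> carrier ?V" using f c id by (simp add: g_def)
  note cl = comp_closed[OF x x x]
  show ?case
  proof (cases "p = []")
    case True
    thus ?thesis using a c id g comp_zero_right[OF x x x f] comp_zero_right[OF x x x g]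
      by (intro exI[of _ "[]"]) (simp add: horner_simps g_def[symmetric])
  next
    case False
    then obtain q where q: "set q \<subseteq> carrier K" "length p = Suc (length q)" "q \<noteq> [] \<longrightarrow> hd q = hd p"
      "?h p = ?m g (?h q) \<oplus>\<^bsub>?V\<^esub> K.eval p c \<odot>\<^bsub>?V\<^esub> ?i"
      using snoc.IH[OF False p] by (auto simp: g_def)
    define e where "e = K.eval p c"
    have e: "e \<in> carrier K" using K.eval_in_carrier[OF p c] by (simp add: e_def)
    define Q where "Q = ?h q"
    have Q: "Q \<in> carrier ?V" unfolding Q_def by (rule horner_closed[OF V.M.zero_closed q(1)])
    have fg: "?m f g = ?m g f"
      using comp_minus_right[OF x x x f V.smult_closed[OF c id] f] comp_minus_left[OF x x x f f V.smult_closed[OF c id]]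
        linear_hom_smult[OF comp_linear_right[OF x x x f] c id] linear_hom_smult[OF comp_linear_left[OF x x x f] c id]
        comp_idm_left[OF x x f] comp_idm_right[OF x x f] by (simp add: g_def)
    have ge: "?m g (e \<odot>\<^bsub>?V\<^esub> ?i) = e \<odot>\<^bsub>?V\<^esub> g"
      using linear_hom_smult[OF comp_linear_right[OF x x x g] e id] comp_idm_right[OF x x g] by simp
    have fe: "?m f (e \<odot>\<^bsub>?V\<^esub> ?i) = e \<odot>\<^bsub>?V\<^esub> f"
      using linear_hom_smult[OF comp_linear_right[OF x x x f] e id] comp_idm_right[OF x x f] by simp
    have gf: "g \<oplus>\<^bsub>?V\<^esub> c \<odot>\<^bsub>?V\<^esub> ?i = f"
      unfolding g_def by (rule V.minus_add_cancel(1)[OF f V.smult_closed[OF c id]])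
    have hq: "?h (q @ [e]) = ?m f Q \<oplus>\<^bsub>?V\<^esub> e \<odot>\<^bsub>?V\<^esub> ?i" by (simp add: horner_simps Q_def)
    have "?h (p @ [a]) = ?m f (?m g Q \<oplus>\<^bsub>?V\<^esub> e \<odot>\<^bsub>?V\<^esub> ?i) \<oplus>\<^bsub>?V\<^esub> a \<odot>\<^bsub>?V\<^esub> ?i"
      using q(4) by (simp add: horner_simps Q_def e_def)
    also have "\<dots> = ?m f (?m g Q) \<oplus>\<^bsub>?V\<^esub> ?m f (e \<odot>\<^bsub>?V\<^esub> ?i) \<oplus>\<^bsub>?V\<^esub> a \<odot>\<^bsub>?V\<^esub> ?i"
      using linear_hom_add[OF comp_linear_right[OF x x x f] cl[OF Q g] V.smult_closed[OF e id]] by simp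
    also have "?m f (?m g Q) = ?m g (?m f Q)"
      using comp_assoc[OF x x x x Q g f] comp_assoc[OF x x x x Q f g] fg by simp
    also have "?m f (e \<odot>\<^bsub>?V\<^esub> ?i) = e \<odot>\<^bsub>?V\<^esub> g \<oplus>\<^bsub>?V\<^esub> (e \<otimes>\<^bsub>K\<^esub> c) \<odot>\<^bsub>?V\<^esub> ?i"
      unfolding fe using V.smult_r_distr[OF e g V.smult_closed[OF c id]] V.smult_assoc1[OF e c id] gf by simp
    also have "?m g (?m f Q) \<oplus>\<^bsub>?V\<^esub> (e \<odot>\<^bsub>?V\<^esub> g \<oplus>\<^bsub>?V\<^esub> (e \<otimes>\<^bsub>K\<^esub> c) \<odot>\<^bsub>?V\<^esub> ?i) \<oplus>\<^bsub>?V\<^esub> a \<odot>\<^bsub>?V\<^esub> ?i =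
       (?m g (?m f Q) \<oplus>\<^bsub>?V\<^esub> e \<odot>\<^bsub>?V\<^esub> g) \<oplus>\<^bsub>?V\<^esub> (e \<otimes>\<^bsub>K\<^esub> c \<oplus>\<^bsub>K\<^esub> a) \<odot>\<^bsub>?V\<^esub> ?i"
      using e c a id g cl[OF cl[OF Q f] g] by (simp add: V.smult_l_distr V.M.a_assoc)
    also have "?m g (?m f Q) \<oplus>\<^bsub>?V\<^esub> e \<odot>\<^bsub>?V\<^esub> g = ?m g (?h (q @ [e]))"
      unfolding hq using linear_hom_add[OF comp_linear_right[OF x x x g] cl[OF Q f] V.smult_closed[OF e id]] ge by simp
    also have "e \<otimes>\<^bsub>K\<^esub> c \<oplus>\<^bsub>K\<^esub> a = K.eval (p @ [a]) c" using K_eval_snoc[OF p a c] by (simp add: e_def)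
    finally have "?h (p @ [a]) = ?m g (?h (q @ [e])) \<oplus>\<^bsub>?V\<^esub> K.eval (p @ [a]) c \<odot>\<^bsub>?V\<^esub> ?i" .
    moreover have "hd (q @ [e]) = hd (p @ [a])"
    proof (cases "q = []")
      case True
      then obtain h where "p = [h]" using q(2) by (cases p) auto
      thus ?thesis using True p by (simp add: e_def)
    qed (use q False in simp)
    ultimately show ?thesis using q e by (intro exI[of _ "q @ [e]"]) (simp add: g_def)
  qed
qed simp

lemma algebraically_closed_root:
  assumes ac: "algebraically_closed K" and p: "set p \<subseteq> carrier K" "length p > 1" "hd p \<noteq> \<zero>\<^bsub>K\<^esub>"
  shows "\<exists>c\<in>carrier K. K.eval p c = \<zero>\<^bsub>K\<^esub>"
proof -
  interpret ac: algebraically_closed K by (rule ac)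
  have pc: "p \<in> carrier (poly_ring K)" using p by (auto simp: univ_poly_def polynomial_def)
  have "size (K.roots p) = length p - 1" using ac.roots_over_carrier[OF pc] by (simp add: K.splitted_def)
  hence "K.roots p \<noteq> {#}" using p by auto
  then obtain c where "c \<in># K.roots p" by blast
  hence "K.is_root p c" using K.roots_mem_iff_is_root[OF pc] by simp
  thus ?thesis by (auto simp: K.is_root_def)
qed

text \<open>Let \<open>c\<close> be a root of the annihilating polynomial.  If \<open>f - c\<close> is a unit, dividing by \<open>X - c\<close> gives an annihilating
  polynomial of smaller degree; degree \<open>0\<close> is impossible because the identity is not zero.\<close>

lemma annihilated_imp_nonunit:
  assumes ac: "algebraically_closed K" and nz: "idm C x \<noteq> \<zero>\<^bsub>mor C x x\<^esub>"
  shows "set p \<subseteq> carrier K \<Longrightarrow> p \<noteq> [] \<Longrightarrow> hd p \<noteq> \<zero>\<^bsub>K\<^esub> \<Longrightarrow>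
    horner C x f \<zero>\<^bsub>mor C x x\<^esub> p = \<zero>\<^bsub>mor C x x\<^esub> \<Longrightarrow>
    \<exists>c\<in>carrier K. f \<ominus>\<^bsub>mor C x x\<^esub> c \<odot>\<^bsub>mor C x x\<^esub> idm C x \<notin> Units (end_ring C x)"
proof (induction "length p" arbitrary: p rule: less_induct)
  case less
  let ?V = "mor C x x" and ?m = "comp C x x x" and ?h = "horner C x f \<zero>\<^bsub>mor C x x\<^esub>" and ?i = "idm C x"
  have id: "?i \<in> carrier ?V" by (rule idm_closed[OF x])
  show ?case
  proof (cases "length p > 1")
    case False
    then obtain a where a: "p = [a]" using less.prems(2) by (cases p) auto
    have aK: "a \<in> carrier K" "a \<noteq> \<zero>\<^bsub>K\<^esub>" using less.prems a by auto
    have "a \<odot>\<^bsub>?V\<^esub> ?i = \<zero>\<^bsub>?V\<^esub>"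
      using less.prems(4) aK id by (simp add: a horner_simps comp_zero_right[OF x x x f])
    moreover have "inv\<^bsub>K\<^esub> a \<odot>\<^bsub>?V\<^esub> (a \<odot>\<^bsub>?V\<^esub> ?i) = ?i"
      using aK id by (subst V.smult_assoc1[symmetric]) (auto simp: K.field_Units)
    ultimately have "?i = \<zero>\<^bsub>?V\<^esub>" using aK by (simp add: K.field_Units)
    thus ?thesis using nz by simp
  next
    case True
    obtain c where c: "c \<in> carrier K" "K.eval p c = \<zero>\<^bsub>K\<^esub>"
      using algebraically_closed_root[OF ac less.prems(1) True less.prems(3)] by blast
    define g where "g = f \<ominus>\<^bsub>?V\<^esub> c \<odot>\<^bsub>?V\<^esub> ?i"
    have g: "g \<in> carrier ?V" using f c id by (simp add: g_def)
    obtain q where q: "set q \<subseteq> carrier K" "length p = Suc (length q)" "q \<noteq> [] \<longrightarrow> hd q = hd p"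
      "?h p = ?m g (?h q) \<oplus>\<^bsub>?V\<^esub> K.eval p c \<odot>\<^bsub>?V\<^esub> ?i"
      using horner_division[OF c(1) less.prems(2,1)] by (auto simp: g_def)
    have Q: "?h q \<in> carrier ?V" by (rule horner_closed[OF V.M.zero_closed q(1)])
    have gQ: "?m g (?h q) = \<zero>\<^bsub>?V\<^esub>"
      using q(4) less.prems(4) c id comp_closed[OF x x x Q g] by simp
    have qne: "q \<noteq> []" using q(2) True by auto
    show ?thesis
    proof (cases "g \<in> Units (end_ring C x)")
      case False thus ?thesis using c by (auto simp: g_def)
    next
      case True
      then obtain u where u: "u \<in> carrier ?V" "?m u g = ?i" by (auto simp: Units_def end_ring_simps)
      have "?h q = \<zero>\<^bsub>?V\<^esub>"
        using comp_assoc[OF x x x x Q g u(1)] u(2) gQ comp_idm_left[OF x x Q] comp_zero_right[OF x x x u(1)] by simp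
      thus ?thesis using less.hyps[of q] q qne less.prems(3) by simp
    qed
  qed
qed

text \<open>The values at \<open>f\<close> of polynomials of degree less than \<open>n\<close> form an increasing chain of subspaces of a
  finite-dimensional space.  It becomes stationary, so \<open>f\<^sup>n\<close> is a combination of lower powers for some \<open>n\<close>, and
  \<open>f\<close> is annihilated by a monic polynomial.\<close>

lemma scalar_plus_nonunit:
  assumes ac: "algebraically_closed K" and nz: "idm C x \<noteq> \<zero>\<^bsub>mor C x x\<^esub>"
    and B: "finite B" "B \<subseteq> carrier (mor C x x)" "lin_span K (mor C x x) B = carrier (mor C x x)"
  shows "\<exists>c\<in>carrier K. f \<ominus>\<^bsub>mor C x x\<^esub> c \<odot>\<^bsub>mor C x x\<^esub> idm C x \<notin> Units (end_ring C x)"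
proof -
  let ?V = "mor C x x" and ?h = "horner C x f \<zero>\<^bsub>mor C x x\<^esub>"
  define P where "P n = {?h p | p. length p = n \<and> set p \<subseteq> carrier K}" for n
  have PI: "?h p \<in> P (length p)" if "set p \<subseteq> carrier K" for p using that by (auto simp: P_def)
  have cons0: "?h (\<zero>\<^bsub>K\<^esub> # p) = ?h p" for p
    using idm_closed[OF x] by (simp add: horner_simps comp_zero_right[OF x x x f])
  have Psuc: "P n \<subseteq> P (Suc n)" for n
  proof
    fix v assume "v \<in> P n"
    then obtain p where "v = ?h p" "length p = n" "set p \<subseteq> carrier K" by (auto simp: P_def)
    thus "v \<in> P (Suc n)" using PI[of "\<zero>\<^bsub>K\<^esub> # p"] cons0[of p] by simp
  qed
  have Pmono: "P n \<subseteq> P k" if "n \<le> k" for n k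
    using that by (rule lift_Suc_mono_le[of P, OF Psuc])
  have Padd: "u \<oplus>\<^bsub>?V\<^esub> v \<in> P n" if uv: "u \<in> P n" "v \<in> P n" for u v n
  proof -
    obtain p q where pq: "u = ?h p" "length p = n" "set p \<subseteq> carrier K" "v = ?h q" "length q = n" "set q \<subseteq> carrier K"
      using uv by (auto simp: P_def)
    have "?h (map2 (\<oplus>\<^bsub>K\<^esub>) p q) = u \<oplus>\<^bsub>?V\<^esub> v"
      using horner_add[of p q "\<zero>\<^bsub>?V\<^esub>" "\<zero>\<^bsub>?V\<^esub>"] pq by simp
    moreover have "set (map2 (\<oplus>\<^bsub>K\<^esub>) p q) \<subseteq> carrier K"
      using map2_closed[OF pq(3,6)] .
    ultimately show ?thesis using PI[of "map2 (\<oplus>\<^bsub>K\<^esub>) p q"] pq by simp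
  qed
  have Psm: "c \<odot>\<^bsub>?V\<^esub> u \<in> P n" if c: "c \<in> carrier K" and u: "u \<in> P n" for c u n
  proof -
    obtain p where p: "u = ?h p" "length p = n" "set p \<subseteq> carrier K" using u by (auto simp: P_def)
    have "?h (map (\<lambda>a. c \<otimes>\<^bsub>K\<^esub> a) p) = c \<odot>\<^bsub>?V\<^esub> u"
      using horner_smult[OF c V.M.zero_closed p(3)] c p by simp
    moreover have "set (map (\<lambda>a. c \<otimes>\<^bsub>K\<^esub> a) p) \<subseteq> carrier K" using p c by auto
    ultimately show ?thesis using PI[of "map (\<lambda>a. c \<otimes>\<^bsub>K\<^esub> a) p"] p by simp
  qed
  have Pc: "P n \<subseteq> carrier ?V" for n using horner_closed[OF V.M.zero_closed] by (auto simp: P_def)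
  have P0: "\<zero>\<^bsub>?V\<^esub> \<in> P n" for n
    using subsetD[OF Pmono[of 0 n]] PI[of "[]"] by (simp add: horner_simps)
  have Pn: "submodule (P n) K ?V" for n
    unfolding submodule_iff[OF mor_module[OF x x]] using Pc P0 Padd Psm by simp
  have Pall: "submodule (\<Union>n. P n) K ?V"
    unfolding submodule_iff[OF mor_module[OF x x]]
  proof (intro conjI ballI)
    show "(\<Union>n. P n) \<subseteq> carrier ?V" using Pc by blast
    show "\<zero>\<^bsub>?V\<^esub> \<in> (\<Union>n. P n)" using P0 by blast
    show "c \<odot>\<^bsub>?V\<^esub> v \<in> (\<Union>n. P n)" if "c \<in> carrier K" "v \<in> (\<Union>n. P n)" for c v using that Psm by blast
    fix u v assume "u \<in> (\<Union>n. P n)" "v \<in> (\<Union>n. P n)"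
    then obtain i j where ij: "u \<in> P i" "v \<in> P j" by blast
    have "u \<oplus>\<^bsub>?V\<^esub> v \<in> P (max i j)"
      by (rule Padd) (use ij Pmono[of i "max i j"] Pmono[of j "max i j"] in auto)
    thus "u \<oplus>\<^bsub>?V\<^esub> v \<in> (\<Union>n. P n)" by blast
  qed
  have "(\<Union>n. P n) \<subseteq> lin_span K ?V B" using Pc B(3) by auto
  then obtain T where T: "finite T" "T \<subseteq> (\<Union>n. P n)" "lin_span K ?V T = (\<Union>n. P n)"
    using subspace_finitely_spanned[OF K.field_axioms mor_module[OF x x] B(1,2) Pall] by blast
  have "\<exists>n. T \<subseteq> P n" using T(1,2)
  proof (induction T rule: finite_induct)
    case (insert t T)
    then obtain i j where ij: "T \<subseteq> P i" "t \<in> P j" by auto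
    have "insert t T \<subseteq> P (max i j)" using ij Pmono[of i "max i j"] Pmono[of j "max i j"] by auto
    thus ?case ..
  qed simp
  then obtain n where n: "T \<subseteq> P n" ..
  have "(\<Union>n. P n) \<subseteq> P n" using lin_span_minimal[OF Pn n] T(3) by simp
  moreover
  \<comment> \<open>The list of the polynomial \<open>X\<^sup>n\<close>.  Its value is also that of a polynomial \<open>p\<close> of length \<open>n\<close>, and the difference of the
    two is monic; the zero in front of \<open>p\<close> adjusts the lengths.\<close>
  let ?e = "\<one>\<^bsub>K\<^esub> # replicate n \<zero>\<^bsub>K\<^esub>"
  have es: "set ?e \<subseteq> carrier K" by auto
  have "?h ?e \<in> (\<Union>n. P n)" using PI[OF es] by blast
  ultimately obtain p where p: "?h ?e = ?h p" "length p = n" "set p \<subseteq> carrier K" by (auto simp: P_def)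
  let ?p = "\<zero>\<^bsub>K\<^esub> # map (\<lambda>a. (\<ominus>\<^bsub>K\<^esub> \<one>\<^bsub>K\<^esub>) \<otimes>\<^bsub>K\<^esub> a) p"
  have mp: "set (map (\<lambda>a. (\<ominus>\<^bsub>K\<^esub> \<one>\<^bsub>K\<^esub>) \<otimes>\<^bsub>K\<^esub> a) p) \<subseteq> carrier K" using p(3) by auto
  have hp: "?h ?p = (\<ominus>\<^bsub>K\<^esub> \<one>\<^bsub>K\<^esub>) \<odot>\<^bsub>?V\<^esub> ?h p"
    using horner_smult[of "\<ominus>\<^bsub>K\<^esub> \<one>\<^bsub>K\<^esub>" "\<zero>\<^bsub>?V\<^esub>", OF _ V.M.zero_closed p(3)] cons0 by simp
  define r where "r = map2 (\<oplus>\<^bsub>K\<^esub>) ?e ?p"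
  have "?h r = ?h ?e \<oplus>\<^bsub>?V\<^esub> ?h ?p"
    using horner_add[of ?e ?p "\<zero>\<^bsub>?V\<^esub>" "\<zero>\<^bsub>?V\<^esub>"] p(2) es mp by (simp add: r_def)
  also have "\<dots> = \<zero>\<^bsub>?V\<^esub>"
    unfolding hp p(1) using horner_closed[OF V.M.zero_closed p(3)] V.smult_l_minus[of "\<one>\<^bsub>K\<^esub>" "?h p"]
    by (simp add: V.M.r_neg)
  finally have "?h r = \<zero>\<^bsub>?V\<^esub>" .
  moreover have "hd r = \<one>\<^bsub>K\<^esub>" "r \<noteq> []" by (simp_all add: r_def)
  moreover have "set r \<subseteq> carrier K"
    unfolding r_def by (rule map2_closed[OF es]) (use mp in simp)
  ultimately show ?thesis using annihilated_imp_nonunit[OF ac nz, of r] by simp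
qed

end

end


section \<open>The associated category on representatives\<close>

locale filtered_category = linear_category K A
  for K :: "('k, 'c) ring_scheme" and A :: "('k, 'o, 'm) lincat" +
  fixes N :: nat and I :: "nat \<Rightarrow> 'o \<Rightarrow> 'o \<Rightarrow> 'm set"
  assumes filtration: "ideal_filtration K A N I"
begin

abbreviation CC :: "('k, 'o \<times> int, 'm set) lincat" where "CC \<equiv> conv_cat A N I"

lemma I_ideal: "cat_ideal K A (I i)"
  using filtration by (simp add: ideal_filtration_def)

lemma I_zero: "x \<in> obj A \<Longrightarrow> y \<in> obj A \<Longrightarrow> I 0 x y = carrier (mor A x y)"
  using filtration by (simp add: ideal_filtration_def)

lemma I_ge_N: "x \<in> obj A \<Longrightarrow> y \<in> obj A \<Longrightarrow> N \<le> i \<Longrightarrow> I i x y = {\<zero>\<^bsub>mor A x y\<^esub>}"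
  using filtration by (simp add: ideal_filtration_def)

lemma I_mult:
  "x \<in> obj A \<Longrightarrow> y \<in> obj A \<Longrightarrow> z \<in> obj A \<Longrightarrow> f \<in> I j x y \<Longrightarrow> g \<in> I i y z \<Longrightarrow>
   comp A x y z g f \<in> I (i + j) x z"
  using filtration by (simp add: ideal_filtration_def)

lemma I_Suc: "x \<in> obj A \<Longrightarrow> y \<in> obj A \<Longrightarrow> I (Suc i) x y \<subseteq> I i x y"
proof (cases "i < N")
  case True
  assume "x \<in> obj A" "y \<in> obj A"
  thus ?thesis using filtration True by (simp add: ideal_filtration_def)
next
  case False
  assume "x \<in> obj A" "y \<in> obj A"
  thus ?thesis using False I_ge_N[of x y i] I_ge_N[of x y "Suc i"] by simp
qed

lemma I_antimono: "x \<in> obj A \<Longrightarrow> y \<in> obj A \<Longrightarrow> i \<le> j \<Longrightarrow> I j x y \<subseteq> I i x y"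
  by (rule lift_Suc_antimono_le[of "\<lambda>i. I i x y"]) (simp_all add: I_Suc)

text \<open>The filtration extended to all integers: negative indices are truncated to \<open>0\<close> and give all morphisms.  With
  this convention the ideals are multiplicative at all integer levels.\<close>

definition J :: "int \<Rightarrow> 'o \<Rightarrow> 'o \<Rightarrow> 'm set" where "J n x y = I (nat n) x y"

lemma J_submodule: "x \<in> obj A \<Longrightarrow> y \<in> obj A \<Longrightarrow> submodule (J n x y) K (mor A x y)"
  unfolding J_def by (rule cat_ideal_submodule[OF I_ideal])

lemma J_carrier: "x \<in> obj A \<Longrightarrow> y \<in> obj A \<Longrightarrow> f \<in> J n x y \<Longrightarrow> f \<in> carrier (mor A x y)"
  by (rule subsetD[OF submodule_subset[OF mor_module J_submodule]])

lemma J_antimono: "x \<in> obj A \<Longrightarrow> y \<in> obj A \<Longrightarrow> m \<le> n \<Longrightarrow> J n x y \<subseteq> J m x y"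
  unfolding J_def by (rule I_antimono) simp_all

lemma J_mono_mem: "f \<in> J n x y \<Longrightarrow> x \<in> obj A \<Longrightarrow> y \<in> obj A \<Longrightarrow> m \<le> n \<Longrightarrow> f \<in> J m x y"
  using J_antimono by blast

lemma J_nonpos: "x \<in> obj A \<Longrightarrow> y \<in> obj A \<Longrightarrow> n \<le> 0 \<Longrightarrow> J n x y = carrier (mor A x y)"
  by (simp add: J_def I_zero)

lemma J_ge_N: "x \<in> obj A \<Longrightarrow> y \<in> obj A \<Longrightarrow> int N \<le> n \<Longrightarrow> J n x y = {\<zero>\<^bsub>mor A x y\<^esub>}"
  by (simp add: J_def I_ge_N)

text \<open>A factor of negative level still belongs to \<open>I\<^sub>0\<close>, hence the maximum; a smaller level \<open>n\<close> may be claimed since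
  the ideals decrease.\<close>

lemma J_mult:
  assumes "x \<in> obj A" "y \<in> obj A" "z \<in> obj A" "f \<in> J m x y" "g \<in> J e y z" "n \<le> m + max e 0"
  shows "comp A x y z g f \<in> J n x z"
proof -
  have "comp A x y z g f \<in> I (nat e + nat m) x z" using I_mult assms(1-5) unfolding J_def by blast
  moreover have "nat n \<le> nat e + nat m" using assms(6) by linarith
  ultimately show ?thesis unfolding J_def using I_antimono[OF assms(1,3)] by blast
qed

lemma J_zero_mem: "x \<in> obj A \<Longrightarrow> y \<in> obj A \<Longrightarrow> \<zero>\<^bsub>mor A x y\<^esub> \<in> J n x y"
  by (rule submodule_zero[OF mor_module J_submodule])

lemma idm_J: "x \<in> obj A \<Longrightarrow> n \<le> 0 \<Longrightarrow> idm A x \<in> J n x x"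
  by (simp add: J_nonpos idm_closed)


text \<open>Numerator and denominator of the space of morphisms.  They agree with the ones in the definition of the
  category on objects (\<open>conv_num_eq\<close>, \<open>conv_den_eq\<close>), but need no case distinction.\<close>

definition num :: "'o \<times> int \<Rightarrow> 'o \<times> int \<Rightarrow> 'm set" where
  "num p q = J (snd q - snd p) (fst p) (fst q)"

definition den :: "'o \<times> int \<Rightarrow> 'o \<times> int \<Rightarrow> 'm set" where
  "den p q = J (snd q - snd p + int N) (fst p) (fst q)"

definition rep :: "'o \<times> int \<Rightarrow> 'o \<times> int \<Rightarrow> ('k, 'm) module" where
  "rep p q = (mor A (fst p) (fst q))\<lparr>carrier := num p q\<rparr>"

definition cls :: "'o \<times> int \<Rightarrow> 'o \<times> int \<Rightarrow> 'm \<Rightarrow> 'm set" where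
  "cls p q f = den p q +>\<^bsub>mor A (fst p) (fst q)\<^esub> f"

lemma obj_CC [simp]: "p \<in> obj CC \<longleftrightarrow> fst p \<in> obj A"
  by (cases p) (simp add: conv_cat_def)

context
  fixes p q :: "'o \<times> int" assumes p: "fst p \<in> obj A" and q: "fst q \<in> obj A"
begin

lemma conv_num_eq: "conv_num A I p q = num p q"
  using J_nonpos[OF p q] by (cases p; cases q) (auto simp: conv_num_def num_def J_def)

lemma conv_den_eq: "conv_den A N I p q = den p q"
  using J_nonpos[OF p q] J_ge_N[OF p q]
  by (cases p; cases q) (auto simp: conv_den_def den_def J_def algebra_simps)

lemma num_submodule: "submodule (num p q) K (mor A (fst p) (fst q))"
  unfolding num_def by (rule J_submodule[OF p q])

lemma den_submodule: "submodule (den p q) K (mor A (fst p) (fst q))"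
  unfolding den_def by (rule J_submodule[OF p q])

lemma den_num: "den p q \<subseteq> num p q"
  unfolding num_def den_def by (rule J_antimono[OF p q]) simp

lemma num_carrier: "f \<in> num p q \<Longrightarrow> f \<in> carrier (mor A (fst p) (fst q))"
  unfolding num_def by (rule J_carrier[OF p q])

lemma rep_module: "module K (rep p q)"
  unfolding rep_def by (rule submodule.submodule_is_module[OF num_submodule mor_module[OF p q]])

lemma rep_simps:
  "carrier (rep p q) = num p q" "\<zero>\<^bsub>rep p q\<^esub> = \<zero>\<^bsub>mor A (fst p) (fst q)\<^esub>"
  "f \<oplus>\<^bsub>rep p q\<^esub> g = f \<oplus>\<^bsub>mor A (fst p) (fst q)\<^esub> g" "c \<odot>\<^bsub>rep p q\<^esub> f = c \<odot>\<^bsub>mor A (fst p) (fst q)\<^esub> f"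
  by (simp_all add: rep_def)

lemma den_sub_rep: "submodule (den p q) K (rep p q)"
  unfolding rep_def using submodule_restrict_iff[OF mor_module[OF p q] num_submodule] den_submodule den_num
  by blast

lemma mor_CC: "mor CC p q = quot_space (rep p q) (den p q)"
  by (simp add: conv_cat_def conv_num_eq conv_den_eq rep_def)

lemma cls_rep: "cls p q f = den p q +>\<^bsub>rep p q\<^esub> f"
  by (simp add: cls_def rep_def)

lemma mor_CC_carrier: "carrier (mor CC p q) = cls p q ` num p q"
  by (auto simp: mor_CC quot_space_carrier rep_simps cls_rep)

lemma mor_CC_module: "module K (mor CC p q)"
  unfolding mor_CC by (rule quot_space_module[OF rep_module den_sub_rep])

lemma cls_linear: "linear_hom K (rep p q) (mor CC p q) (cls p q)"
  using quot_space_linear_hom[OF rep_module den_sub_rep]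
  by (simp add: mor_CC cls_rep[abs_def])

lemma cls_closed: "f \<in> num p q \<Longrightarrow> cls p q f \<in> carrier (mor CC p q)"
  by (simp add: mor_CC_carrier)

lemma cls_zero_iff: "f \<in> num p q \<Longrightarrow> cls p q f = \<zero>\<^bsub>mor CC p q\<^esub> \<longleftrightarrow> f \<in> den p q"
  unfolding mor_CC quot_space_zero cls_rep
  by (rule coset_zero_iff[OF rep_module den_sub_rep]) (simp add: rep_simps)

lemma cls_minus:
  assumes "f \<in> num p q" "g \<in> num p q"
  shows "cls p q (f \<ominus>\<^bsub>mor A (fst p) (fst q)\<^esub> g) = cls p q f \<ominus>\<^bsub>mor CC p q\<^esub> cls p q g"
proof -
  have "f \<ominus>\<^bsub>rep p q\<^esub> g = f \<ominus>\<^bsub>mor A (fst p) (fst q)\<^esub> g"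
  proof -
    interpret R: module K "rep p q" by (rule rep_module)
    interpret M: module K "mor A (fst p) (fst q)" by (rule mor_module[OF p q])
    have d: "f \<ominus>\<^bsub>mor A (fst p) (fst q)\<^esub> g \<in> num p q"
      by (rule submodule_minus[OF mor_module[OF p q] num_submodule assms])
    have "(f \<ominus>\<^bsub>mor A (fst p) (fst q)\<^esub> g) \<oplus>\<^bsub>rep p q\<^esub> g = f"
      using M.minus_add_cancel(1)[of f g] assms num_carrier by (simp add: rep_simps)
    thus ?thesis using R.minus_add_cancel(3)[of "f \<ominus>\<^bsub>mor A (fst p) (fst q)\<^esub> g" g] d assms
      by (simp add: rep_simps)
  qed
  thus ?thesis using linear_hom_minus[OF rep_module mor_CC_module cls_linear, of f g] assms
    by (simp add: rep_simps)
qed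

lemma cls_mem_iff:
  assumes G: "submodule G K (mor A (fst p) (fst q))" "den p q \<subseteq> G" "G \<subseteq> num p q" and f: "f \<in> num p q"
  shows "cls p q f \<in> cls p q ` G \<longleftrightarrow> f \<in> G"
proof
  interpret M: module K "mor A (fst p) (fst q)" by (rule mor_module[OF p q])
  assume "cls p q f \<in> cls p q ` G"
  then obtain g where g: "g \<in> G" "cls p q f = cls p q g" by blast
  have gn: "g \<in> num p q" using g(1) G(3) by blast
  have "f \<ominus>\<^bsub>mor A (fst p) (fst q)\<^esub> g \<in> den p q"
    using g(2) coset_eq_iff[OF mor_module[OF p q] den_submodule num_carrier[OF f] num_carrier[OF gn]]
    by (simp add: cls_def)
  hence "f \<ominus>\<^bsub>mor A (fst p) (fst q)\<^esub> g \<in> G" using G(2) by blast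
  from submodule_add[OF mor_module[OF p q] G(1) this g(1)]
  show "f \<in> G" using M.minus_add_cancel(1)[OF num_carrier[OF f] num_carrier[OF gn]] by simp
qed simp

end

lemma num_comp:
  assumes "fst p \<in> obj A" "fst q \<in> obj A" "fst r \<in> obj A" "f \<in> num p q" "g \<in> num q r"
  shows "comp A (fst p) (fst q) (fst r) g f \<in> num p r"
  using J_mult[OF assms(1-3), of f "snd q - snd p" g "snd r - snd q" "snd r - snd p"] assms(4,5)
  by (simp add: num_def)

lemma den_comp_right:
  assumes "fst p \<in> obj A" "fst q \<in> obj A" "fst r \<in> obj A" "f \<in> den p q" "g \<in> num q r"
  shows "comp A (fst p) (fst q) (fst r) g f \<in> den p r"
  using J_mult[OF assms(1-3), of f "snd q - snd p + int N" g "snd r - snd q" "snd r - snd p + int N"] assms(4,5)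
  by (simp add: num_def den_def)

lemma den_comp_left:
  assumes "fst p \<in> obj A" "fst q \<in> obj A" "fst r \<in> obj A" "f \<in> num p q" "g \<in> den q r"
  shows "comp A (fst p) (fst q) (fst r) g f \<in> den p r"
  using J_mult[OF assms(1-3), of f "snd q - snd p" g "snd r - snd q + int N" "snd r - snd p + int N"] assms(4,5)
  by (simp add: num_def den_def)

lemma comp_rep_right:
  assumes "fst p \<in> obj A" "fst q \<in> obj A" "fst r \<in> obj A" "g \<in> num q r"
  shows "linear_hom K (rep p q) (rep p r) (\<lambda>f. comp A (fst p) (fst q) (fst r) g f)"
  unfolding rep_def
  by (rule linear_hom_restrict[OF mor_module num_submodule comp_linear_right])
    (use assms num_carrier[OF assms(2,3)] num_comp in auto)

lemma comp_rep_left: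
  assumes "fst p \<in> obj A" "fst q \<in> obj A" "fst r \<in> obj A" "f \<in> num p q"
  shows "linear_hom K (rep q r) (rep p r) (\<lambda>g. comp A (fst p) (fst q) (fst r) g f)"
  unfolding rep_def
  by (rule linear_hom_restrict[OF mor_module num_submodule comp_linear_left])
    (use assms num_carrier[OF assms(1,2)] num_comp in auto)

text \<open>The double union of cosets in the composition collapses to the coset of the composite.  The target \<open>D\<close> is
  arbitrary because the same union also defines the action on the entry modules.\<close>

lemma UN_UN_coset:
  assumes o: "fst p \<in> obj A" "fst q \<in> obj A" "z \<in> obj A" "x \<in> obj A"
    and D: "submodule D K (mor A x z)"
    and W: "submodule W K (mor A x (fst p))" and U: "submodule U K (mor A x (fst p))" "W \<subseteq> U"
    and absorb: "\<And>g f. g \<in> num p q \<Longrightarrow> f \<in> W \<Longrightarrow> comp A x (fst p) z g f \<in> D"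
      "\<And>g f. g \<in> den p q \<Longrightarrow> f \<in> U \<Longrightarrow> comp A x (fst p) z g f \<in> D"
    and z: "z = fst q" and f: "f \<in> U" and g: "g \<in> num p q"
  shows "(\<Union>g'\<in>cls p q g. \<Union>f'\<in>(W +>\<^bsub>mor A x (fst p)\<^esub> f). D +>\<^bsub>mor A x z\<^esub> comp A x (fst p) z g' f') =
    D +>\<^bsub>mor A x z\<^esub> comp A x (fst p) z g f"
proof -
  note U' = submodule.submodule_is_module[OF U(1) mor_module[OF o(4,1)]]
  have WU: "submodule W K ((mor A x (fst p))\<lparr>carrier := U\<rparr>)"
    using submodule_restrict_iff[OF mor_module[OF o(4,1)] U(1)] W U(2) by blast
  have fc: "f \<in> carrier (mor A x (fst p))" using f submodule_subset[OF mor_module[OF o(4,1)] U(1)] by blast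
  have inner: "(\<Union>f'\<in>(W +>\<^bsub>mor A x (fst p)\<^esub> f). D +>\<^bsub>mor A x z\<^esub> comp A x (fst p) z g' f') =
      D +>\<^bsub>mor A x z\<^esub> comp A x (fst p) z g' f" if g': "g' \<in> num p q" for g'
    using UN_coset_linear[OF U' WU mor_module[OF o(4,3)] D
        linear_hom_subset[OF mor_module[OF o(4,1)] U(1) comp_linear_right[OF o(4,1,3)]], of g' f]
      absorb(1)[OF g'] num_carrier[OF o(1,2) g'] f z by simp
  have "(\<Union>g'\<in>cls p q g. \<Union>f'\<in>(W +>\<^bsub>mor A x (fst p)\<^esub> f). D +>\<^bsub>mor A x z\<^esub> comp A x (fst p) z g' f') =
      (\<Union>g'\<in>cls p q g. D +>\<^bsub>mor A x z\<^esub> comp A x (fst p) z g' f)"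
  proof (rule SUP_cong[OF refl inner])
    fix g' assume "g' \<in> cls p q g"
    thus "g' \<in> num p q"
      using mem_coset_iff[OF rep_module[OF o(1,2)] den_sub_rep[OF o(1,2)], of g g'] g
      by (simp add: cls_rep[OF o(1,2)] rep_simps[OF o(1,2)])
  qed
  also have "\<dots> = D +>\<^bsub>mor A x z\<^esub> comp A x (fst p) z g f"
    unfolding cls_rep[OF o(1,2)]
  proof (rule UN_coset_linear[OF rep_module[OF o(1,2)] den_sub_rep[OF o(1,2)] mor_module[OF o(4,3)] D])
    show "linear_hom K (rep p q) (mor A x z) (\<lambda>g. comp A x (fst p) z g f)"
      unfolding rep_def z
      by (rule linear_hom_subset[OF mor_module[OF o(1,2)] num_submodule[OF o(1,2)] comp_linear_left[OF o(4,1,2) fc]])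
    show "g \<in> carrier (rep p q)" using g by (simp add: rep_simps[OF o(1,2)])
  qed (use absorb(2) f in simp)
  finally show ?thesis .
qed

lemma comp_CC:
  assumes o: "fst p \<in> obj A" "fst q \<in> obj A" "fst r \<in> obj A" and f: "f \<in> num p q" and g: "g \<in> num q r"
  shows "comp CC p q r (cls q r g) (cls p q f) = cls p r (comp A (fst p) (fst q) (fst r) g f)"
proof -
  have "(\<Union>g'\<in>cls q r g. \<Union>f'\<in>(den p q +>\<^bsub>mor A (fst p) (fst q)\<^esub> f). den p r +>\<^bsub>mor A (fst p) (fst r)\<^esub> comp A (fst p) (fst q) (fst r) g' f') =
    den p r +>\<^bsub>mor A (fst p) (fst r)\<^esub> comp A (fst p) (fst q) (fst r) g f"
    by (rule UN_UN_coset[OF o(2,3,3,1) den_submodule[OF o(1,3)] den_submodule[OF o(1,2)]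
          num_submodule[OF o(1,2)] den_num[OF o(1,2)] den_comp_right[OF o] den_comp_left[OF o] refl f g]) assumption+
  thus ?thesis by (simp add: conv_cat_def conv_den_eq[OF o(1,3)] cls_def)
qed

lemma idm_CC: "fst p \<in> obj A \<Longrightarrow> idm CC p = cls p p (idm A (fst p))"
  by (simp add: conv_cat_def conv_den_eq cls_def)

lemma idm_num: "fst p \<in> obj A \<Longrightarrow> idm A (fst p) \<in> num p p"
  by (simp add: num_def idm_J)

text \<open>Every axiom is inherited from \<open>A\<close> through the surjective class maps.\<close>

lemma conv_cat_linear_category: "linear_category K CC"
proof (intro linear_category.intro linear_category_axioms.intro)
  show "field K" by (rule K.field_axioms)
next
  fix x y assume "x \<in> obj CC" "y \<in> obj CC"
  thus "module K (mor CC x y)" using mor_CC_module by simp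
next
  fix x y z g assume o: "x \<in> obj CC" "y \<in> obj CC" "z \<in> obj CC" and g: "g \<in> carrier (mor CC y z)"
  hence o': "fst x \<in> obj A" "fst y \<in> obj A" "fst z \<in> obj A" by auto
  obtain g0 where g0: "g0 \<in> num y z" "g = cls y z g0" using g o' by (auto simp: mor_CC_carrier)
  show "linear_hom K (mor CC x y) (mor CC x z) (\<lambda>f. comp CC x y z g f)"
  proof (rule linear_hom_from_surj[OF rep_module[OF o'(1,2)] cls_linear[OF o'(1,2)]])
    show "cls x y ` carrier (rep x y) = carrier (mor CC x y)" using o' by (simp add: rep_simps mor_CC_carrier)
    show "linear_hom K (rep x y) (mor CC x z) (\<lambda>f. comp CC x y z g (cls x y f))"
      by (rule linear_hom_cong[OF rep_module[OF o'(1,2)] linear_hom_comp[OF comp_rep_right[OF o' g0(1)] cls_linear[OF o'(1,3)]]])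
        (use o' g0 in \<open>simp add: rep_simps comp_CC\<close>)
  qed
next
  fix x y z f assume o: "x \<in> obj CC" "y \<in> obj CC" "z \<in> obj CC" and f: "f \<in> carrier (mor CC x y)"
  hence o': "fst x \<in> obj A" "fst y \<in> obj A" "fst z \<in> obj A" by auto
  obtain f0 where f0: "f0 \<in> num x y" "f = cls x y f0" using f o' by (auto simp: mor_CC_carrier)
  show "linear_hom K (mor CC y z) (mor CC x z) (\<lambda>g. comp CC x y z g f)"
  proof (rule linear_hom_from_surj[OF rep_module[OF o'(2,3)] cls_linear[OF o'(2,3)]])
    show "cls y z ` carrier (rep y z) = carrier (mor CC y z)" using o' by (simp add: rep_simps mor_CC_carrier)
    show "linear_hom K (rep y z) (mor CC x z) (\<lambda>g. comp CC x y z (cls y z g) f)"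
      by (rule linear_hom_cong[OF rep_module[OF o'(2,3)] linear_hom_comp[OF comp_rep_left[OF o' f0(1)] cls_linear[OF o'(1,3)]]])
        (use o' f0 in \<open>simp add: rep_simps comp_CC\<close>)
  qed
next
  fix w x y z f g h
  assume o: "w \<in> obj CC" "x \<in> obj CC" "y \<in> obj CC" "z \<in> obj CC" and f: "f \<in> carrier (mor CC w x)"
    and g: "g \<in> carrier (mor CC x y)" and h: "h \<in> carrier (mor CC y z)"
  hence o': "fst w \<in> obj A" "fst x \<in> obj A" "fst y \<in> obj A" "fst z \<in> obj A" by auto
  obtain f0 where f0: "f0 \<in> num w x" "f = cls w x f0" using f o' by (auto simp: mor_CC_carrier)
  obtain g0 where g0: "g0 \<in> num x y" "g = cls x y g0" using g o' by (auto simp: mor_CC_carrier)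
  obtain h0 where h0: "h0 \<in> num y z" "h = cls y z h0" using h o' by (auto simp: mor_CC_carrier)
  show "comp CC w y z h (comp CC w x y g f) = comp CC w x z (comp CC x y z h g) f"
    unfolding f0(2) g0(2) h0(2)
      comp_CC[OF o'(1,2,3) f0(1) g0(1)] comp_CC[OF o'(2,3,4) g0(1) h0(1)]
      comp_CC[OF o'(1,3,4) num_comp[OF o'(1,2,3) f0(1) g0(1)] h0(1)]
      comp_CC[OF o'(1,2,4) f0(1) num_comp[OF o'(2,3,4) g0(1) h0(1)]]
    using comp_assoc[OF o' num_carrier[OF o'(1,2) f0(1)] num_carrier[OF o'(2,3) g0(1)] num_carrier[OF o'(3,4) h0(1)]]
    by simp
next
  fix x assume "x \<in> obj CC"
  thus "idm CC x \<in> carrier (mor CC x x)" by (simp add: idm_CC cls_closed idm_num)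
next
  fix x y f assume o: "x \<in> obj CC" "y \<in> obj CC" and f: "f \<in> carrier (mor CC x y)"
  hence o': "fst x \<in> obj A" "fst y \<in> obj A" by auto
  obtain f0 where f0: "f0 \<in> num x y" "f = cls x y f0" using f o' by (auto simp: mor_CC_carrier)
  show "comp CC x x y f (idm CC x) = f"
    using comp_CC[OF o'(1,1,2) idm_num[OF o'(1)] f0(1)] comp_idm_right[OF o' num_carrier[OF o' f0(1)]]
    by (simp add: idm_CC o' f0(2))
  show "comp CC x y y (idm CC y) f = f"
    using comp_CC[OF o'(1,2,2) f0(1) idm_num[OF o'(2)]] comp_idm_left[OF o' num_carrier[OF o' f0(1)]]
    by (simp add: idm_CC o' f0(2))
qed

end


section \<open>Standard modules of the associated category\<close>

context filtered_category
begin

interpretation CC: linear_category K CC by (rule conv_cat_linear_category)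

text \<open>Submodules of the projective at \<open>l\<close>, described by representatives.  The denominators are required to be contained
  in the family so that membership of a class does not depend on the representative (\<open>cls_mem_iff\<close>).\<close>

definition rep_family :: "'o \<times> int \<Rightarrow> ('o \<times> int \<Rightarrow> 'm set) \<Rightarrow> bool" where
  "rep_family l T \<longleftrightarrow>
     (\<forall>q. fst q \<in> obj A \<longrightarrow> submodule (T q) K (mor A (fst l) (fst q)) \<and> den l q \<subseteq> T q \<and> T q \<subseteq> num l q) \<and>
     (\<forall>q r f g. fst q \<in> obj A \<longrightarrow> fst r \<in> obj A \<longrightarrow> f \<in> T q \<longrightarrow> g \<in> num q r \<longrightarrow>
        comp A (fst l) (fst q) (fst r) g f \<in> T r)"

definition class_family :: "'o \<times> int \<Rightarrow> ('o \<times> int \<Rightarrow> 'm set) \<Rightarrow> 'o \<times> int \<Rightarrow> 'm set set" where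
  "class_family l T q = cls l q ` T q"

lemma rep_familyD:
  assumes "rep_family l T"
  shows "\<And>q. fst q \<in> obj A \<Longrightarrow> submodule (T q) K (mor A (fst l) (fst q))"
    "\<And>q. fst q \<in> obj A \<Longrightarrow> den l q \<subseteq> T q" "\<And>q. fst q \<in> obj A \<Longrightarrow> T q \<subseteq> num l q"
    "\<And>q r f g. fst q \<in> obj A \<Longrightarrow> fst r \<in> obj A \<Longrightarrow> f \<in> T q \<Longrightarrow> g \<in> num q r \<Longrightarrow>
        comp A (fst l) (fst q) (fst r) g f \<in> T r"
  using assms unfolding rep_family_def by blast+

lemma cls_mem_class_family:
  assumes "fst l \<in> obj A" "fst q \<in> obj A" "rep_family l T" "f \<in> num l q"
  shows "cls l q f \<in> class_family l T q \<longleftrightarrow> f \<in> T q"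
  unfolding class_family_def using cls_mem_iff[OF assms(1,2) rep_familyD(1,2,3)[OF assms(3,2)] assms(4)] .

lemma class_family_sub:
  assumes l: "fst l \<in> obj A" and T: "rep_family l T"
  shows "catmod_sub K CC (projective CC l) (class_family l T)"
  unfolding catmod_sub_def
proof (intro conjI ballI)
  fix q assume "q \<in> obj CC"
  hence q: "fst q \<in> obj A" by simp
  have "submodule (T q) K (rep l q)" unfolding rep_def
    using submodule_restrict_iff[OF mor_module[OF l q] num_submodule[OF l q]] rep_familyD[OF T] q by blast
  from linear_hom_image_submodule[OF rep_module[OF l q] mor_CC_module[OF l q] cls_linear[OF l q] this]
  show "submodule (class_family l T q) K (val (projective CC l) q)" by (simp add: class_family_def)
next
  fix q r g v assume "q \<in> obj CC" "r \<in> obj CC"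
  hence q: "fst q \<in> obj A" and r: "fst r \<in> obj A" by auto
  assume "g \<in> carrier (mor CC q r)" "v \<in> class_family l T q"
  then obtain g0 f where g0: "g0 \<in> num q r" "g = cls q r g0" and f: "f \<in> T q" "v = cls l q f"
    using q r by (auto simp: mor_CC_carrier class_family_def)
  have fn: "f \<in> num l q" using rep_familyD(3)[OF T q] f(1) by blast
  show "act (projective CC l) q r g v \<in> class_family l T r"
    using rep_familyD(4)[OF T q r f(1) g0(1)] comp_CC[OF l q r fn g0(1)]
    by (simp add: class_family_def g0(2) f(2))
qed

text \<open>Families that depend only on the difference \<open>d\<close> of the shifts, through the level \<open>\<phi> d\<close>.\<close>

definition level :: "(int \<Rightarrow> int) \<Rightarrow> 'o \<times> int \<Rightarrow> 'o \<times> int \<Rightarrow> 'm set" where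
  "level \<phi> l q = J (\<phi> (snd q - snd l)) (fst l) (fst q)"

text \<open>The last condition on \<open>\<phi>\<close> combines closure under morphisms that raise the row, which multiply by \<open>I\<^sub>e\<close>, with
  monotonicity, which is closure under those that lower it.\<close>

lemma level_rep_family:
  assumes l: "fst l \<in> obj A" and \<phi>: "\<And>d. d \<le> \<phi> d" "\<And>d. \<phi> d \<le> d + int N"
    and \<phi>': "\<And>d e. \<phi> (d + e) \<le> \<phi> d + max e 0"
  shows "rep_family l (level \<phi> l)"
  unfolding rep_family_def
proof (intro conjI allI impI)
  fix q :: "'o \<times> int" assume q: "fst q \<in> obj A"
  show "submodule (level \<phi> l q) K (mor A (fst l) (fst q))" unfolding level_def by (rule J_submodule[OF l q])
  show "den l q \<subseteq> level \<phi> l q" "level \<phi> l q \<subseteq> num l q"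
    unfolding level_def den_def num_def by (rule J_antimono[OF l q], rule \<phi>)+
next
  fix q r :: "'o \<times> int" and f g assume "fst q \<in> obj A" "fst r \<in> obj A" "f \<in> level \<phi> l q" "g \<in> num q r"
  thus "comp A (fst l) (fst q) (fst r) g f \<in> level \<phi> l r"
    unfolding level_def num_def
    using J_mult[OF l, of "fst q" "fst r" f _ g _ "\<phi> (snd r - snd l)"] \<phi>'[of "snd q - snd l" "snd r - snd q"]
    by simp
qed

text \<open>The levels of the two traces.  The formula for the first order unifies three cases: all of \<open>I\<^sub>d\<close> for \<open>d > 0\<close>, the
  ideal \<open>I\<^sub>1\<close> for \<open>-N < d \<le> 0\<close>, and nothing modulo \<open>I\<^bsub>d+N\<^esub>\<close> below.\<close>

definition first_level :: "int \<Rightarrow> int" where "first_level d = max d (min 1 (d + int N))"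
definition second_level :: "int \<Rightarrow> int" where "second_level d = d + 1"

lemma first_level_family: "fst l \<in> obj A \<Longrightarrow> rep_family l (level first_level l)"
  by (rule level_rep_family) (auto simp: first_level_def)

lemma second_level_family: "fst l \<in> obj A \<Longrightarrow> 0 < N \<Longrightarrow> rep_family l (level second_level l)"
  by (rule level_rep_family) (auto simp: second_level_def)

text \<open>A morphism to a larger object \<open>m\<close> lies in \<open>I\<^sub>1\<close>.  Conversely, for \<open>d \<le> 0\<close> an element of \<open>I\<^sub>1\<close> factors as a
  morphism into row \<open>i + 1\<close> followed by an identity of \<open>A\<close>, and for \<open>d > 0\<close> every morphism factors through its own
  target.\<close>

lemma first_trace:
  assumes l: "fst l \<in> obj A" and q: "fst q \<in> obj A"
  shows "standard_trace K CC first_order l q = class_family l (level first_level l) q"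
proof (rule CC.standard_trace_eqI[OF _ class_family_sub[OF l first_level_family[OF l]]])
  show "l \<in> obj CC" "q \<in> obj CC" using l q by auto
next
  fix m a assume m: "m \<in> obj CC" "first_order l m" and a: "a \<in> carrier (mor CC l m)"
  then obtain f where f: "f \<in> num l m" "a = cls l m f" using l by (auto simp: mor_CC_carrier)
  have "f \<in> level first_level l m" using f(1) m(2) by (auto simp: num_def level_def first_level_def first_order_def)
  thus "a \<in> class_family l (level first_level l) m" by (simp add: class_family_def f(2))
next
  fix q v assume "q \<in> obj CC" and v: "v \<in> class_family l (level first_level l) q"
  hence q: "fst q \<in> obj A" by simp
  obtain f where f: "f \<in> level first_level l q" "v = cls l q f" using v by (auto simp: class_family_def)
  have fn: "f \<in> num l q" using f(1) rep_familyD(3)[OF first_level_family[OF l] q] by blast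
  define d where "d = snd q - snd l"
  show "v = \<zero>\<^bsub>mor CC l q\<^esub> \<or> (\<exists>m a g. m \<in> obj CC \<and> first_order l m \<and> a \<in> carrier (mor CC l m) \<and>
      g \<in> carrier (mor CC m q) \<and> v = comp CC l m q g a)"
  proof (cases "d \<le> 0")
    case True
    show ?thesis
    proof (cases "d + int N \<le> 0")
      case True
      hence "f \<in> den l q" using f(1) by (simp add: level_def first_level_def den_def d_def)
      thus ?thesis using f(2) cls_zero_iff[OF l q fn] by simp
    next
      case False
      \<comment> \<open>Here \<open>-N < d \<le> 0\<close>, so \<open>f \<in> I\<^sub>1\<close> is a morphism into row \<open>i + 1\<close>.\<close>
      let ?m = "(fst q, snd l + 1)"
      have f1: "f \<in> num l ?m" using f(1) False True by (simp add: level_def first_level_def num_def d_def)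
      have id: "idm A (fst q) \<in> num ?m q" using True q by (simp add: num_def d_def idm_J)
      have "v = comp CC l ?m q (cls ?m q (idm A (fst q))) (cls l ?m f)"
        using comp_CC[OF l _ q f1 id] q comp_idm_left[OF l q num_carrier[OF l q fn]] by (simp add: f(2))
      moreover have "cls l ?m f \<in> carrier (mor CC l ?m)" "cls ?m q (idm A (fst q)) \<in> carrier (mor CC ?m q)"
        using cls_closed[OF l _ f1] cls_closed[OF _ q id] q by auto
      moreover have "?m \<in> obj CC" "first_order l ?m" using q by (auto simp: first_order_def)
      ultimately show ?thesis by blast
    qed
  next
    case False
    have "v = comp CC l q q (cls q q (idm A (fst q))) v"
      using CC.comp_idm_left[of l q v] cls_closed[OF l q fn] l q by (simp add: f(2) idm_CC)
    moreover have "first_order l q" using False by (simp add: first_order_def d_def)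
    moreover have "v \<in> carrier (mor CC l q)" using cls_closed[OF l q fn] by (simp add: f(2))
    moreover have "cls q q (idm A (fst q)) \<in> carrier (mor CC q q)" by (rule cls_closed[OF q q idm_num[OF q]])
    moreover have "q \<in> obj CC" using q by simp
    ultimately show ?thesis by blast
  qed
qed

text \<open>All of \<open>I\<^bsub>d+1\<^esub>\<close> factors through the identity of \<open>A\<close>, viewed as a morphism from \<open>x[i]\<close> to \<open>x[i-1]\<close>.\<close>

lemma second_trace:
  assumes l: "fst l \<in> obj A" and q: "fst q \<in> obj A" and N: "0 < N"
  shows "standard_trace K CC second_order l q = class_family l (level second_level l) q"
proof (rule CC.standard_trace_eqI[OF _ class_family_sub[OF l second_level_family[OF l N]]])
  show "l \<in> obj CC" "q \<in> obj CC" using l q by auto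
next
  fix m a assume m: "m \<in> obj CC" "second_order l m" and a: "a \<in> carrier (mor CC l m)"
  then obtain f where f: "f \<in> num l m" "a = cls l m f" using l by (auto simp: mor_CC_carrier)
  have "f \<in> level second_level l m"
    using num_carrier[OF l _ f(1)] m l by (simp add: level_def second_level_def second_order_def J_nonpos)
  thus "a \<in> class_family l (level second_level l) m" by (simp add: class_family_def f(2))
next
  fix q v assume "q \<in> obj CC" and v: "v \<in> class_family l (level second_level l) q"
  hence q: "fst q \<in> obj A" by simp
  obtain f where f: "f \<in> level second_level l q" "v = cls l q f" using v by (auto simp: class_family_def)
  have fn: "f \<in> num l q" using f(1) rep_familyD(3)[OF second_level_family[OF l N] q] by blast
  \<comment> \<open>The object \<open>x[i-1]\<close>, which is larger than \<open>x[i]\<close> in the second order.\<close>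
  let ?m = "(fst l, snd l - 1)"
  have f1: "f \<in> num ?m q" using f(1) by (simp add: level_def second_level_def num_def algebra_simps)
  have id: "idm A (fst l) \<in> num l ?m" using l by (simp add: num_def idm_J)
  have "v = comp CC l ?m q (cls ?m q f) (cls l ?m (idm A (fst l)))"
    using comp_CC[OF l _ q id f1] l comp_idm_right[OF l q num_carrier[OF l q fn]] by (simp add: f(2))
  moreover have "cls l ?m (idm A (fst l)) \<in> carrier (mor CC l ?m)" "cls ?m q f \<in> carrier (mor CC ?m q)"
    using cls_closed[OF l _ id] cls_closed[OF _ q f1] l by auto
  moreover have "?m \<in> obj CC" "second_order l ?m" using l by (auto simp: second_order_def)
  ultimately show "v = \<zero>\<^bsub>mor CC l q\<^esub> \<or> (\<exists>m a g. m \<in> obj CC \<and> second_order l m \<and> a \<in> carrier (mor CC l m) \<and>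
      g \<in> carrier (mor CC m q) \<and> v = comp CC l m q g a)" by blast
qed

lemma entry_val: "val (entry_module A S U D x) q =
  (if snd q \<in> S then quot_space ((mor A x (fst q))\<lparr>carrier := U (snd q) x (fst q)\<rparr>) (D (snd q) x (fst q))
   else quot_space ((mor A x (fst q))\<lparr>carrier := {\<zero>\<^bsub>mor A x (fst q)\<^esub>}\<rparr>) {\<zero>\<^bsub>mor A x (fst q)\<^esub>})"
  by (cases q) (simp add: entry_module_def)

lemma entry_act: "act (entry_module A S U D x) q r G Y =
  (if snd r \<notin> S then {\<zero>\<^bsub>mor A x (fst r)\<^esub>} else if snd q \<notin> S then D (snd r) x (fst r)
   else \<Union>g\<in>G. \<Union>f\<in>Y. D (snd r) x (fst r) +>\<^bsub>mor A x (fst r)\<^esub> comp A x (fst q) (fst r) g f)"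
  by (cases q; cases r) (simp add: entry_module_def)

text \<open>Both modules are presented by the numerators at \<open>l\<close> with relations \<open>T\<close>.  Outside \<open>S\<close> the family \<open>T\<close> is the whole
  numerator, so both sides vanish there.\<close>

lemma standard_entry_iso:
  assumes x: "x \<in> obj A" and T: "rep_family (x, i) T"
    and trace: "\<And>q. fst q \<in> obj A \<Longrightarrow> standard_trace K CC lt (x, i) q = class_family (x, i) T q"
    and inS: "\<And>z k. z \<in> obj A \<Longrightarrow> k \<in> S \<Longrightarrow> U k x z = num (x, i) (z, k) \<and> D k x z = T (z, k)"
    and outS: "\<And>z k. z \<in> obj A \<Longrightarrow> k \<notin> S \<Longrightarrow> T (z, k) = num (x, i) (z, k)"
  shows "catmod_iso K CC (standard K CC lt (x, i)) (entry_module A S U D x)"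
proof -
  let ?l = "(x, i)" and ?E = "entry_module A S U D x"
  have l: "fst ?l \<in> obj A" and lC: "?l \<in> obj CC" using x by auto
  note tr_sub = CC.standard_trace_sub[OF lC, of lt]
  note P = CC.projective_left_module[OF lC]
  have stdm: "left_module K CC (standard K CC lt ?l)"
    unfolding standard_def by (rule catmod_quot_left_module[OF conv_cat_linear_category P tr_sub])
  have stdval: "val (standard K CC lt ?l) q = quot_space (mor CC ?l q) (standard_trace K CC lt ?l q)" for q
    by (simp add: standard_def catmod_quot_val)
  have inS': "U (snd q) x (fst q) = num ?l q" "D (snd q) x (fst q) = T q" if "fst q \<in> obj A" "snd q \<in> S" for q
    using inS[OF that] by (auto simp del: split_paired_All)
  have outS': "T q = num ?l q" if "fst q \<in> obj A" "snd q \<notin> S" for q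
    using outS[OF that] by simp
  let ?Z = "\<lambda>q. {\<zero>\<^bsub>mor A x (fst q)\<^esub>}"
  have valIn: "val ?E q = quot_space (rep ?l q) (T q)" if "fst q \<in> obj A" "snd q \<in> S" for q
    using that inS'[OF that] by (simp add: entry_val rep_def)
  have valOut: "val ?E q = quot_space ((mor A x (fst q))\<lparr>carrier := ?Z q\<rparr>) (?Z q)"
    if "snd q \<notin> S" for q
    using that by (simp add: entry_val)
  have Tsub: "submodule (T q) K (rep ?l q)" if q: "fst q \<in> obj A" for q
    unfolding rep_def
    using submodule_restrict_iff[OF mor_module[OF l q] num_submodule[OF l q]] rep_familyD[OF T] q by blast
  have trs: "submodule (standard_trace K CC lt ?l q) K (mor CC ?l q)" if "fst q \<in> obj A" for q
    using catmod_sub_submodule[OF tr_sub, of q] that by simp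
  have Zmod: "module K ((mor A x (fst q))\<lparr>carrier := ?Z q\<rparr>)" and Zsub: "submodule (?Z q) K ((mor A x (fst q))\<lparr>carrier := ?Z q\<rparr>)"
    if q: "fst q \<in> obj A" for q
  proof -
    note m = mor_module[OF x q]
    show z: "module K ((mor A x (fst q))\<lparr>carrier := ?Z q\<rparr>)"
      by (rule submodule.submodule_is_module[OF submodule_zero_space[OF m] m])
    show "submodule (?Z q) K ((mor A x (fst q))\<lparr>carrier := ?Z q\<rparr>)"
      using submodule_restrict_iff[OF m submodule_zero_space[OF m]] submodule_zero_space[OF m] by blast
  qed
  have Zcoset: "?Z q +>\<^bsub>mor A x (fst q)\<^esub> \<zero>\<^bsub>mor A x (fst q)\<^esub> = ?Z q" if q: "fst q \<in> obj A" for q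
    using coset_zero_iff[OF mor_module[OF x q] submodule_zero_space[OF mor_module[OF x q]], of "\<zero>\<^bsub>mor A x (fst q)\<^esub>"]
      submodule_zero[OF mor_module[OF x q] submodule_zero_space[OF mor_module[OF x q]]]
      submodule_zero[OF mor_module[OF x q] submodule_carrier[OF mor_module[OF x q]]] by simp
  define \<beta> where "\<beta> q f = (if snd q \<in> S then T q +>\<^bsub>mor A x (fst q)\<^esub> f else ?Z q)" for q f
  define \<alpha> where "\<alpha> q f = standard_trace K CC lt ?l q +>\<^bsub>mor CC ?l q\<^esub> cls ?l q f" for q f
  show ?thesis
  proof (rule common_presentation_iso[where Q = "rep ?l" and \<alpha> = \<alpha> and \<beta> = \<beta>, OF conv_cat_linear_category stdm])
    fix q assume "q \<in> obj CC"
    hence q: "fst q \<in> obj A" by simp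
    show Em: "module K (val ?E q)"
    proof (cases "snd q \<in> S")
      case True thus ?thesis using quot_space_module[OF rep_module[OF l q] Tsub[OF q]] by (simp add: valIn[OF q])
    next
      case False thus ?thesis using quot_space_module[OF Zmod[OF q] Zsub[OF q]] by (simp add: valOut)
    qed
    show "module K (rep ?l q)" by (rule rep_module[OF l q])
    show "linear_hom K (rep ?l q) (val (standard K CC lt ?l) q) (\<alpha> q)"
      unfolding \<alpha>_def[abs_def] stdval
      by (rule linear_hom_comp[OF cls_linear[OF l q] quot_space_linear_hom[OF mor_CC_module[OF l q] trs[OF q]]])
    show "\<alpha> q ` carrier (rep ?l q) = carrier (val (standard K CC lt ?l) q)"
      unfolding \<alpha>_def[abs_def] stdval quot_space_carrier mor_CC_carrier[OF l q] rep_simps[OF l q]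
      by (simp add: image_image)
    show "linear_hom K (rep ?l q) (val ?E q) (\<beta> q)"
    proof (cases "snd q \<in> S")
      case True
      thus ?thesis using quot_space_linear_hom[OF rep_module[OF l q] Tsub[OF q]]
        by (simp add: valIn[OF q] \<beta>_def[abs_def] rep_def)
    next
      case False
      interpret E: module K "val ?E q" by (rule Em)
      have "\<beta> q = (\<lambda>f. \<zero>\<^bsub>val ?E q\<^esub>)" using False by (auto simp: \<beta>_def valOut quot_space_zero)
      thus ?thesis by (simp add: linear_hom_def)
    qed
    show "\<beta> q ` carrier (rep ?l q) = carrier (val ?E q)"
    proof (cases "snd q \<in> S")
      case True
      thus ?thesis by (simp add: valIn[OF q] \<beta>_def[abs_def] quot_space_carrier rep_def)
    next
      case False
      have "num ?l q \<noteq> {}" using submodule_zero[OF mor_module[OF l q] num_submodule[OF l q]] by auto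
      thus ?thesis using False Zcoset[OF q] by (auto simp: valOut \<beta>_def[abs_def] quot_space_carrier rep_simps[OF l q])
    qed
    fix f assume "f \<in> carrier (rep ?l q)"
    hence f: "f \<in> num ?l q" by (simp add: rep_simps[OF l q])
    have "\<alpha> q f = \<zero>\<^bsub>val (standard K CC lt ?l) q\<^esub> \<longleftrightarrow> f \<in> T q"
      using coset_zero_iff[OF mor_CC_module[OF l q] trs[OF q] cls_closed[OF l q f]] cls_mem_class_family[OF l q T f] trace[OF q]
      by (simp add: \<alpha>_def stdval quot_space_zero)
    moreover have "\<beta> q f = \<zero>\<^bsub>val ?E q\<^esub> \<longleftrightarrow> f \<in> T q"
    proof (cases "snd q \<in> S")
      case True
      thus ?thesis
        using coset_zero_iff[OF mor_module[OF l q] rep_familyD(1)[OF T q] num_carrier[OF l q f]]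
        by (simp add: \<beta>_def valIn[OF q] quot_space_zero)
    next
      case False
      thus ?thesis using outS'[OF q False] f by (simp add: \<beta>_def valOut quot_space_zero)
    qed
    ultimately show "\<alpha> q f = \<zero>\<^bsub>val (standard K CC lt ?l) q\<^esub> \<longleftrightarrow> \<beta> q f = \<zero>\<^bsub>val ?E q\<^esub>" by simp
    fix r g assume rC: "r \<in> obj CC" and g: "g \<in> carrier (mor CC q r)"
    have r: "fst r \<in> obj A" using rC by simp
    obtain g0 where g0: "g0 \<in> num q r" "g = cls q r g0" using g by (auto simp: mor_CC_carrier[OF q r])
    define h where "h = comp A x (fst q) (fst r) g0 f"
    have h: "h \<in> num ?l r" using num_comp[OF l q r f g0(1)] by (simp add: h_def)
    have "\<alpha> r h = act (standard K CC lt ?l) q r g (\<alpha> q f)"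
      using catmod_quot_act[OF P tr_sub \<open>q \<in> obj CC\<close> rC g, of "cls ?l q f"] cls_closed[OF l q f]
        comp_CC[OF l q r f g0(1)] by (simp add: \<alpha>_def standard_def g0(2) h_def)
    moreover have "\<beta> r h = act ?E q r g (\<beta> q f)"
    proof (cases "snd r \<in> S \<and> snd q \<in> S")
      case True
      have "(\<Union>g'\<in>cls q r g0. \<Union>f'\<in>(T q +>\<^bsub>mor A x (fst q)\<^esub> f). T r +>\<^bsub>mor A x (fst r)\<^esub> comp A x (fst q) (fst r) g' f') =
          T r +>\<^bsub>mor A x (fst r)\<^esub> comp A x (fst q) (fst r) g0 f"
      proof (rule UN_UN_coset[OF q r r x, of "T r" "T q" "num ?l q"])
        show "submodule (T r) K (mor A x (fst r))" using rep_familyD(1)[OF T r] by simp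
        show "submodule (T q) K (mor A x (fst q))" using rep_familyD(1)[OF T q] by simp
        show "submodule (num ?l q) K (mor A x (fst q))" using num_submodule[OF l q] by simp
        show "T q \<subseteq> num ?l q" by (rule rep_familyD(3)[OF T q])
        show "comp A x (fst q) (fst r) g f \<in> T r" if "g \<in> num q r" "f \<in> T q" for g f
          using rep_familyD(4)[OF T q r that(2,1)] by simp
        show "comp A x (fst q) (fst r) g f \<in> T r" if "g \<in> den q r" "f \<in> num ?l q" for g f
          using den_comp_left[OF l q r that(2,1)] rep_familyD(2)[OF T r] by auto
      qed (use f g0 in auto)
      thus ?thesis using True inS'[OF r] by (simp add: \<beta>_def entry_act g0(2) h_def)
    next
      case False
      show ?thesis
      proof (cases "snd r \<in> S")
        case True
        hence "f \<in> T q" using False outS'[OF q] f by simp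
        hence "h \<in> T r" using rep_familyD(4)[OF T q r _ g0(1)] by (simp add: h_def)
        hence "T r +>\<^bsub>mor A x (fst r)\<^esub> h = T r"
          using coset_zero_iff[OF mor_module[OF l r] rep_familyD(1)[OF T r] num_carrier[OF l r h]] by simp
        thus ?thesis using True False inS'[OF r] by (simp add: \<beta>_def entry_act)
      qed (simp add: \<beta>_def entry_act)
    qed
    ultimately show "\<exists>q'\<in>carrier (rep ?l r). \<alpha> r q' = act (standard K CC lt ?l) q r g (\<alpha> q f) \<and>
        \<beta> r q' = act ?E q r g (\<beta> q f)" using h by (auto simp: rep_simps[OF l r])
  qed
qed

lemma first_standard_iso:
  assumes x: "x \<in> obj A"
  shows "catmod_iso K CC (standard K CC first_order (x, i)) (entry_1l A N I i x)"
  unfolding entry_1l_def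
proof (rule standard_entry_iso[OF x])
  show "rep_family (x, i) (level first_level (x, i))" by (rule first_level_family) (use x in simp)
  show "standard_trace K CC first_order (x, i) q = class_family (x, i) (level first_level (x, i)) q" if "fst q \<in> obj A" for q
    by (rule first_trace) (use x that in simp_all)
  fix z k assume z: "z \<in> obj A"
  show "carrier (mor A x z) = num (x, i) (z, k) \<and> I 1 x z = level first_level (x, i) (z, k)" if k: "k \<in> {j. i - int N < j \<and> j \<le> i}"
  proof
    show "carrier (mor A x z) = num (x, i) (z, k)" using k J_nonpos[OF x z, of "k - i"] by (simp add: num_def)
    have "first_level (k - i) = 1" using k by (auto simp: first_level_def)
    thus "I 1 x z = level first_level (x, i) (z, k)" by (simp add: level_def J_def)
  qed
  show "level first_level (x, i) (z, k) = num (x, i) (z, k)" if k: "k \<notin> {j. i - int N < j \<and> j \<le> i}"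
  proof (cases "k > i")
    case True
    hence "first_level (k - i) = k - i" by (simp add: first_level_def)
    thus ?thesis by (simp add: level_def num_def)
  next
    case False
    hence "first_level (k - i) \<le> 0" "k - i \<le> 0" using k by (auto simp: first_level_def)
    thus ?thesis using J_nonpos[OF x z] by (simp add: level_def num_def)
  qed
qed

lemma second_standard_iso:
  assumes x: "x \<in> obj A" and N: "0 < N"
  shows "catmod_iso K CC (standard K CC second_order (x, i)) (entry_2l A I i x)"
  unfolding entry_2l_def
proof (rule standard_entry_iso[OF x])
  show "rep_family (x, i) (level second_level (x, i))" by (rule second_level_family) (use x N in simp_all)
  show "standard_trace K CC second_order (x, i) q = class_family (x, i) (level second_level (x, i)) q" if "fst q \<in> obj A" for q
    by (rule second_trace) (use x that N in simp_all)
  fix z k assume z: "z \<in> obj A"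
  show "I (nat (k - i)) x z = num (x, i) (z, k) \<and> I (nat (k - i + 1)) x z = level second_level (x, i) (z, k)"
    by (simp add: num_def level_def second_level_def J_def)
  show "level second_level (x, i) (z, k) = num (x, i) (z, k)" if k: "k \<notin> {j. i \<le> j}"
    using k J_nonpos[OF x z] by (simp add: level_def num_def second_level_def)
qed

text \<open>For \<open>N = 0\<close> the filtration forces \<open>I\<^sub>0 = 0\<close>, so a nonzero identity excludes this case.\<close>

lemma N_pos_if_idm_nonzero: "x \<in> obj A \<Longrightarrow> idm A x \<noteq> \<zero>\<^bsub>mor A x x\<^esub> \<Longrightarrow> 0 < N"
  using I_zero[of x x] I_ge_N[of x x 0] idm_closed[of x] by (cases "N = 0") auto

text \<open>If the identity were in \<open>I\<^sub>1\<close>, its powers would put it in every \<open>I\<^sub>n\<close>, and \<open>I\<^sub>N = 0\<close>.\<close>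

lemma idm_not_in_I1:
  assumes x: "x \<in> obj A" and nz: "idm A x \<noteq> \<zero>\<^bsub>mor A x x\<^esub>"
  shows "idm A x \<notin> I 1 x x"
proof
  assume id: "idm A x \<in> I 1 x x"
  have "idm A x \<in> I n x x" for n
  proof (induction n)
    case 0 show ?case using I_zero[OF x x] idm_closed[OF x] by simp
  next
    case (Suc n)
    from I_mult[OF x x x Suc id] show ?case using comp_idm_left[OF x x idm_closed[OF x]] by simp
  qed
  from this[of N] show False using I_ge_N[OF x x order_refl] nz by simp
qed

text \<open>In both orders the trace at \<open>l\<close> itself is \<open>I\<^sub>1\<close>, so the standard module is one-dimensional there.\<close>

lemma end_standard:
  assumes l: "fst l \<in> obj A" and N: "0 < N" and nz: "idm A (fst l) \<noteq> \<zero>\<^bsub>mor A (fst l) (fst l)\<^esub>"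
    and scalar: "\<And>f. f \<in> carrier (mor A (fst l) (fst l)) \<Longrightarrow> \<exists>c\<in>carrier K.
      f \<ominus>\<^bsub>mor A (fst l) (fst l)\<^esub> c \<odot>\<^bsub>mor A (fst l) (fst l)\<^esub> idm A (fst l) \<in> I 1 (fst l) (fst l)"
    and T: "rep_family l T" and Tl: "T l = I 1 (fst l) (fst l)"
    and trace: "\<And>q. fst q \<in> obj A \<Longrightarrow> standard_trace K CC lt l q = class_family l T q"
  shows "end_is_ground_field K CC (standard K CC lt l)"
  unfolding standard_def
proof (rule CC.end_is_ground_field_quotient)
  show lC: "l \<in> obj CC" using l by simp
  show "catmod_sub K CC (projective CC l) (standard_trace K CC lt l)" by (rule CC.standard_trace_sub[OF lC])
  show "idm CC l \<notin> standard_trace K CC lt l l"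
    using cls_mem_class_family[OF l l T idm_num[OF l]] idm_not_in_I1[OF l nz] by (simp add: trace[OF l] idm_CC[OF l] Tl)
  fix F assume "F \<in> carrier (mor CC l l)"
  then obtain f where f: "f \<in> num l l" "F = cls l l f" by (auto simp: mor_CC_carrier[OF l l])
  obtain c where c: "c \<in> carrier K"
    "f \<ominus>\<^bsub>mor A (fst l) (fst l)\<^esub> c \<odot>\<^bsub>mor A (fst l) (fst l)\<^esub> idm A (fst l) \<in> T l"
    using scalar[OF num_carrier[OF l l f(1)]] Tl by auto
  have ci: "c \<odot>\<^bsub>mor A (fst l) (fst l)\<^esub> idm A (fst l) \<in> num l l"
    by (rule submodule_smult[OF mor_module[OF l l] num_submodule[OF l l] c(1) idm_num[OF l]])
  have "cls l l (c \<odot>\<^bsub>mor A (fst l) (fst l)\<^esub> idm A (fst l)) = c \<odot>\<^bsub>mor CC l l\<^esub> idm CC l"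
    using linear_hom_smult[OF cls_linear[OF l l] c(1), of "idm A (fst l)"] idm_num[OF l]
    by (simp add: rep_simps[OF l l] idm_CC[OF l])
  hence "F \<ominus>\<^bsub>mor CC l l\<^esub> c \<odot>\<^bsub>mor CC l l\<^esub> idm CC l \<in> class_family l T l"
    using cls_minus[OF l l f(1) ci] imageI[OF c(2), of "cls l l"] by (simp add: f(2) class_family_def)
  thus "\<exists>c\<in>carrier K. F \<ominus>\<^bsub>mor CC l l\<^esub> c \<odot>\<^bsub>mor CC l l\<^esub> idm CC l \<in> standard_trace K CC lt l l"
    using c(1) by (auto simp: trace[OF l])
qed

end


section \<open>Standard filtrations of the projectives\<close>

text \<open>The fact to which semisimplicity, basicness and algebraic closedness are reduced: \<open>A/I\<^sub>1\<close> is the ground field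
  on the diagonal and zero off it.  Apart from finite dimension these conditions are self-dual.\<close>

locale schurian_filtration = filtered_category K A N I
  for K :: "('k, 'c) ring_scheme" and A :: "('k, 'o, 'm) lincat" and N I +
  assumes idm_not_zero: "x \<in> obj A \<Longrightarrow> idm A x \<noteq> \<zero>\<^bsub>mor A x x\<^esub>"
    and I1_off_diagonal: "\<lbrakk>x \<in> obj A; y \<in> obj A; x \<noteq> y; f \<in> carrier (mor A x y)\<rbrakk> \<Longrightarrow> f \<in> I 1 x y"
    and I1_diagonal: "\<lbrakk>x \<in> obj A; f \<in> carrier (mor A x x)\<rbrakk> \<Longrightarrow>
      \<exists>c\<in>carrier K. f \<ominus>\<^bsub>mor A x x\<^esub> c \<odot>\<^bsub>mor A x x\<^esub> idm A x \<in> I 1 x x"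
    and fin_dim_projectives: "x \<in> obj A \<Longrightarrow> fin_dim K (dsum (obj A) (mor A x))"
begin

interpretation CC: linear_category K CC by (rule conv_cat_linear_category)

lemma N_pos: "x \<in> obj A \<Longrightarrow> 0 < N"
  using N_pos_if_idm_nonzero idm_not_zero by blast

lemma end_standard_first:
  assumes l: "fst l \<in> obj A"
  shows "end_is_ground_field K CC (standard K CC first_order l)"
  by (rule end_standard[OF l N_pos[OF l] idm_not_zero[OF l] I1_diagonal[OF l] first_level_family[OF l] _ first_trace[OF l]])
    (use N_pos[OF l] in \<open>simp_all add: level_def first_level_def J_def\<close>)

lemma end_standard_second:
  assumes l: "fst l \<in> obj A"
  shows "end_is_ground_field K CC (standard K CC second_order l)"
  by (rule end_standard[OF l N_pos[OF l] idm_not_zero[OF l] I1_diagonal[OF l] second_level_family[OF l N_pos[OF l]] _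
        second_trace[OF l _ N_pos[OF l]]])
    (simp_all add: level_def second_level_def J_def)

lemma den_family_zero:
  assumes l: "fst l \<in> obj A" and q: "fst q \<in> obj A" and T: "T q = den l q"
  shows "class_family l T q = {\<zero>\<^bsub>mor CC l q\<^esub>}"
proof -
  have "cls l q f = \<zero>\<^bsub>mor CC l q\<^esub>" if "f \<in> den l q" for f
    using cls_zero_iff[OF l q subsetD[OF den_num[OF l q] that]] that by simp
  moreover have "den l q \<noteq> {}" using submodule_zero[OF mor_module[OF l q] den_submodule[OF l q]] by auto
  ultimately show ?thesis unfolding class_family_def T by auto
qed

lemma shift_family: "fst l \<in> obj A \<Longrightarrow> t \<le> N \<Longrightarrow> rep_family l (level (\<lambda>d. d + int t) l)"
  by (rule level_rep_family) auto

text \<open>A generator \<open>b\<close> of \<open>G/G'\<close> at \<open>m\<close> identifies this quotient with a standard module as soon as its annihilator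
  modulo \<open>G'\<close> is the trace at \<open>m\<close>.\<close>

lemma standard_subquotient:
  assumes l: "fst l \<in> obj A" and m: "fst m \<in> obj A"
    and G: "rep_family l G" and G': "rep_family l G'" and le: "\<And>q. fst q \<in> obj A \<Longrightarrow> G' q \<subseteq> G q"
    and T: "rep_family m T"
    and trace: "\<And>q. fst q \<in> obj A \<Longrightarrow> standard_trace K CC lt m q = class_family m T q"
    and b: "b \<in> G m"
    and gen: "\<And>q f. fst q \<in> obj A \<Longrightarrow> f \<in> G q \<Longrightarrow>
      \<exists>g\<in>num m q. f \<ominus>\<^bsub>mor A (fst l) (fst q)\<^esub> comp A (fst l) (fst m) (fst q) g b \<in> G' q"
    and ker: "\<And>q g. fst q \<in> obj A \<Longrightarrow> g \<in> num m q \<Longrightarrow> comp A (fst l) (fst m) (fst q) g b \<in> G' q \<longleftrightarrow> g \<in> T q"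
  shows "catmod_iso K CC (catmod_quot (catmod_restrict (projective CC l) (class_family l G)) (class_family l G'))
    (standard K CC lt m)"
  unfolding standard_def
proof (rule CC.generated_subquotient_iso)
  show "l \<in> obj CC" and mC: "m \<in> obj CC" using l m by auto
  show "catmod_sub K CC (projective CC l) (class_family l G)" by (rule class_family_sub[OF l G])
  show "catmod_sub K CC (projective CC l) (class_family l G')" by (rule class_family_sub[OF l G'])
  show "class_family l G' q \<subseteq> class_family l G q" if "q \<in> obj CC" for q
    using le[of q] that by (auto simp: class_family_def)
  show "catmod_sub K CC (projective CC m) (standard_trace K CC lt m)" by (rule CC.standard_trace_sub[OF mC])
  show "cls l m b \<in> class_family l G m" using b by (simp add: class_family_def)
  have bn: "b \<in> num l m" using rep_familyD(3)[OF G m] b by blast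
  fix q assume "q \<in> obj CC"
  hence q: "fst q \<in> obj A" by simp
  show "comp CC l m q g (cls l m b) \<in> class_family l G' q \<longleftrightarrow> g \<in> standard_trace K CC lt m q"
    if g: "g \<in> carrier (mor CC m q)" for g
  proof -
    obtain g0 where g0: "g0 \<in> num m q" "g = cls m q g0" using g by (auto simp: mor_CC_carrier[OF m q])
    show ?thesis
      using cls_mem_class_family[OF l q G' num_comp[OF l m q bn g0(1)]] cls_mem_class_family[OF m q T g0(1)]
        ker[OF q g0(1)] by (simp add: trace[OF q] g0(2) comp_CC[OF l m q bn g0(1)])
  qed
  fix v assume "v \<in> class_family l G q"
  then obtain f where f: "f \<in> G q" "v = cls l q f" by (auto simp: class_family_def)
  have fn: "f \<in> num l q" using rep_familyD(3)[OF G q] f(1) by blast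
  obtain g where g: "g \<in> num m q" "f \<ominus>\<^bsub>mor A (fst l) (fst q)\<^esub> comp A (fst l) (fst m) (fst q) g b \<in> G' q"
    using gen[OF q f(1)] by blast
  have "v \<ominus>\<^bsub>mor CC l q\<^esub> comp CC l m q (cls m q g) (cls l m b) =
      cls l q (f \<ominus>\<^bsub>mor A (fst l) (fst q)\<^esub> comp A (fst l) (fst m) (fst q) g b)"
    using cls_minus[OF l q fn num_comp[OF l m q bn g(1)]] by (simp add: f(2) comp_CC[OF l m q bn g(1)])
  hence "v \<ominus>\<^bsub>mor CC l q\<^esub> comp CC l m q (cls m q g) (cls l m b) \<in> class_family l G' q"
    using g(2) by (simp add: class_family_def)
  thus "\<exists>g\<in>carrier (mor CC m q). v \<ominus>\<^bsub>mor CC l q\<^esub> comp CC l m q g (cls l m b) \<in> class_family l G' q"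
    using cls_closed[OF m q g(1)] by blast
qed

text \<open>The layer between the levels \<open>d + t\<close> and \<open>d + t + 1\<close> is generated by the identity of \<open>x\<close>, viewed as a morphism from
  \<open>x[i]\<close> to \<open>x[i-t]\<close>: right multiplication by it does not change representatives.\<close>

lemma second_filtered:
  assumes l: "fst l \<in> obj A"
  shows "1 \<le> t \<Longrightarrow> t \<le> N \<Longrightarrow> std_filtered K CC second_order l (class_family l (level (\<lambda>d. d + int t) l))"
proof (induction t arbitrary: rule: measure_induct_rule[of "\<lambda>t. N - t"])
  case (less t)
  note fam = shift_family[OF l less.prems(2)]
  show ?case
  proof (cases "t = N")
    case True
    show ?thesis
    proof (rule std_filtered.zero[OF class_family_sub[OF l fam]])
      fix q assume "q \<in> obj CC"
      thus "class_family l (level (\<lambda>d. d + int t) l) q = {\<zero>\<^bsub>mor CC l q\<^esub>}"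
        by (intro den_family_zero) (use l True in \<open>auto simp: level_def den_def\<close>)
    qed
  next
    case False
    hence t: "Suc t \<le> N" using less.prems by simp
    note fam' = shift_family[OF l t]
    let ?m = "(fst l, snd l - int t)"
    have m: "fst ?m \<in> obj A" using l by simp
    have le: "level (\<lambda>d. d + int (Suc t)) l q \<subseteq> level (\<lambda>d. d + int t) l q" if "fst q \<in> obj A" for q
      unfolding level_def by (rule J_antimono[OF l that]) simp
    have iso: "catmod_iso K CC (catmod_quot (catmod_restrict (projective CC l)
        (class_family l (level (\<lambda>d. d + int t) l))) (class_family l (level (\<lambda>d. d + int (Suc t)) l)))
      (standard K CC second_order ?m)"
    proof (rule standard_subquotient[OF l m fam fam' le second_level_family[OF m N_pos[OF l]] second_trace[OF m _ N_pos[OF l]]])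
      show "idm A (fst l) \<in> level (\<lambda>d. d + int t) l ?m" using l by (simp add: level_def idm_J)
      fix q assume q: "fst (q :: 'o \<times> int) \<in> obj A"
      show "comp A (fst l) (fst ?m) (fst q) g (idm A (fst l)) \<in> level (\<lambda>d. d + int (Suc t)) l q \<longleftrightarrow> g \<in> level second_level ?m q"
        if g: "g \<in> num ?m q" for g
        using comp_idm_right[OF l q, of g] num_carrier[OF m q g] by (simp add: level_def second_level_def algebra_simps)
      fix f assume f: "f \<in> level (\<lambda>d. d + int t) l q"
      have fc: "f \<in> carrier (mor A (fst l) (fst q))" using J_carrier[OF l q] f by (auto simp: level_def)
      interpret V: module K "mor A (fst l) (fst q)" by (rule mor_module[OF l q])
      have "f \<in> num ?m q" using f by (simp add: level_def num_def algebra_simps)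
      moreover have "f \<ominus>\<^bsub>mor A (fst l) (fst q)\<^esub> comp A (fst l) (fst ?m) (fst q) f (idm A (fst l)) = \<zero>\<^bsub>mor A (fst l) (fst q)\<^esub>"
        using comp_idm_right[OF l q fc] fc by (simp add: a_minus_def V.M.r_neg)
      moreover have "\<zero>\<^bsub>mor A (fst l) (fst q)\<^esub> \<in> level (\<lambda>d. d + int (Suc t)) l q"
        unfolding level_def by (rule J_zero_mem[OF l q])
      ultimately show "\<exists>g\<in>num ?m q. f \<ominus>\<^bsub>mor A (fst l) (fst q)\<^esub> comp A (fst l) (fst ?m) (fst q) g (idm A (fst l))
          \<in> level (\<lambda>d. d + int (Suc t)) l q" by (intro bexI[of _ f]) simp_all
    qed
    show ?thesis
    proof (rule std_filtered.step[OF class_family_sub[OF l fam] less.IH _ _ _ iso])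
      show "N - Suc t < N - t" "1 \<le> Suc t" "Suc t \<le> N" using t by auto
      show "class_family l (level (\<lambda>d. d + int (Suc t)) l) q \<subseteq> class_family l (level (\<lambda>d. d + int t) l) q"
        if "q \<in> obj CC" for q using le[of q] that by (auto simp: class_family_def)
      show "?m \<in> obj CC" "second_order l ?m" using l less.prems by (auto simp: second_order_def)
    qed
  qed
qed

lemma left_quasi_hereditary_second: "left_quasi_hereditary K CC second_order"
  unfolding left_quasi_hereditary_def
proof (intro conjI ballI conv_cat_linear_category)
  fix l assume lC: "l \<in> obj CC"
  hence l: "fst l \<in> obj A" by simp
  show "end_is_ground_field K CC (standard K CC second_order l)" by (rule end_standard_second[OF l])
  have "std_filtered K CC second_order l (class_family l (level (\<lambda>d. d + int 1) l))"
    by (rule second_filtered[OF l]) (use N_pos[OF l] in auto)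
  moreover have "level (\<lambda>d. d + int 1) l = level second_level l" by (rule ext) (simp add: level_def second_level_def)
  ultimately have "std_filtered K CC second_order l (class_family l (level second_level l))" by simp
  hence "std_filtered K CC second_order l (standard_trace K CC second_order l)"
    by (rule std_filtered_cong) (simp add: second_trace[OF l _ N_pos[OF l]])
  thus "has_standard_filtration K CC second_order l"
    by (rule has_standard_filtrationI[OF conv_cat_linear_category lC])
qed


text \<open>The submodule of the projective at \<open>x[i]\<close> that is cut out by an \<open>A\<close>-submodule \<open>W\<close> of \<open>A(x,-)\<close>.  Intersecting with the
  numerator and adding the denominator is forced by the subquotients.\<close>

definition hull_family :: "('o \<Rightarrow> 'm set) \<Rightarrow> 'o \<times> int \<Rightarrow> 'o \<times> int \<Rightarrow> 'm set" where
  "hull_family W l q = num l q \<inter> {u \<oplus>\<^bsub>mor A (fst l) (fst q)\<^esub> w | u w. u \<in> W (fst q) \<and> w \<in> den l q}"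

lemma hull_family_mem:
  assumes l: "fst l \<in> obj A" and q: "fst q \<in> obj A" and W: "submodule (W (fst q)) K (mor A (fst l) (fst q))"
  shows "f \<in> W (fst q) \<Longrightarrow> f \<in> num l q \<Longrightarrow> f \<in> hull_family W l q" "f \<in> den l q \<Longrightarrow> f \<in> hull_family W l q"
  using submodule_sum_superset[OF mor_module[OF l q] W den_submodule[OF l q]] den_num[OF l q]
  unfolding hull_family_def by blast+

lemma hull_family_sub:
  assumes l: "fst l \<in> obj A" and q: "fst q \<in> obj A" and W: "submodule (W (fst q)) K (mor A (fst l) (fst q))"
  shows "submodule (hull_family W l q) K (mor A (fst l) (fst q))"
  unfolding hull_family_def
  by (rule submodule_Int[OF mor_module[OF l q] num_submodule[OF l q] submodule_sum[OF mor_module[OF l q] W den_submodule[OF l q]]])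

lemma hull_rep_family:
  assumes l: "fst l \<in> obj A" and W: "catmod_sub K A (projective A (fst l)) W"
  shows "rep_family l (hull_family W l)"
  unfolding rep_family_def
proof (intro conjI allI impI)
  have Ws: "submodule (W z) K (mor A (fst l) z)" if "z \<in> obj A" for z
    using catmod_sub_submodule[OF W that] by simp
  fix q :: "'o \<times> int" assume q: "fst q \<in> obj A"
  show "submodule (hull_family W l q) K (mor A (fst l) (fst q))" by (rule hull_family_sub[of l q W, OF l q Ws[OF q]])
  show "den l q \<subseteq> hull_family W l q" using hull_family_mem(2)[of l q W, OF l q Ws[OF q]] by blast
  show "hull_family W l q \<subseteq> num l q" by (auto simp: hull_family_def)
next
  have Ws: "submodule (W z) K (mor A (fst l) z)" if "z \<in> obj A" for z
    using catmod_sub_submodule[OF W that] by simp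
  fix q r :: "'o \<times> int" and f g assume q: "fst q \<in> obj A" and r: "fst r \<in> obj A"
    and f: "f \<in> hull_family W l q" and g: "g \<in> num q r"
  obtain u w where uw: "u \<in> W (fst q)" "w \<in> den l q" "f = u \<oplus>\<^bsub>mor A (fst l) (fst q)\<^esub> w"
    and fn: "f \<in> num l q" using f by (auto simp: hull_family_def)
  have gc: "g \<in> carrier (mor A (fst q) (fst r))" by (rule num_carrier[OF q r g])
  have uc: "u \<in> carrier (mor A (fst l) (fst q))" using submodule_subset[OF mor_module[OF l q] Ws[OF q]] uw(1) by blast
  have wn: "w \<in> num l q" using den_num[OF l q] uw(2) by blast
  have "comp A (fst l) (fst q) (fst r) g f =
    comp A (fst l) (fst q) (fst r) g u \<oplus>\<^bsub>mor A (fst l) (fst r)\<^esub> comp A (fst l) (fst q) (fst r) g w"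
    unfolding uw(3) by (rule linear_hom_add[OF comp_linear_right[OF l q r gc] uc num_carrier[OF l q wn]])
  moreover have "comp A (fst l) (fst q) (fst r) g u \<in> W (fst r)"
    using catmod_sub_act[OF W q r gc uw(1)] by simp
  moreover have "comp A (fst l) (fst q) (fst r) g w \<in> den l r" by (rule den_comp_right[OF l q r uw(2) g])
  ultimately show "comp A (fst l) (fst q) (fst r) g f \<in> hull_family W l r"
    using num_comp[OF l q r fn g] unfolding hull_family_def by blast
qed

text \<open>Since \<open>I\<^sub>1 I\<^sub>t \<subseteq> I\<^bsub>t+1\<^esub>\<close> and \<open>A/I\<^sub>1\<close> consists of scalars on the diagonal, every family of subspaces between
  \<open>I\<^bsub>t+1\<^esub>\<close> and \<open>I\<^sub>t\<close> is a submodule.\<close>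

lemma between_sub:
  assumes x: "x \<in> obj A" and W: "\<And>z. z \<in> obj A \<Longrightarrow> submodule (W z) K (mor A x z)"
    and lo: "\<And>z. z \<in> obj A \<Longrightarrow> I (Suc t) x z \<subseteq> W z" and hi: "\<And>z. z \<in> obj A \<Longrightarrow> W z \<subseteq> I t x z"
  shows "catmod_sub K A (projective A x) W"
  unfolding catmod_sub_def projective_simps
proof (intro conjI ballI W)
  fix y z g w assume y: "y \<in> obj A" and z: "z \<in> obj A" and g: "g \<in> carrier (mor A y z)" and w: "w \<in> W y"
  have wt: "w \<in> I t x y" using hi[OF y] w by blast
  have low: "comp A x y z' h w \<in> W z'" if "z' \<in> obj A" "h \<in> I 1 y z'" for z' h
    using I_mult[OF x y that(1) wt that(2)] lo[OF that(1)] by auto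
  show "comp A x y z g w \<in> W z"
  proof (cases "y = z")
    case False thus ?thesis using I1_off_diagonal[OF y z False g] low z by blast
  next
    case True
    have gy: "g \<in> carrier (mor A y y)" using g True by simp
    obtain c where c: "c \<in> carrier K" "g \<ominus>\<^bsub>mor A y y\<^esub> c \<odot>\<^bsub>mor A y y\<^esub> idm A y \<in> I 1 y y"
      using I1_diagonal[OF y gy] by blast
    interpret V: module K "mor A y y" by (rule mor_module[OF y y])
    interpret U: module K "mor A x y" by (rule mor_module[OF x y])
    have id: "idm A y \<in> carrier (mor A y y)" by (rule idm_closed[OF y])
    have wc: "w \<in> carrier (mor A x y)" using submodule_subset[OF mor_module[OF x y] W[OF y]] w by blast
    have ci: "c \<odot>\<^bsub>mor A y y\<^esub> idm A y \<in> carrier (mor A y y)" using c id by simp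
    have cw: "comp A x y y (c \<odot>\<^bsub>mor A y y\<^esub> idm A y) w = c \<odot>\<^bsub>mor A x y\<^esub> w"
      using linear_hom_smult[OF comp_linear_left[OF x y y wc] c(1) id] comp_idm_left[OF x y wc] by simp
    have "comp A x y y (g \<ominus>\<^bsub>mor A y y\<^esub> c \<odot>\<^bsub>mor A y y\<^esub> idm A y) w = comp A x y y g w \<ominus>\<^bsub>mor A x y\<^esub> c \<odot>\<^bsub>mor A x y\<^esub> w"
      using comp_minus_left[OF x y y wc gy ci] cw by simp
    hence 1: "comp A x y y g w \<ominus>\<^bsub>mor A x y\<^esub> c \<odot>\<^bsub>mor A x y\<^esub> w \<in> W y" using low[OF y c(2)] by simp
    have 2: "c \<odot>\<^bsub>mor A x y\<^esub> w \<in> W y" by (rule submodule_smult[OF mor_module[OF x y] W[OF y] c(1) w])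
    have "comp A x y y g w = (comp A x y y g w \<ominus>\<^bsub>mor A x y\<^esub> c \<odot>\<^bsub>mor A x y\<^esub> w) \<oplus>\<^bsub>mor A x y\<^esub> c \<odot>\<^bsub>mor A x y\<^esub> w"
      using U.minus_add_cancel(1)[of "comp A x y y g w" "c \<odot>\<^bsub>mor A x y\<^esub> w"] comp_closed[OF x y y wc gy] c wc by simp
    thus ?thesis using submodule_add[OF mor_module[OF x y] W[OF y] 1 2] True by simp
  qed
qed

text \<open>Removing one vector \<open>b \<in> I\<^sub>t(x,y)\<close>.  As a morphism from \<open>x[i]\<close> to \<open>y[i+t]\<close> it generates the layer.  A morphism \<open>g\<close>
  starting at \<open>y[i+t]\<close> annihilates \<open>b\<close> modulo the smaller submodule exactly if it lies in the trace: elements of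
  \<open>I\<^sub>1\<close> send \<open>b\<close> into \<open>I\<^bsub>t+1\<^esub>\<close>, nonzero scalars do not kill \<open>b\<close>, and in rows where the denominator has absorbed
  \<open>I\<^sub>t\<close> there is nothing to prove.\<close>

lemma first_step:
  assumes l: "fst l \<in> obj A" and y: "y \<in> obj A"
    and W: "\<And>z. z \<in> obj A \<Longrightarrow> submodule (W z) K (mor A (fst l) z)"
    and W': "\<And>z. z \<in> obj A \<Longrightarrow> submodule (W' z) K (mor A (fst l) z)"
    and lo: "\<And>z. z \<in> obj A \<Longrightarrow> I (Suc t) (fst l) z \<subseteq> W' z"
    and le: "\<And>z. z \<in> obj A \<Longrightarrow> W' z \<subseteq> W z" and hi: "\<And>z. z \<in> obj A \<Longrightarrow> W z \<subseteq> I t (fst l) z"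
    and b: "b \<in> W y" "b \<notin> W' y"
    and Wy: "\<And>w. w \<in> W y \<Longrightarrow> \<exists>c\<in>carrier K. \<exists>u\<in>W' y. w = c \<odot>\<^bsub>mor A (fst l) y\<^esub> b \<oplus>\<^bsub>mor A (fst l) y\<^esub> u"
    and Wz: "\<And>z. z \<in> obj A \<Longrightarrow> z \<noteq> y \<Longrightarrow> W z = W' z"
    and t: "0 < t"
    and filt: "std_filtered K CC first_order l (class_family l (hull_family W' l))"
  shows "std_filtered K CC first_order l (class_family l (hull_family W l))"
proof -
  let ?x = "fst l" and ?m = "(y, snd l + int t)"
  have m: "fst ?m \<in> obj A" using y by simp
  have lo': "I (Suc t) ?x z \<subseteq> W z" and hi': "W' z \<subseteq> I t ?x z" if "z \<in> obj A" for z
    using lo le hi that by blast+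
  note Wf = hull_rep_family[OF l between_sub[OF l W lo' hi]]
  note Wf' = hull_rep_family[OF l between_sub[OF l W' lo hi']]
  have sub: "hull_family W' l q \<subseteq> hull_family W l q" if "fst q \<in> obj A" for q
    using le[OF that] unfolding hull_family_def by blast
  have bt: "b \<in> J (int t) ?x y" using hi[OF y] b(1) by (auto simp: J_def)
  have bn: "b \<in> num l ?m" using bt by (simp add: num_def)
  have bc: "b \<in> carrier (mor A ?x y)" using J_carrier[OF l y bt] .
  have JW': "f \<in> W' z" if "z \<in> obj A" "f \<in> J n ?x z" "int t + 1 \<le> n" for f z n
  proof -
    have "f \<in> J (int (Suc t)) ?x z" by (rule J_mono_mem[OF that(2) l that(1)]) (use that(3) in simp)
    hence "f \<in> I (Suc t) ?x z" unfolding J_def nat_int .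
    thus ?thesis using lo[OF that(1)] by blast
  qed
  have iso: "catmod_iso K CC (catmod_quot (catmod_restrict (projective CC l)
        (class_family l (hull_family W l))) (class_family l (hull_family W' l)))
      (standard K CC first_order ?m)"
  proof (rule standard_subquotient[OF l m Wf Wf' sub first_level_family[OF m] first_trace[OF m]])
    show "b \<in> hull_family W l ?m" using hull_family_mem(1)[of l ?m W b, OF l m] W[OF y] b(1) bn by simp
    fix q :: "'o \<times> int" assume q: "fst q \<in> obj A"
    define d where "d = snd q - snd l"
    let ?z = "fst q"
    interpret V: module K "mor A ?x ?z" by (rule mor_module[OF l q])
    interpret Y: module K "mor A ?x y" by (rule mor_module[OF l y])
    have mem: "f \<in> hull_family W' l q" if "f \<in> W' ?z" "f \<in> J d ?x ?z" for f
      using hull_family_mem(1)[of l q W' f, OF l q W'[OF q] that(1)] that(2) by (simp add: num_def d_def)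
    show "\<exists>g\<in>num ?m q. f \<ominus>\<^bsub>mor A ?x ?z\<^esub> comp A ?x (fst ?m) ?z g b \<in> hull_family W' l q"
      if f: "f \<in> hull_family W l q" for f
    proof -
      obtain u w where uw: "u \<in> W ?z" "w \<in> den l q" "f = u \<oplus>\<^bsub>mor A ?x ?z\<^esub> w"
        and fn: "f \<in> num l q" using f by (auto simp: hull_family_def)
      have fc: "f \<in> carrier (mor A ?x ?z)" by (rule num_carrier[OF l q fn])
      have triv: ?thesis if "f \<in> hull_family W' l q"
      proof -
        have "\<zero>\<^bsub>mor A y ?z\<^esub> \<in> num ?m q" using J_zero_mem[OF y q] by (simp add: num_def)
        moreover have "f \<ominus>\<^bsub>mor A ?x ?z\<^esub> comp A ?x (fst ?m) ?z \<zero>\<^bsub>mor A y ?z\<^esub> b = f"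
          using comp_zero_left[OF l y q bc] fc V.minus_add_cancel(3)[OF fc V.M.zero_closed] by simp
        ultimately show ?thesis using that by (intro bexI[of _ "\<zero>\<^bsub>mor A y ?z\<^esub>"]) simp_all
      qed
      \<comment> \<open>In the rows above \<open>i + t\<close> and away from \<open>y\<close> the two submodules agree; in the remaining entries the scalar multiples
        of the identity of \<open>y\<close> are available.\<close>
      consider "d > int t" | "?z \<noteq> y" | "d \<le> int t" "?z = y" by linarith
      thus ?thesis
      proof cases
        case 1
        have fJ: "f \<in> J d ?x ?z" using fn by (simp add: num_def d_def)
        show ?thesis by (rule triv[OF mem[OF JW'[OF q fJ] fJ]]) (use 1 in simp)
      next
        case 2
        show ?thesis by (rule triv) (use f Wz[OF q 2] in \<open>simp add: hull_family_def\<close>)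
      next
        case 3
        obtain c u' where c: "c \<in> carrier K" "u' \<in> W' y" "u = c \<odot>\<^bsub>mor A ?x y\<^esub> b \<oplus>\<^bsub>mor A ?x y\<^esub> u'"
          using Wy uw(1) 3(2) by blast
        interpret E: module K "mor A y y" by (rule mor_module[OF y y])
        have id: "idm A y \<in> carrier (mor A y y)" by (rule idm_closed[OF y])
        have g: "c \<odot>\<^bsub>mor A y y\<^esub> idm A y \<in> num ?m q"
          using 3 c(1) id J_nonpos[OF y y] by (simp add: num_def d_def)
        have gb: "comp A ?x y y (c \<odot>\<^bsub>mor A y y\<^esub> idm A y) b = c \<odot>\<^bsub>mor A ?x y\<^esub> b"
          using linear_hom_smult[OF comp_linear_left[OF l y y bc] c(1) id] comp_idm_left[OF l y bc] by simp
        have u'c: "u' \<in> carrier (mor A ?x y)" using submodule_subset[OF mor_module[OF l y] W'[OF y]] c(2) by blast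
        have wc: "w \<in> carrier (mor A ?x y)" using den_num[OF l q] uw(2) num_carrier[OF l q] 3(2) by auto
        have cbc: "c \<odot>\<^bsub>mor A ?x y\<^esub> b \<in> carrier (mor A ?x y)" using c(1) bc by simp
        have eq: "f \<ominus>\<^bsub>mor A ?x y\<^esub> c \<odot>\<^bsub>mor A ?x y\<^esub> b = u' \<oplus>\<^bsub>mor A ?x y\<^esub> w"
          using uw(3) c(3) 3(2) Y.minus_add_cancel(4)[of "u' \<oplus>\<^bsub>mor A ?x y\<^esub> w" "c \<odot>\<^bsub>mor A ?x y\<^esub> b"] cbc u'c wc
          by (simp add: Y.M.a_assoc)
        have "c \<odot>\<^bsub>mor A ?x y\<^esub> b \<in> num l q"
          using submodule_smult[OF mor_module[OF l y] J_submodule[OF l y] c(1) J_mono_mem[OF bt l y]] 3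
          by (simp add: num_def d_def)
        hence "f \<ominus>\<^bsub>mor A ?x y\<^esub> c \<odot>\<^bsub>mor A ?x y\<^esub> b \<in> num l q"
          using submodule_minus[OF mor_module[OF l q] num_submodule[OF l q] fn] 3(2) by simp
        hence "f \<ominus>\<^bsub>mor A ?x y\<^esub> c \<odot>\<^bsub>mor A ?x y\<^esub> b \<in> hull_family W' l q"
          unfolding hull_family_def using eq c(2) uw(2) 3(2) by auto
        thus ?thesis using g gb 3(2) by (intro bexI[of _ "c \<odot>\<^bsub>mor A y y\<^esub> idm A y"]) simp_all
      qed
    qed
    show "comp A ?x (fst ?m) ?z g b \<in> hull_family W' l q \<longleftrightarrow> g \<in> level first_level ?m q" if g: "g \<in> num ?m q" for g
    proof -
      define e where "e = d - int t"
      have gJ: "g \<in> J e y ?z" using g by (simp add: num_def d_def e_def algebra_simps)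
      have gc: "g \<in> carrier (mor A y ?z)" by (rule J_carrier[OF y q gJ])
      have T: "level first_level ?m q = J (first_level e) y ?z" by (simp add: level_def d_def e_def algebra_simps)
      have gbn: "comp A ?x y ?z g b \<in> num l q" using num_comp[OF l m q bn g] by simp
      show ?thesis
      proof (cases "e + int N \<le> 0")
        case True
        have "comp A ?x y ?z g b \<in> J (d + int N) ?x ?z"
          by (rule J_mult[OF l y q bt gJ]) (use True in \<open>simp add: e_def\<close>)
        hence "comp A ?x y ?z g b \<in> hull_family W' l q"
          using hull_family_mem(2)[of l q W', OF l q W'[OF q]] by (simp add: den_def d_def)
        moreover have "g \<in> level first_level ?m q" unfolding T using J_nonpos[OF y q] gc True by (simp add: first_level_def)
        ultimately show ?thesis by simp
      next
        case False
        hence tr: "first_level e = max e 1" by (simp add: first_level_def)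
        have I1: "g \<in> level first_level ?m q \<longleftrightarrow> g \<in> J 1 y ?z" unfolding T tr using gJ J_mono_mem[of g "max e 1" y ?z 1] y q
          by (auto simp: max_def)
        show ?thesis
        proof
          assume "g \<in> level first_level ?m q"
          hence g1: "g \<in> J 1 y ?z" using I1 by simp
          have "comp A ?x y ?z g b \<in> J (int t + 1) ?x ?z" by (rule J_mult[OF l y q bt g1]) simp
          hence "comp A ?x y ?z g b \<in> W' ?z" by (rule JW'[OF q]) simp
          thus "comp A ?x (fst ?m) ?z g b \<in> hull_family W' l q" using mem gbn by (simp add: num_def d_def)
        next
          assume "comp A ?x (fst ?m) ?z g b \<in> hull_family W' l q"
          then obtain u w where uw: "u \<in> W' ?z" "w \<in> den l q" "comp A ?x y ?z g b = u \<oplus>\<^bsub>mor A ?x ?z\<^esub> w"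
            by (auto simp: hull_family_def)
          have "w \<in> W' ?z" by (rule JW'[OF q, of _ "d + int N"]) (use uw(2) False in \<open>auto simp: den_def d_def e_def\<close>)
          hence gbW: "comp A ?x y ?z g b \<in> W' ?z" unfolding uw(3) by (rule submodule_add[OF mor_module[OF l q] W'[OF q] uw(1)])
          have "g \<in> I 1 y ?z"
          proof (cases "?z = y")
            case False thus ?thesis using I1_off_diagonal[OF y q _ gc] by auto
          next
            case True
            interpret E: module K "mor A y y" by (rule mor_module[OF y y])
            have id: "idm A y \<in> carrier (mor A y y)" by (rule idm_closed[OF y])
            have gy: "g \<in> carrier (mor A y y)" using gc True by simp
            obtain c where c: "c \<in> carrier K" "g \<ominus>\<^bsub>mor A y y\<^esub> c \<odot>\<^bsub>mor A y y\<^esub> idm A y \<in> I 1 y y"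
              using I1_diagonal[OF y gy] by blast
            have ci: "c \<odot>\<^bsub>mor A y y\<^esub> idm A y \<in> carrier (mor A y y)" using c id by simp
            define j where "j = g \<ominus>\<^bsub>mor A y y\<^esub> c \<odot>\<^bsub>mor A y y\<^esub> idm A y"
            have jI: "j \<in> J 1 y y" using c(2) by (simp add: j_def J_def)
            have jW: "comp A ?x y y j b \<in> W' y" by (rule JW'[OF y J_mult[OF l y y bt jI order_refl]]) simp
            have jb: "comp A ?x y y j b = comp A ?x y y g b \<ominus>\<^bsub>mor A ?x y\<^esub> c \<odot>\<^bsub>mor A ?x y\<^esub> b"
              unfolding j_def using comp_minus_left[OF l y y bc gy ci]
                linear_hom_smult[OF comp_linear_left[OF l y y bc] c(1) id] comp_idm_left[OF l y bc] by simp
            have gbc: "comp A ?x y y g b \<in> carrier (mor A ?x y)" by (rule comp_closed[OF l y y bc gy])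
            have cbc: "c \<odot>\<^bsub>mor A ?x y\<^esub> b \<in> carrier (mor A ?x y)" using c(1) bc by simp
            have "c \<odot>\<^bsub>mor A ?x y\<^esub> b = comp A ?x y y g b \<ominus>\<^bsub>mor A ?x y\<^esub> comp A ?x y y j b"
              unfolding jb using Y.minus_add_cancel(1)[OF gbc cbc]
                Y.minus_add_cancel(4)[OF cbc Y.minus_closed[OF gbc cbc]] by simp
            hence cb: "c \<odot>\<^bsub>mor A ?x y\<^esub> b \<in> W' y"
              using submodule_minus[OF mor_module[OF l y] W'[OF y] _ jW] gbW True by simp
            have "c = \<zero>\<^bsub>K\<^esub>"
            proof (rule ccontr)
              assume "c \<noteq> \<zero>\<^bsub>K\<^esub>"
              hence cU: "c \<in> Units K" using c(1) by (simp add: K.field_Units)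
              have "inv\<^bsub>K\<^esub> c \<odot>\<^bsub>mor A ?x y\<^esub> (c \<odot>\<^bsub>mor A ?x y\<^esub> b) \<in> W' y"
                by (rule submodule_smult[OF mor_module[OF l y] W'[OF y] K.Units_inv_closed[OF cU] cb])
              moreover have "inv\<^bsub>K\<^esub> c \<odot>\<^bsub>mor A ?x y\<^esub> (c \<odot>\<^bsub>mor A ?x y\<^esub> b) = b"
                using Y.smult_assoc1[OF K.Units_inv_closed[OF cU] c(1) bc] K.Units_l_inv[OF cU] bc by simp
              ultimately show False using b(2) by simp
            qed
            hence "g = j" using E.minus_add_cancel(3)[OF gy E.M.zero_closed] gy id by (simp add: j_def)
            thus ?thesis using c(2) True by (simp add: j_def)
          qed
          thus "g \<in> level first_level ?m q" using I1 by (simp add: J_def)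
        qed
      qed
    qed
  qed
  show ?thesis
  proof (rule std_filtered.step[OF class_family_sub[OF l Wf] filt _ _ _ iso])
    show "class_family l (hull_family W' l) q \<subseteq> class_family l (hull_family W l) q" if "q \<in> obj CC" for q
      using sub[of q] that by (auto simp: class_family_def)
    show "?m \<in> obj CC" "first_order l ?m" using y t by (auto simp: first_order_def)
  qed
qed

text \<open>One step for each element of \<open>S\<close>; elements that do not enlarge the span are skipped.\<close>

lemma first_refine:
  assumes l: "fst l \<in> obj A" and t: "0 < t"
    and filt: "std_filtered K CC first_order l (class_family l (hull_family (I (Suc t) (fst l)) l))"
  defines "W \<equiv> \<lambda>S z. lin_span K (mor A (fst l) z) (I (Suc t) (fst l) z \<union> {b. (z, b) \<in> S})"
  shows "finite S \<Longrightarrow> (\<And>y b. (y, b) \<in> S \<Longrightarrow> y \<in> obj A \<and> b \<in> I t (fst l) y) \<Longrightarrow>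
    std_filtered K CC first_order l (class_family l (hull_family (W S) l))"
proof (induction S rule: finite_induct)
  case empty
  have "W {} z = I (Suc t) (fst l) z" if "z \<in> obj A" for z
    unfolding W_def using lin_span_submodule_eq[OF cat_ideal_submodule[OF I_ideal l that]] by simp
  thus ?case by (intro std_filtered_cong[OF filt]) (simp add: class_family_def hull_family_def)
next
  case (insert p S)
  obtain y b where p: "p = (y, b)" by (cases p)
  have y: "y \<in> obj A" and b: "b \<in> I t (fst l) y" using insert.prems[of y b] p by auto
  have S: "y \<in> obj A \<and> b \<in> I t (fst l) y" if "(y, b) \<in> S" for y b using insert.prems that by blast
  have IH: "std_filtered K CC first_order l (class_family l (hull_family (W S) l))"
    by (rule insert.IH[OF S])
  note Is = cat_ideal_submodule[OF I_ideal l]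
  have gens: "I (Suc t) (fst l) z \<union> {b. (z, b) \<in> R} \<subseteq> I t (fst l) z"
    if "z \<in> obj A" "\<And>y b. (y, b) \<in> R \<Longrightarrow> y \<in> obj A \<and> b \<in> I t (fst l) y" for z R
    using that I_Suc[OF l that(1), of t] by blast
  have gensc: "I (Suc t) (fst l) z \<union> {b. (z, b) \<in> R} \<subseteq> carrier (mor A (fst l) z)"
    if "z \<in> obj A" "\<And>y b. (y, b) \<in> R \<Longrightarrow> y \<in> obj A \<and> b \<in> I t (fst l) y" for z R
    using gens[OF that] submodule_subset[OF mor_module[OF l that(1)] Is[OF that(1)]] by blast
  have Wsub: "submodule (W R z) K (mor A (fst l) z)" and Whi: "W R z \<subseteq> I t (fst l) z"
    and Wlo: "I (Suc t) (fst l) z \<subseteq> W R z"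
    if z: "z \<in> obj A" and R: "\<And>y b. (y, b) \<in> R \<Longrightarrow> y \<in> obj A \<and> b \<in> I t (fst l) y" for z R
  proof -
    show "submodule (W R z) K (mor A (fst l) z)"
      unfolding W_def by (rule lin_span_submodule[OF mor_module[OF l z] gensc[OF z R]])
    show "W R z \<subseteq> I t (fst l) z" unfolding W_def by (rule lin_span_minimal[OF Is[OF z] gens[OF z R]])
    show "I (Suc t) (fst l) z \<subseteq> W R z" unfolding W_def
      by (rule subset_trans[OF Un_upper1 lin_span_superset])
  qed
  have Wz: "W (insert p S) z = W S z" if "z \<noteq> y" for z
    using that by (simp add: W_def p)
  have set_y: "I (Suc t) (fst l) y \<union> {b'. (y, b') \<in> insert p S} = insert b (I (Suc t) (fst l) y \<union> {b'. (y, b') \<in> S})"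
    using p by auto
  have bc: "b \<in> carrier (mor A (fst l) y)" using b submodule_subset[OF mor_module[OF l y] Is[OF y]] by blast
  have Wy: "W (insert p S) y = {c \<odot>\<^bsub>mor A (fst l) y\<^esub> b \<oplus>\<^bsub>mor A (fst l) y\<^esub> w | c w. c \<in> carrier K \<and> w \<in> W S y}"
    unfolding W_def set_y by (rule lin_span_insert[OF mor_module[OF l y] gensc[OF y S] bc])
  have bW: "b \<in> W (insert p S) y"
    unfolding W_def set_y by (rule subsetD[OF lin_span_superset]) simp
  have mono: "W S z \<subseteq> W (insert p S) z" for z unfolding W_def by (rule lin_span_mono) auto
  show ?case
  proof (cases "b \<in> W S y")
    case True
    have "W (insert p S) y \<subseteq> W S y" unfolding W_def set_y
      by (rule lin_span_minimal[OF Wsub[OF y S, unfolded W_def]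
            insert_subsetI[OF True[unfolded W_def] lin_span_superset]])
    hence "W (insert p S) z = W S z" for z using mono[of z] Wz[of z] by (cases "z = y") auto
    hence "W (insert p S) = W S" by (rule ext)
    thus ?thesis using IH by simp
  next
    case False
    show ?thesis
    proof (rule first_step[where t = t and y = y and b = b and W' = "W S", OF l y Wsub[OF _ insert.prems] Wsub[OF _ S]
          Wlo[OF _ S] mono Whi[OF _ insert.prems] bW False _ Wz t IH])
      show "\<exists>c\<in>carrier K. \<exists>u\<in>W S y. w = c \<odot>\<^bsub>mor A (fst l) y\<^esub> b \<oplus>\<^bsub>mor A (fst l) y\<^esub> u"
        if "w \<in> W (insert p S) y" for w using that unfolding Wy by blast
    qed
  qed
qed

lemma ideal_generators:
  assumes x: "x \<in> obj A"
  obtains S where "finite S" "\<And>y b. (y, b) \<in> S \<Longrightarrow> y \<in> obj A \<and> b \<in> I t x y"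
    "\<And>z. z \<in> obj A \<Longrightarrow> lin_span K (mor A x z) (I (Suc t) x z \<union> {b. (z, b) \<in> S}) = I t x z"
proof -
  obtain S0 where S0: "finite S0" "\<And>y v. (y, v) \<in> S0 \<Longrightarrow> y \<in> obj A \<and> v \<in> carrier (mor A x y)"
    "\<And>y. y \<in> obj A \<Longrightarrow> lin_span K (mor A x y) {v. (y, v) \<in> S0} = carrier (mor A x y)"
    using fin_dim_dsum_span[OF K.is_cring mor_module[OF x] fin_dim_projectives[OF x]] by metis
  note Is = cat_ideal_submodule[OF I_ideal x]
  have "\<exists>T. finite T \<and> T \<subseteq> I t x y \<and> lin_span K (mor A x y) T = I t x y" if y: "y \<in> obj A" for y
  proof (rule subspace_finitely_spanned[OF K.field_axioms mor_module[OF x y] _ _ Is[OF y], of "{v. (y, v) \<in> S0}"])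
    have "{v. (y, v) \<in> S0} \<subseteq> snd ` S0" by force
    thus "finite {v. (y, v) \<in> S0}" by (rule finite_subset) (use S0(1) in simp)
    show "{v. (y, v) \<in> S0} \<subseteq> carrier (mor A x y)" using S0(2) by blast
    show "I t x y \<subseteq> lin_span K (mor A x y) {v. (y, v) \<in> S0}"
      using S0(3)[OF y] submodule_subset[OF mor_module[OF x y] Is[OF y]] by simp
  qed
  then obtain T where T: "\<And>y. y \<in> obj A \<Longrightarrow> finite (T y)" "\<And>y. y \<in> obj A \<Longrightarrow> T y \<subseteq> I t x y"
    "\<And>y. y \<in> obj A \<Longrightarrow> lin_span K (mor A x y) (T y) = I t x y" by metis
  \<comment> \<open>Only finitely many objects \<open>y\<close> admit nonzero morphisms from \<open>x\<close>.\<close>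
  define S where "S = Sigma (fst ` S0) T"
  have Y: "fst ` S0 \<subseteq> obj A" using S0(2) by force
  have fin: "finite S" unfolding S_def using S0(1) T(1) Y by (intro finite_SigmaI) auto
  have mem: "y \<in> obj A \<and> b \<in> I t x y" if "(y, b) \<in> S" for y b
    using that T(2) Y by (auto simp: S_def)
  have "lin_span K (mor A x z) (I (Suc t) x z \<union> {b. (z, b) \<in> S}) = I t x z" if z: "z \<in> obj A" for z
  proof
    show "lin_span K (mor A x z) (I (Suc t) x z \<union> {b. (z, b) \<in> S}) \<subseteq> I t x z"
      by (rule lin_span_minimal[OF Is[OF z]]) (use mem I_Suc[OF x z] in blast)
    show "I t x z \<subseteq> lin_span K (mor A x z) (I (Suc t) x z \<union> {b. (z, b) \<in> S})"
    proof (cases "z \<in> fst ` S0")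
      case True
      hence "T z \<subseteq> I (Suc t) x z \<union> {b. (z, b) \<in> S}" by (auto simp: S_def)
      from lin_span_mono[OF this, of K "mor A x z"] show ?thesis using T(3)[OF z] by simp
    next
      case False
      hence "{v. (z, v) \<in> S0} = {}" by force
      hence "carrier (mor A x z) = {\<zero>\<^bsub>mor A x z\<^esub>}" using S0(3)[OF z] lin_span_empty[OF mor_module[OF x z]] by simp
      hence "I t x z \<subseteq> I (Suc t) x z"
        using submodule_subset[OF mor_module[OF x z] Is[OF z], of t] submodule_zero[OF mor_module[OF x z] Is[OF z], of "Suc t"] by auto
      thus ?thesis using lin_span_superset[of "I (Suc t) x z \<union> {b. (z, b) \<in> S}" K "mor A x z"] by blast
    qed
  qed
  thus ?thesis using that fin mem by blast
qed

text \<open>Downward induction on the level, from \<open>I\<^sub>N = 0\<close> to \<open>I\<^sub>1\<close>, which gives the trace.\<close>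

lemma first_filtered:
  assumes l: "fst l \<in> obj A"
  shows "1 \<le> t \<Longrightarrow> t \<le> N \<Longrightarrow> std_filtered K CC first_order l (class_family l (hull_family (I t (fst l)) l))"
proof (induction t rule: measure_induct_rule[of "\<lambda>t. N - t"])
  case (less t)
  show ?case
  proof (cases "t = N")
    case True
    have sub: "catmod_sub K A (projective A (fst l)) (I t (fst l))"
      using cat_ideal_submodule[OF I_ideal l] cat_ideal_left[OF I_ideal l] by (simp add: catmod_sub_def)
    show ?thesis
    proof (rule std_filtered.zero[OF class_family_sub[OF l hull_rep_family[OF l sub]]])
      fix q assume "q \<in> obj CC"
      hence q: "fst q \<in> obj A" by simp
      interpret V: module K "mor A (fst l) (fst q)" by (rule mor_module[OF l q])
      have "{\<zero>\<^bsub>mor A (fst l) (fst q)\<^esub> \<oplus>\<^bsub>mor A (fst l) (fst q)\<^esub> w | w. w \<in> den l q} = den l q"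
      proof -
        have "\<zero>\<^bsub>mor A (fst l) (fst q)\<^esub> \<oplus>\<^bsub>mor A (fst l) (fst q)\<^esub> w = w" if "w \<in> den l q" for w
          using subsetD[OF submodule_subset[OF mor_module[OF l q] den_submodule[OF l q]] that] by simp
        thus ?thesis by force
      qed
      hence "hull_family (I t (fst l)) l q = den l q"
        using den_num[OF l q] I_ge_N[OF l q, of t] True by (auto simp: hull_family_def)
      thus "class_family l (hull_family (I t (fst l)) l) q = {\<zero>\<^bsub>mor CC l q\<^esub>}" by (rule den_family_zero[OF l q])
    qed
  next
    case False
    hence t: "Suc t \<le> N" using less.prems by simp
    have IH: "std_filtered K CC first_order l (class_family l (hull_family (I (Suc t) (fst l)) l))"
      by (rule less.IH) (use t in auto)
    obtain S where S: "finite S" "\<And>y b. (y, b) \<in> S \<Longrightarrow> y \<in> obj A \<and> b \<in> I t (fst l) y"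
      "\<And>z. z \<in> obj A \<Longrightarrow> lin_span K (mor A (fst l) z) (I (Suc t) (fst l) z \<union> {b. (z, b) \<in> S}) = I t (fst l) z"
      using ideal_generators[OF l, of t] by metis
    have "0 < t" using less.prems by simp
    have "std_filtered K CC first_order l (class_family l (hull_family
        (\<lambda>z. lin_span K (mor A (fst l) z) (I (Suc t) (fst l) z \<union> {b. (z, b) \<in> S})) l))"
      by (rule first_refine[OF l \<open>0 < t\<close> IH S(1,2)])
    thus ?thesis
      by (rule std_filtered_cong) (simp add: class_family_def hull_family_def S(3))
  qed
qed

lemma left_quasi_hereditary_first: "left_quasi_hereditary K CC first_order"
  unfolding left_quasi_hereditary_def
proof (intro conjI ballI conv_cat_linear_category)
  fix l assume lC: "l \<in> obj CC"
  hence l: "fst l \<in> obj A" by simp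
  show "end_is_ground_field K CC (standard K CC first_order l)" by (rule end_standard_first[OF l])
  have "hull_family (I 1 (fst l)) l q = level first_level l q" if q: "fst q \<in> obj A" for q
  proof -
    define d where "d = snd q - snd l"
    note Is = cat_ideal_submodule[OF I_ideal l q, of 1]
    note sup = submodule_sum_superset[OF mor_module[OF l q] Is den_submodule[OF l q]]
    let ?S = "{u \<oplus>\<^bsub>mor A (fst l) (fst q)\<^esub> w | u w. u \<in> I 1 (fst l) (fst q) \<and> w \<in> den l q}"
    show ?thesis
    proof (cases "d + int N \<le> 0")
      case True
      have "den l q = carrier (mor A (fst l) (fst q))" using J_nonpos[OF l q] True by (simp add: den_def d_def)
      hence "?S = carrier (mor A (fst l) (fst q))"
        using sup submodule_subset[OF mor_module[OF l q] submodule_sum[OF mor_module[OF l q] Is den_submodule[OF l q]]] by blast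
      thus ?thesis using True J_nonpos[OF l q]
        by (auto simp: hull_family_def level_def first_level_def d_def num_def)
    next
      case False
      hence "den l q \<subseteq> I 1 (fst l) (fst q)"
        using J_antimono[OF l q, of 1 "d + int N"] by (auto simp: den_def d_def J_def)
      hence "?S \<subseteq> I 1 (fst l) (fst q)" using submodule_add[OF mor_module[OF l q] Is] by blast
      hence "?S = J 1 (fst l) (fst q)" using sup(1) by (auto simp: J_def)
      hence "hull_family (I 1 (fst l)) l q = J d (fst l) (fst q) \<inter> J 1 (fst l) (fst q)"
        by (simp add: hull_family_def num_def d_def)
      also have "\<dots> = J (max d 1) (fst l) (fst q)"
        using J_antimono[OF l q, of d 1] J_antimono[OF l q, of 1 d] by (auto simp: max_def)
      also have "max d 1 = first_level d" using False by (simp add: first_level_def)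
      finally show ?thesis by (simp add: level_def d_def)
    qed
  qed
  hence eq: "class_family l (hull_family (I 1 (fst l)) l) q = standard_trace K CC first_order l q" if "q \<in> obj CC" for q
    using first_trace[OF l, of q] that by (simp add: class_family_def)
  have "std_filtered K CC first_order l (class_family l (hull_family (I 1 (fst l)) l))"
    by (rule first_filtered[OF l]) (use N_pos[OF l] in auto)
  hence "std_filtered K CC first_order l (standard_trace K CC first_order l)"
    by (rule std_filtered_cong[OF _ eq])
  thus "has_standard_filtration K CC first_order l"
    by (rule has_standard_filtrationI[OF conv_cat_linear_category lC])
qed

lemma first_summands: "standards_are_summands K CC (obj A) first_order (entry_1l A N I)"
  by (rule standards_are_summandsI[OF conv_cat_linear_category first_standard_iso])

lemma second_summands: "standards_are_summands K CC (obj A) second_order (entry_2l A I)"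
  by (rule standards_are_summandsI[OF conv_cat_linear_category second_standard_iso[OF _ N_pos]])

end


section \<open>Right modules\<close>

lemma opcat_simps:
  "obj (opcat C) = obj C" "mor (opcat C) x y = mor C y x"
  "comp (opcat C) x y z g f = comp C z y x f g" "idm (opcat C) x = idm C x"
  by (simp_all add: opcat_def)

lemma opcat_linear_category:
  assumes "linear_category K C"
  shows "linear_category K (opcat C)"
proof -
  interpret linear_category K C by fact
  show ?thesis
    unfolding linear_category_def linear_category_axioms_def opcat_simps
    by (intro conjI allI impI)
      (rule K.field_axioms mor_module comp_linear_left comp_linear_right comp_assoc[symmetric]
        idm_closed comp_idm_left comp_idm_right; assumption)+
qed

lemma opcat_ideal_filtration:
  assumes "ideal_filtration K A N I"
  shows "ideal_filtration K (opcat A) N (\<lambda>i x y. I i y x)"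
proof -
  have "comp A z y x f g \<in> I (i + j) z x"
    if "x \<in> obj A" "y \<in> obj A" "z \<in> obj A" "f \<in> I j y x" "g \<in> I i z y" for x y z f g i j
    using assms that add.commute[of i j] unfolding ideal_filtration_def by metis
  moreover have "\<exists>x\<in>obj A. \<exists>y\<in>obj A. I (Suc i) y x \<noteq> I i y x" if "i < N" for i
  proof -
    from assms that have "\<exists>x\<in>obj A. \<exists>y\<in>obj A. I (Suc i) x y \<noteq> I i x y"
      by (simp add: ideal_filtration_def)
    thus ?thesis by blast
  qed
  ultimately show ?thesis using assms unfolding ideal_filtration_def cat_ideal_def opcat_simps by simp
qed

lemma opcat_schurian_filtration:
  assumes S: "schurian_filtration K A N I"
    and fd: "\<And>x. x \<in> obj A \<Longrightarrow> fin_dim K (dsum (obj A) (\<lambda>y. mor A y x))"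
  shows "schurian_filtration K (opcat A) N (\<lambda>i x y. I i y x)"
proof -
  interpret schurian_filtration K A N I by fact
  show ?thesis
  proof (intro schurian_filtration.intro filtered_category.intro filtered_category_axioms.intro
      schurian_filtration_axioms.intro)
    show "linear_category K (opcat A)" by (rule opcat_linear_category[OF linear_category_axioms])
    show "ideal_filtration K (opcat A) N (\<lambda>i x y. I i y x)" by (rule opcat_ideal_filtration[OF filtration])
    show "fin_dim K (dsum (obj (opcat A)) (mor (opcat A) x))" if "x \<in> obj (opcat A)" for x
      using fd[of x] that by (simp add: opcat_def)
  qed (simp_all add: opcat_simps idm_not_zero I1_off_diagonal I1_diagonal del: One_nat_def)
qed

definition flip :: "'o \<times> int \<Rightarrow> 'o \<times> int" where "flip p = (fst p, - snd p)"

lemma flip_flip: "flip (flip p) = p"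
  by (simp add: flip_def)

lemma flip_orders:
  "(\<lambda>p q. first_order (flip p) (flip q)) = second_order"
  "(\<lambda>p q. second_order (flip p) (flip q)) = first_order"
  by (auto simp: fun_eq_iff first_order_def second_order_def flip_def)

text \<open>Both categories have literally the same spaces of cosets: reversing the arrows exchanges source and target,
  and negating the shifts restores the sign of their difference.\<close>

lemma opcat_conv_cat:
  "opcat (conv_cat A N I) = relabel_cat flip (conv_cat (opcat A) N (\<lambda>i x y. I i y x))"
proof -
  have num: "conv_num (opcat A) (\<lambda>i x y. I i y x) (flip p) (flip q) = conv_num A I q p" for p q
    by (cases p; cases q) (simp add: conv_num_def flip_def opcat_simps)
  have den: "conv_den (opcat A) N (\<lambda>i x y. I i y x) (flip p) (flip q) = conv_den A N I q p" for p q
    by (cases p; cases q) (simp add: conv_den_def flip_def opcat_simps)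
  show ?thesis
    by (subst opcat_def, unfold relabel_cat_def, rule lincat.equality)
      (auto simp: conv_cat_def num den opcat_simps fun_eq_iff, auto simp: flip_def)
qed

lemma relabel_entry_1r:
  "relabel_mod flip (entry_2l (opcat A) (\<lambda>i x y. I i y x) (- i) x) = entry_1r A I i x"
  by (rule catmod.equality)
    (auto simp: relabel_mod_def entry_2l_def entry_1r_def entry_module_def fun_eq_iff flip_def algebra_simps)

lemma relabel_entry_2r:
  "relabel_mod flip (entry_1l (opcat A) N (\<lambda>i x y. I i y x) (- i) x) = entry_2r A N I i x"
  by (rule catmod.equality)
    (auto simp: relabel_mod_def entry_1l_def entry_2r_def entry_module_def fun_eq_iff flip_def opcat_simps algebra_simps)

text \<open>A morphism between distinct objects, or a nonunit, is radical and hence lies in \<open>I\<^sub>1\<close>.\<close>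

lemma schurian_filtrationI:
  assumes ac: "algebraically_closed K" and A: "linear_category K A" and basic: "basic_category A"
    and fd: "fin_dim_projectives_injectives K A" and filt: "ideal_filtration K A N I"
    and ss: "semisimple_bimod K A (ideal_quot_bimod A (I 0) (I 1))"
  shows "schurian_filtration K A N I"
proof -
  interpret linear_category K A by (rule A)
  interpret F: filtered_category K A N I by unfold_locales (rule filt)
  have loc: "local_ring (end_ring A x)" if "x \<in> obj A" for x
    using basic that by (simp add: basic_category_def)
  have fdp: "fin_dim K (dsum (obj A) (mor A x))" if "x \<in> obj A" for x
    using fd that by (simp add: fin_dim_projectives_injectives_def)
  have spanned: "\<exists>B. finite B \<and> B \<subseteq> carrier (mor A x x) \<and> lin_span K (mor A x x) B = carrier (mor A x x)"
    if x: "x \<in> obj A" for x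
  proof -
    obtain S where S: "finite S" "\<And>j v. (j, v) \<in> S \<Longrightarrow> j \<in> obj A \<and> v \<in> carrier (mor A x j)"
      "\<And>j. j \<in> obj A \<Longrightarrow> lin_span K (mor A x j) {v. (j, v) \<in> S} = carrier (mor A x j)"
      using fin_dim_dsum_span[OF K.is_cring mor_module[OF x] fdp[OF x]] by metis
    have "{v. (x, v) \<in> S} \<subseteq> snd ` S" by force
    hence "finite {v. (x, v) \<in> S}" by (rule finite_subset) (use S(1) in simp)
    thus ?thesis using S(2,3) x by blast
  qed
  have radical: "r \<in> I 1 x y"
    if x: "x \<in> obj A" and y: "y \<in> obj A" and r: "r \<in> carrier (mor A x y)"
      and rad: "\<And>a. a \<in> carrier (mor A y x) \<Longrightarrow> comp A x y x a r \<notin> Units (end_ring A x)" for x y r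
  proof -
    obtain B where B: "finite B" "B \<subseteq> carrier (mor A x x)" "lin_span K (mor A x x) B = carrier (mor A x x)"
      using spanned[OF x] by blast
    show ?thesis
      by (rule radical_in_semisimple_ideal[OF x y loc[OF x] F.I_ideal F.I_zero B ss r rad])
  qed
  show ?thesis
  proof unfold_locales
    fix x assume x: "x \<in> obj A"
    show "idm A x \<noteq> \<zero>\<^bsub>mor A x x\<^esub>" by (rule idm_nonzero[OF x loc[OF x]])
    show "fin_dim K (dsum (obj A) (mor A x))" by (rule fdp[OF x])
    fix f assume f: "f \<in> carrier (mor A x x)"
    obtain B where B: "finite B" "B \<subseteq> carrier (mor A x x)" "lin_span K (mor A x x) B = carrier (mor A x x)"
      using spanned[OF x] by blast
    obtain c where c: "c \<in> carrier K" "f \<ominus>\<^bsub>mor A x x\<^esub> c \<odot>\<^bsub>mor A x x\<^esub> idm A x \<notin> Units (end_ring A x)"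
      using scalar_plus_nonunit[OF x f ac idm_nonzero[OF x loc[OF x]] B] by blast
    interpret V: module K "mor A x x" by (rule mor_module[OF x x])
    have d: "f \<ominus>\<^bsub>mor A x x\<^esub> c \<odot>\<^bsub>mor A x x\<^esub> idm A x \<in> carrier (mor A x x)"
      using f c(1) idm_closed[OF x] by simp
    have "f \<ominus>\<^bsub>mor A x x\<^esub> c \<odot>\<^bsub>mor A x x\<^esub> idm A x \<in> I 1 x x"
      by (rule radical[OF x x d]) (use nonunits_left[OF x loc[OF x] _ ] c(2) d in blast)
    thus "\<exists>c\<in>carrier K. f \<ominus>\<^bsub>mor A x x\<^esub> c \<odot>\<^bsub>mor A x x\<^esub> idm A x \<in> I 1 x x" using c(1) by blast
  next
    fix x y f assume x: "x \<in> obj A" and y: "y \<in> obj A" and ne: "x \<noteq> y" and f: "f \<in> carrier (mor A x y)"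
    have "\<not> isomorphic_objs A x y" using basic x y ne by (auto simp: basic_category_def)
    thus "f \<in> I 1 x y"
      by (intro radical[OF x y f] composite_nonunit[OF x y loc[OF x] loc[OF y] f])
  qed
qed

theorem proposition1:
  fixes K :: "('k, 'c) ring_scheme"
    and A :: "('k, 'o, 'm) lincat"
    and N :: nat
    and I :: "nat \<Rightarrow> 'o \<Rightarrow> 'o \<Rightarrow> 'm set"
  assumes "algebraically_closed K"
    and "linear_category K A"
    and "basic_category A"
    and "countable (obj A)"
    and "fin_dim_projectives_injectives K A"
    and "ideal_filtration K A N I"
    and "\<forall>i. semisimple_bimod K A (ideal_quot_bimod A (I i) (I (Suc i)))"
  shows "standards_are_summands K (conv_cat A N I) (obj A) first_order (entry_1l A N I) \<and>
         standards_are_summands K (conv_cat A N I) (obj A) second_order (entry_2l A I) \<and>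
         standards_are_summands K (opcat (conv_cat A N I)) (obj A) first_order (entry_1r A I) \<and>
         standards_are_summands K (opcat (conv_cat A N I)) (obj A) second_order (entry_2r A N I) \<and>
         quasi_hereditary K (conv_cat A N I) first_order \<and>
         quasi_hereditary K (conv_cat A N I) second_order"
proof -
  let ?I = "\<lambda>i x y. I i y x" and ?C = "conv_cat A N I"
  let ?D = "conv_cat (opcat A) N ?I"
  have L: "schurian_filtration K A N I"
    using schurian_filtrationI[OF assms(1-3,5,6)] assms(7) by (metis One_nat_def)
  interpret L: schurian_filtration K A N I by (rule L)
  interpret R: schurian_filtration K "opcat A" N ?I
    by (rule opcat_schurian_filtration[OF L])
      (use assms(5) in \<open>simp add: fin_dim_projectives_injectives_def\<close>)
  have op: "opcat ?C = relabel_cat flip ?D" by (rule opcat_conv_cat)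
  have opC: "linear_category K (opcat ?C)" by (rule opcat_linear_category[OF L.conv_cat_linear_category])
  have "catmod_iso K (opcat ?C) (standard K (opcat ?C) first_order (x, i)) (entry_1r A I i x)"
    if x: "x \<in> obj A" for x i
  proof -
    have x': "x \<in> obj (opcat A)" using x by (simp add: opcat_simps)
    show ?thesis
      using relabel_iso[OF R.second_standard_iso[OF x' R.N_pos[OF x'], of "- i"], of flip]
      unfolding op relabel_standard[OF flip_flip] flip_orders relabel_entry_1r by (simp add: flip_def)
  qed
  moreover have "catmod_iso K (opcat ?C) (standard K (opcat ?C) second_order (x, i)) (entry_2r A N I i x)"
    if x: "x \<in> obj A" for x i
  proof -
    have x': "x \<in> obj (opcat A)" using x by (simp add: opcat_simps)
    show ?thesis
      using relabel_iso[OF R.first_standard_iso[OF x', of "- i"], of flip]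
      unfolding op relabel_standard[OF flip_flip] flip_orders relabel_entry_2r by (simp add: flip_def)
  qed
  moreover have "left_quasi_hereditary K (opcat ?C) first_order"
    unfolding op by (rule relabel_left_quasi_hereditary[OF flip_flip])
      (simp add: flip_orders R.left_quasi_hereditary_second)
  moreover have "left_quasi_hereditary K (opcat ?C) second_order"
    unfolding op by (rule relabel_left_quasi_hereditary[OF flip_flip])
      (simp add: flip_orders R.left_quasi_hereditary_first)
  ultimately show ?thesis
    unfolding quasi_hereditary_def
    using L.first_summands L.second_summands L.left_quasi_hereditary_first L.left_quasi_hereditary_second
      standards_are_summandsI[OF opC] by blast
qed

end
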